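(* The theory of the variety $\mathcal V_4$ has a model completion, which is axiomatized (together with the axioms of $\mathcal V_4$) by the density axiom D4 and the splitting axiom S4.
   Context: A co-Heyting algebra is a bounded distributive lattice $(L,\mathbf{0},\mathbf{1},\vee,\wedge)$ with a binary operation $-$ such that $a-b$ is the least $c\in L$ with $a\le b\vee c$, viewed as a structure in the language $\{\mathbf 0,\mathbf 1,\vee,\wedge,-\}$. For $a,b\in L$ write $b\ll a$ iff $a-b=a$ and $b\le a$, and $a\triangle b=(a-b)\vee(b-a)$. $\mathcal V_4$ is the variety of co-Heyting algebras satisfying both $\big(((\mathbf 1-x)\wedge x)-y\big)\wedge y=\mathbf 0$ and $(x-y)\wedge(y-x)\wedge(x\triangle(\mathbf 1-y))=\mathbf 0$. Model completion is in the usual model-theoretic sense. Axiom D4: for every $a$ with $a=\mathbf 1-(\mathbf 1-a)\neq\mathbf 0$ there is $b\ne\mathbf 0$ with $b\ll a$. Axiom S4: for all $a,b_1,b_2$ with $b_1\vee b_2\ll a\ne\mathbf 0$ and $b_1\wedge b_2\wedge(\mathbf 1-a)=\mathbf 0$ there are non-zero $a_1,a_2$ with $a-a_2=a_1\ge b_1$, $a-a_1=a_2\ge b_2$, and $a_1\wedge a_2=b_1\wedge b_2$. *)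

theory Defs
  imports Main
begin

section \<open>First-order logic in the language of co-Heyting algebras\<close>

datatype tm =
    Var nat
  | Bot                ("\<^bold>0")
  | Top                ("\<^bold>1")
  | Join tm tm         (infixl "\<^bold>\<squnion>" 65)
  | Meet tm tm         (infixl "\<^bold>\<sqinter>" 70)
  | Minus tm tm        (infixl "\<^bold>-" 65)

datatype fm =
    Eq tm tm           (infix "\<^bold>=" 50)
  | Neg fm             ("\<^bold>\<not> _" [40] 40)
  | And fm fm          (infixr "\<^bold>\<and>" 35)
  | Or fm fm           (infixr "\<^bold>\<or>" 30)
  | Imp fm fm          (infixr "\<^bold>\<longrightarrow>" 25)
  | All nat fm         ("\<^bold>\<forall>_./ _" [0, 10] 10)
  | Ex nat fm          ("\<^bold>\<exists>_./ _" [0, 10] 10)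

record 'a struc =
  carrier :: "'a set"
  zero :: 'a
  one :: 'a
  join :: "'a \<Rightarrow> 'a \<Rightarrow> 'a"
  meet :: "'a \<Rightarrow> 'a \<Rightarrow> 'a"
  minus :: "'a \<Rightarrow> 'a \<Rightarrow> 'a"

hide_const (open) carrier zero one join meet minus

definition is_struc :: "'a struc \<Rightarrow> bool" where
  "is_struc M \<longleftrightarrow>
     struc.zero M \<in> struc.carrier M \<and> struc.one M \<in> struc.carrier M \<and>
     (\<forall>x \<in> struc.carrier M. \<forall>y \<in> struc.carrier M.
        struc.join M x y \<in> struc.carrier M \<and>
        struc.meet M x y \<in> struc.carrier M \<and>
        struc.minus M x y \<in> struc.carrier M)"

primrec val :: "'a struc \<Rightarrow> (nat \<Rightarrow> 'a) \<Rightarrow> tm \<Rightarrow> 'a" where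
  "val M s (Var n) = s n"
| "val M s \<^bold>0 = struc.zero M"
| "val M s \<^bold>1 = struc.one M"
| "val M s (t \<^bold>\<squnion> u) = struc.join M (val M s t) (val M s u)"
| "val M s (t \<^bold>\<sqinter> u) = struc.meet M (val M s t) (val M s u)"
| "val M s (t \<^bold>- u) = struc.minus M (val M s t) (val M s u)"

primrec sat :: "'a struc \<Rightarrow> (nat \<Rightarrow> 'a) \<Rightarrow> fm \<Rightarrow> bool" where
  "sat M s (t \<^bold>= u) \<longleftrightarrow> val M s t = val M s u"
| "sat M s (\<^bold>\<not> p) \<longleftrightarrow> \<not> sat M s p"
| "sat M s (p \<^bold>\<and> q) \<longleftrightarrow> sat M s p \<and> sat M s q"
| "sat M s (p \<^bold>\<or> q) \<longleftrightarrow> sat M s p \<or> sat M s q"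
| "sat M s (p \<^bold>\<longrightarrow> q) \<longleftrightarrow> (sat M s p \<longrightarrow> sat M s q)"
| "sat M s (\<^bold>\<forall>n. p) \<longleftrightarrow> (\<forall>x \<in> struc.carrier M. sat M (s(n := x)) p)"
| "sat M s (\<^bold>\<exists>n. p) \<longleftrightarrow> (\<exists>x \<in> struc.carrier M. sat M (s(n := x)) p)"

definition models :: "'a struc \<Rightarrow> fm set \<Rightarrow> bool" where
  "models M T \<longleftrightarrow> is_struc M \<and>
     (\<forall>s. range s \<subseteq> struc.carrier M \<longrightarrow> (\<forall>p \<in> T. sat M s p))"

text \<open>The language has no relation symbols, so an embedding is an injective homomorphism.\<close>

definition embedding :: "('a \<Rightarrow> 'b) \<Rightarrow> 'a struc \<Rightarrow> 'b struc \<Rightarrow> bool" where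
  "embedding f M N \<longleftrightarrow>
     f ` struc.carrier M \<subseteq> struc.carrier N \<and> inj_on f (struc.carrier M) \<and>
     f (struc.zero M) = struc.zero N \<and> f (struc.one M) = struc.one N \<and>
     (\<forall>x \<in> struc.carrier M. \<forall>y \<in> struc.carrier M.
        f (struc.join M x y) = struc.join N (f x) (f y) \<and>
        f (struc.meet M x y) = struc.meet N (f x) (f y) \<and>
        f (struc.minus M x y) = struc.minus N (f x) (f y))"

text \<open>\<open>T'\<close> is a model completion of \<open>T\<close>: models of \<open>T'\<close> are models of \<open>T\<close>, every model of \<open>T\<close>
  embeds into a model of \<open>T'\<close>, and for every model \<open>M\<close> of \<open>T\<close> the theory \<open>T'\<close> together with the
  diagram of \<open>M\<close> is complete.  A model of \<open>T'\<close> and the diagram of \<open>M\<close> is a model \<open>N\<close> of \<open>T'\<close>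
  with an embedding \<open>f\<close> of \<open>M\<close> into \<open>N\<close>; a sentence with names for the elements of \<open>M\<close> is a
  formula \<open>p\<close> with an assignment \<open>s\<close> into \<open>M\<close>, to be evaluated in \<open>N\<close> under \<open>f \<circ> s\<close>.

  HOL cannot quantify over types inside a formula.  The structures which are universally
  quantified range over types that are parameters of the definition, to be left as type variables
  when the notion is asserted.  For the model into which \<open>M\<close> embeds, the type \<open>'a + nat\<close> is large
  enough, by the downward Loewenheim-Skolem theorem and because the language is countable.\<close>

definition model_completion ::
    "'a itself \<Rightarrow> 'b itself \<Rightarrow> 'c itself \<Rightarrow> fm set \<Rightarrow> fm set \<Rightarrow> bool" where
  "model_completion _ _ _ T T' \<longleftrightarrow>
     (\<forall>N :: 'b struc. models N T' \<longrightarrow> models N T) \<and>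
     (\<forall>M :: 'a struc. models M T \<longrightarrow>
        (\<exists>(N :: ('a + nat) struc) f. models N T' \<and> embedding f M N)) \<and>
     (\<forall>(M :: 'a struc) (N1 :: 'b struc) (N2 :: 'c struc) f1 f2.
        models M T \<longrightarrow> models N1 T' \<longrightarrow> embedding f1 M N1 \<longrightarrow>
        models N2 T' \<longrightarrow> embedding f2 M N2 \<longrightarrow>
        (\<forall>p s. range s \<subseteq> struc.carrier M \<longrightarrow> (sat N1 (f1 \<circ> s) p \<longleftrightarrow> sat N2 (f2 \<circ> s) p)))"


section \<open>The variety \<open>V\<^sub>4\<close> and the axioms D4 and S4\<close>

definition Le :: "tm \<Rightarrow> tm \<Rightarrow> fm" (infix "\<^bold>\<le>" 50) where
  "t \<^bold>\<le> u = (t \<^bold>\<sqinter> u \<^bold>= t)"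

definition Ll :: "tm \<Rightarrow> tm \<Rightarrow> fm" (infix "\<^bold>\<lless>" 50) where
  "t \<^bold>\<lless> u = (u \<^bold>- t \<^bold>= u \<^bold>\<and> t \<^bold>\<le> u)"

definition SymDiff :: "tm \<Rightarrow> tm \<Rightarrow> tm" (infixl "\<^bold>\<triangle>" 65) where
  "t \<^bold>\<triangle> u = (t \<^bold>- u) \<^bold>\<squnion> (u \<^bold>- t)"

definition coHeyting_theory :: "fm set" where
  "coHeyting_theory = (let x = Var 0; y = Var 1; z = Var 2 in
    {\<^bold>\<forall>0. \<^bold>\<forall>1. x \<^bold>\<squnion> y \<^bold>= y \<^bold>\<squnion> x,
     \<^bold>\<forall>0. \<^bold>\<forall>1. x \<^bold>\<sqinter> y \<^bold>= y \<^bold>\<sqinter> x,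
     \<^bold>\<forall>0. \<^bold>\<forall>1. \<^bold>\<forall>2. (x \<^bold>\<squnion> y) \<^bold>\<squnion> z \<^bold>= x \<^bold>\<squnion> (y \<^bold>\<squnion> z),
     \<^bold>\<forall>0. \<^bold>\<forall>1. \<^bold>\<forall>2. (x \<^bold>\<sqinter> y) \<^bold>\<sqinter> z \<^bold>= x \<^bold>\<sqinter> (y \<^bold>\<sqinter> z),
     \<^bold>\<forall>0. \<^bold>\<forall>1. x \<^bold>\<squnion> (x \<^bold>\<sqinter> y) \<^bold>= x,
     \<^bold>\<forall>0. \<^bold>\<forall>1. x \<^bold>\<sqinter> (x \<^bold>\<squnion> y) \<^bold>= x,
     \<^bold>\<forall>0. \<^bold>\<forall>1. \<^bold>\<forall>2. x \<^bold>\<sqinter> (y \<^bold>\<squnion> z) \<^bold>= (x \<^bold>\<sqinter> y) \<^bold>\<squnion> (x \<^bold>\<sqinter> z),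
     \<^bold>\<forall>0. \<^bold>0 \<^bold>\<le> x,
     \<^bold>\<forall>0. x \<^bold>\<le> \<^bold>1,
     \<^bold>\<forall>0. \<^bold>\<forall>1. x \<^bold>\<le> y \<^bold>\<squnion> (x \<^bold>- y) \<^bold>\<and> (\<^bold>\<forall>2. x \<^bold>\<le> y \<^bold>\<squnion> z \<^bold>\<longrightarrow> x \<^bold>- y \<^bold>\<le> z)})"

definition V4_theory :: "fm set" where
  "V4_theory = coHeyting_theory \<union> (let x = Var 0; y = Var 1 in
    {\<^bold>\<forall>0. \<^bold>\<forall>1. (((\<^bold>1 \<^bold>- x) \<^bold>\<sqinter> x) \<^bold>- y) \<^bold>\<sqinter> y \<^bold>= \<^bold>0,
     \<^bold>\<forall>0. \<^bold>\<forall>1. (x \<^bold>- y) \<^bold>\<sqinter> (y \<^bold>- x) \<^bold>\<sqinter> (x \<^bold>\<triangle> (\<^bold>1 \<^bold>- y)) \<^bold>= \<^bold>0})"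

definition D4 :: fm where
  "D4 = (let a = Var 0; b = Var 1 in
     \<^bold>\<forall>0. a \<^bold>= \<^bold>1 \<^bold>- (\<^bold>1 \<^bold>- a) \<^bold>\<and> \<^bold>\<not> (a \<^bold>= \<^bold>0) \<^bold>\<longrightarrow> (\<^bold>\<exists>1. \<^bold>\<not> (b \<^bold>= \<^bold>0) \<^bold>\<and> b \<^bold>\<lless> a))"

definition S4 :: fm where
  "S4 = (let a = Var 0; b1 = Var 1; b2 = Var 2; a1 = Var 3; a2 = Var 4 in
     \<^bold>\<forall>0. \<^bold>\<forall>1. \<^bold>\<forall>2.
       b1 \<^bold>\<squnion> b2 \<^bold>\<lless> a \<^bold>\<and> \<^bold>\<not> (a \<^bold>= \<^bold>0) \<^bold>\<and> b1 \<^bold>\<sqinter> b2 \<^bold>\<sqinter> (\<^bold>1 \<^bold>- a) \<^bold>= \<^bold>0 \<^bold>\<longrightarrow>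
       (\<^bold>\<exists>3. \<^bold>\<exists>4. \<^bold>\<not> (a1 \<^bold>= \<^bold>0) \<^bold>\<and> \<^bold>\<not> (a2 \<^bold>= \<^bold>0) \<^bold>\<and>
          a \<^bold>- a2 \<^bold>= a1 \<^bold>\<and> b1 \<^bold>\<le> a1 \<^bold>\<and> a \<^bold>- a1 \<^bold>= a2 \<^bold>\<and> b2 \<^bold>\<le> a2 \<^bold>\<and>
          a1 \<^bold>\<sqinter> a2 \<^bold>= b1 \<^bold>\<sqinter> b2))"


section \<open>The axioms read in a structure\<close>

text \<open>These lemmas are not used by the definitions; they confirm that the axioms, as formulas,
  have the intended meaning.\<close>

context
  fixes M :: "'a struc"
begin

private abbreviation "Z \<equiv> struc.zero M"
private abbreviation "I \<equiv> struc.one M"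
private abbreviation jn (infixl "\<squnion>" 65) where "x \<squnion> y \<equiv> struc.join M x y"
private abbreviation mt (infixl "\<sqinter>" 70) where "x \<sqinter> y \<equiv> struc.meet M x y"
private abbreviation mn (infixl "\<ominus>" 65) where "x \<ominus> y \<equiv> struc.minus M x y"
private abbreviation le (infix "\<sqsubseteq>" 50) where "x \<sqsubseteq> y \<equiv> x \<sqinter> y = x"

lemma sat_D4:
  "sat M s D4 \<longleftrightarrow> (\<forall>a \<in> struc.carrier M. a = I \<ominus> (I \<ominus> a) \<and> a \<noteq> Z \<longrightarrow>
     (\<exists>b \<in> struc.carrier M. b \<noteq> Z \<and> a \<ominus> b = a \<and> b \<sqsubseteq> a))"
  by (simp add: D4_def Let_def Ll_def Le_def)

lemma sat_S4:
  "sat M s S4 \<longleftrightarrow>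
     (\<forall>a \<in> struc.carrier M. \<forall>b1 \<in> struc.carrier M. \<forall>b2 \<in> struc.carrier M.
       a \<ominus> (b1 \<squnion> b2) = a \<and> b1 \<squnion> b2 \<sqsubseteq> a \<and> a \<noteq> Z \<and> b1 \<sqinter> b2 \<sqinter> (I \<ominus> a) = Z \<longrightarrow>
       (\<exists>a1 \<in> struc.carrier M. \<exists>a2 \<in> struc.carrier M. a1 \<noteq> Z \<and> a2 \<noteq> Z \<and>
          a \<ominus> a2 = a1 \<and> b1 \<sqsubseteq> a1 \<and> a \<ominus> a1 = a2 \<and> b2 \<sqsubseteq> a2 \<and> a1 \<sqinter> a2 = b1 \<sqinter> b2))"
  by (simp add: S4_def Let_def Ll_def Le_def)

lemma models_V4_theory:
  "models M V4_theory \<longleftrightarrow> models M coHeyting_theory \<and>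
     (\<forall>x \<in> struc.carrier M. \<forall>y \<in> struc.carrier M.
        (((I \<ominus> x) \<sqinter> x) \<ominus> y) \<sqinter> y = Z \<and>
        (x \<ominus> y) \<sqinter> (y \<ominus> x) \<sqinter> ((x \<ominus> (I \<ominus> y)) \<squnion> ((I \<ominus> y) \<ominus> x)) = Z)"
proof (cases "is_struc M")
  case True
  then have "\<exists>s :: nat \<Rightarrow> 'a. range s \<subseteq> struc.carrier M"
    by (intro exI[of _ "\<lambda>_. Z"]) (auto simp: is_struc_def)
  then show ?thesis
    by (auto simp: models_def V4_theory_def Let_def SymDiff_def)
qed (simp add: models_def)

end

lemma models_coHeyting_theory_class:
  fixes sub :: "'a \<Rightarrow> 'a \<Rightarrow> 'a :: {distrib_lattice, bounded_lattice}"
  shows "models \<lparr>struc.carrier = UNIV, zero = bot, one = top, join = sup, meet = inf, minus = sub\<rparr>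
           coHeyting_theory \<longleftrightarrow>
         (\<forall>a b. a \<le> sup b (sub a b) \<and> (\<forall>c. a \<le> sup b c \<longrightarrow> sub a b \<le> c))"
  by (simp add: models_def is_struc_def coHeyting_theory_def Let_def Le_def inf_sup_distrib1
      sup_commute inf_commute sup_left_commute inf_left_commute sup_assoc inf_assoc inf.absorb_iff1
      all_conj_distrib)

end

theory Submission
  imports Defs
begin

text \<open>The subdirectly irreducible algebras of \<open>V\<^sub>4\<close> embed into a five-element algebra with elements
  \<open>0 < m < l, r < 1\<close>, written \<open>F0, FM, FL, FR, F1\<close> below, so an algebra of \<open>V\<^sub>4\<close> is governed by its
  homomorphisms into this algebra.  A finite one is a finite multigraph: its vertices are the
  maximal join irreducible elements and its edges, with one or two end points, are the other ones.

  Elimination of quantifiers is a back-and-forth argument.  A finite relation between two models is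
  good if each homomorphism on one side is matched by one on the other side.  A good relation whose
  domain is a proper subalgebra of a finite algebra \<open>B\<close> can be extended by one of three
  moves: divide an edge (S4 with \<open>b\<^sub>1 = b\<^sub>2 = 0\<close>), add an edge below a vertex (S4 to make room, then
  D4), or, when \<open>B\<close> has no further edges, divide a vertex (S4 with \<open>b\<^sub>1\<close> and \<open>b\<^sub>2\<close> prescribing where
  the edges go).

  Witnesses for D4 and S4 are adjoined to an algebra \<open>M\<close> as Skolem terms, evaluated in the
  five-element algebra at a homomorphism of \<open>M\<close> and a sequence of random bits; the functions of
  homomorphism and bits that arise form a model of D4 and S4.\<close>

text \<open>The five elements are the up-sets of a three-point order: the two laws of the variety
  say that strictly below a prime filter there are at most two others, both minimal
  (\<open>prime_depth\<close>, \<open>prime_width\<close>). Working with homomorphisms into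
  \<open>a5\<close> avoids a duality for finite algebras, but it sees an edge only together with an
  order of its end points; hence the recurring alternative "equal, or equal after
  \<open>flip\<close>". What starts the back and forth is that homomorphisms into \<open>a5\<close>
  extend along embeddings (\<open>hom_extend\<close>). Dividing a vertex is left to the end because
  each edge at the vertex must be assigned to one half or to both, and S4 can prescribe this only
  for edges that already have partners. Room has to be made for a new edge because a witness of D4
  may otherwise consist of old edges. Each Skolem term has a bit of its own, which can be switched
  without changing the arguments of the term; this keeps the witnesses of D4 and S4
  non-zero.\<close>

unbundle lattice_syntax

section \<open>The five-element algebra\<close>

datatype a5 = F0 | FM | FL | FR | F1

instantiation a5 :: "{distrib_lattice, bounded_lattice, minus}"
begin

definition less_eq_a5 :: "a5 \<Rightarrow> a5 \<Rightarrow> bool" where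
  "x \<le> y \<longleftrightarrow> x = y \<or> x = F0 \<or> y = F1 \<or> (x = FM \<and> y \<noteq> F0)"

definition less_a5 :: "a5 \<Rightarrow> a5 \<Rightarrow> bool" where
  "(x :: a5) < y \<longleftrightarrow> x \<le> y \<and> x \<noteq> y"

definition sup_a5 :: "a5 \<Rightarrow> a5 \<Rightarrow> a5" where
  "x \<squnion> y = (if x \<le> y then y else if y \<le> x then x else F1)"

definition inf_a5 :: "a5 \<Rightarrow> a5 \<Rightarrow> a5" where
  "x \<sqinter> y = (if x \<le> y then x else if y \<le> x then y else FM)"

definition bot_a5 :: a5 where "\<bottom> = F0"

definition top_a5 :: a5 where "\<top> = F1"

definition minus_a5 :: "a5 \<Rightarrow> a5 \<Rightarrow> a5" where
  "x - y = (if x \<le> y then F0 else if y \<le> FM then x else if y = FL then FR else FL)"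

lemmas a5_defs = less_eq_a5_def less_a5_def sup_a5_def inf_a5_def bot_a5_def top_a5_def minus_a5_def

instance
proof
  fix x y z :: a5
  show "x < y \<longleftrightarrow> x \<le> y \<and> \<not> y \<le> x" by (cases x; cases y; simp add: a5_defs)
  show "x \<le> x" by (simp add: a5_defs)
  show "x \<le> y \<Longrightarrow> y \<le> z \<Longrightarrow> x \<le> z" by (cases x; cases y; cases z; simp add: a5_defs)
  show "x \<le> y \<Longrightarrow> y \<le> x \<Longrightarrow> x = y" by (cases x; cases y; simp add: a5_defs)
  show "x \<sqinter> y \<le> x" by (cases x; cases y; simp add: a5_defs)
  show "x \<sqinter> y \<le> y" by (cases x; cases y; simp add: a5_defs)
  show "x \<le> y \<Longrightarrow> x \<le> z \<Longrightarrow> x \<le> y \<sqinter> z" by (cases x; cases y; cases z; simp add: a5_defs)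
  show "x \<le> x \<squnion> y" by (cases x; cases y; simp add: a5_defs)
  show "y \<le> x \<squnion> y" by (cases x; cases y; simp add: a5_defs)
  show "y \<le> x \<Longrightarrow> z \<le> x \<Longrightarrow> y \<squnion> z \<le> x" by (cases x; cases y; cases z; simp add: a5_defs)
  show "x \<squnion> y \<sqinter> z = (x \<squnion> y) \<sqinter> (x \<squnion> z)" by (cases x; cases y; cases z; simp add: a5_defs)
  show "\<bottom> \<le> x" by (simp add: a5_defs)
  show "x \<le> \<top>" by (simp add: a5_defs)
qed

end

lemma UNIV_a5: "(UNIV :: a5 set) = {F0, FM, FL, FR, F1}"
  by (auto intro: a5.exhaust)

lemma a5_all: "(\<forall>x :: a5. P x) \<longleftrightarrow> P F0 \<and> P FM \<and> P FL \<and> P FR \<and> P F1"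
  using ball_UNIV[of P, unfolded UNIV_a5] by simp

instance a5 :: finite
  by standard (simp add: UNIV_a5)

primrec flip :: "a5 \<Rightarrow> a5" where
  "flip F0 = F0" | "flip FM = FM" | "flip FL = FR" | "flip FR = FL" | "flip F1 = F1"

text \<open>\<open>prL\<close> and \<open>prR\<close> lead from an edge to its two end points: they
  evaluate at one of the two minimal points of the three-point order whose up-sets form
  \<open>a5\<close>.\<close>

definition prL :: "a5 \<Rightarrow> a5" where "prL x = (if FL \<le> x then F1 else F0)"

definition prR :: "a5 \<Rightarrow> a5" where "prR x = (if FR \<le> x then F1 else F0)"

lemma flip_flip [simp]: "flip (flip x) = x"
  by (cases x) simp_all

definition hom :: "'a struc \<Rightarrow> ('a \<Rightarrow> a5) \<Rightarrow> bool" where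
  "hom N h \<longleftrightarrow> h (struc.zero N) = F0 \<and> h (struc.one N) = F1 \<and>
     (\<forall>x \<in> struc.carrier N. \<forall>y \<in> struc.carrier N.
        h (struc.join N x y) = h x \<squnion> h y \<and> h (struc.meet N x y) = h x \<sqinter> h y \<and>
        h (struc.minus N x y) = h x - h y)"

definition end5 :: "(a5 \<Rightarrow> a5) \<Rightarrow> bool" where
  "end5 f \<longleftrightarrow> f F0 = F0 \<and> f F1 = F1 \<and>
     (\<forall>x y. f (x \<squnion> y) = f x \<squnion> f y \<and> f (x \<sqinter> y) = f x \<sqinter> f y \<and> f (x - y) = f x - f y)"

lemma end5_flip: "end5 flip" and end5_prL: "end5 prL" and end5_prR: "end5 prR"
  by (simp_all add: end5_def a5_all prL_def prR_def a5_defs)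

lemma hom_end5: "hom N h \<Longrightarrow> end5 f \<Longrightarrow> hom N (\<lambda>x. f (h x))"
  by (simp add: hom_def end5_def)

lemmas hom_flip = hom_end5[OF _ end5_flip]
lemmas hom_prL = hom_end5[OF _ end5_prL]
lemmas hom_prR = hom_end5[OF _ end5_prR]

text \<open>Amounts to an embedding of \<open>N\<close> into a power of \<open>a5\<close>. It is
  equivalent to being a model of \<open>V4_theory\<close> (\<open>V4_separated\<close>), and it
  reduces equations in \<open>N\<close> to finite checks of values.\<close>

definition separated :: "'a struc \<Rightarrow> bool" where
  "separated N \<longleftrightarrow> is_struc N \<and>
    (\<forall>x \<in> struc.carrier N. \<forall>y \<in> struc.carrier N. (\<forall>h. hom N h \<longrightarrow> h x = h y) \<longrightarrow> x = y)"

lemma coHeyting_theoryD: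
  assumes "models N coHeyting_theory"
  shows "is_struc N"
    "(\<forall>x \<in> struc.carrier N. \<forall>y \<in> struc.carrier N. struc.join N x y = struc.join N y x)"
    "(\<forall>x \<in> struc.carrier N. \<forall>y \<in> struc.carrier N. struc.meet N x y = struc.meet N y x)"
    "(\<forall>x \<in> struc.carrier N. \<forall>y \<in> struc.carrier N. \<forall>z \<in> struc.carrier N.
      struc.join N (struc.join N x y) z = struc.join N x (struc.join N y z))"
    "(\<forall>x \<in> struc.carrier N. \<forall>y \<in> struc.carrier N. \<forall>z \<in> struc.carrier N.
      struc.meet N (struc.meet N x y) z = struc.meet N x (struc.meet N y z))"
    "(\<forall>x \<in> struc.carrier N. \<forall>y \<in> struc.carrier N. struc.join N x (struc.meet N x y) = x)"
    "(\<forall>x \<in> struc.carrier N. \<forall>y \<in> struc.carrier N. struc.meet N x (struc.join N x y) = x)"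
    "(\<forall>x \<in> struc.carrier N. \<forall>y \<in> struc.carrier N. \<forall>z \<in> struc.carrier N.
      struc.meet N x (struc.join N y z) = struc.join N (struc.meet N x y) (struc.meet N x z))"
    "(\<forall>x \<in> struc.carrier N. struc.meet N (struc.zero N) x = struc.zero N)"
    "(\<forall>x \<in> struc.carrier N. struc.meet N x (struc.one N) = x)"
    "(\<forall>x \<in> struc.carrier N. \<forall>y \<in> struc.carrier N.
      struc.meet N x (struc.join N y (struc.minus N x y)) = x \<and>
      (\<forall>z \<in> struc.carrier N. struc.meet N x (struc.join N y z) = x \<longrightarrow>
          struc.meet N (struc.minus N x y) z = struc.minus N x y))"
proof -
  have N: "is_struc N" using assms by (simp add: models_def)
  then have "range (\<lambda>_ :: nat. struc.zero N) \<subseteq> struc.carrier N"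
    by (auto simp: is_struc_def)
  then have *: "\<forall>p \<in> coHeyting_theory. sat N (\<lambda>_. struc.zero N) p"
    using assms unfolding models_def by blast
  note ** = *[unfolded coHeyting_theory_def Let_def Le_def ball_simps sat.simps val.simps
      fun_upd_apply, simplified num.distinct zero_neq_numeral]
  from ** N show "is_struc N"
    "(\<forall>x \<in> struc.carrier N. \<forall>y \<in> struc.carrier N. struc.join N x y = struc.join N y x)"
    "(\<forall>x \<in> struc.carrier N. \<forall>y \<in> struc.carrier N. struc.meet N x y = struc.meet N y x)"
    "(\<forall>x \<in> struc.carrier N. \<forall>y \<in> struc.carrier N. \<forall>z \<in> struc.carrier N.
      struc.join N (struc.join N x y) z = struc.join N x (struc.join N y z))"
    "(\<forall>x \<in> struc.carrier N. \<forall>y \<in> struc.carrier N. \<forall>z \<in> struc.carrier N.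
      struc.meet N (struc.meet N x y) z = struc.meet N x (struc.meet N y z))"
    "(\<forall>x \<in> struc.carrier N. \<forall>y \<in> struc.carrier N. struc.join N x (struc.meet N x y) = x)"
    "(\<forall>x \<in> struc.carrier N. \<forall>y \<in> struc.carrier N. struc.meet N x (struc.join N x y) = x)"
    "(\<forall>x \<in> struc.carrier N. \<forall>y \<in> struc.carrier N. \<forall>z \<in> struc.carrier N.
      struc.meet N x (struc.join N y z) = struc.join N (struc.meet N x y) (struc.meet N x z))"
    "(\<forall>x \<in> struc.carrier N. struc.meet N (struc.zero N) x = struc.zero N)"
    "(\<forall>x \<in> struc.carrier N. struc.meet N x (struc.one N) = x)"
    "(\<forall>x \<in> struc.carrier N. \<forall>y \<in> struc.carrier N.
      struc.meet N x (struc.join N y (struc.minus N x y)) = x \<and>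
      (\<forall>z \<in> struc.carrier N. struc.meet N x (struc.join N y z) = x \<longrightarrow>
          struc.meet N (struc.minus N x y) z = struc.minus N x y))"
    by simp_all
qed

text \<open>The axioms are identities and, for the minimality of the difference, one implication
  between identities; both pass from \<open>a5\<close> to subalgebras of its powers.\<close>

lemma separated_models_V4:
  assumes "separated N"
  shows "models N V4_theory"
proof -
  have N: "is_struc N" using assms by (simp add: separated_def)
  have c: "struc.zero N \<in> struc.carrier N" "struc.one N \<in> struc.carrier N"
    "\<And>x y. x \<in> struc.carrier N \<Longrightarrow> y \<in> struc.carrier N \<Longrightarrow> struc.join N x y \<in> struc.carrier N"
    "\<And>x y. x \<in> struc.carrier N \<Longrightarrow> y \<in> struc.carrier N \<Longrightarrow> struc.meet N x y \<in> struc.carrier N"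
    "\<And>x y. x \<in> struc.carrier N \<Longrightarrow> y \<in> struc.carrier N \<Longrightarrow> struc.minus N x y \<in> struc.carrier N"
    using N by (auto simp: is_struc_def)
  have e: "x = y \<longleftrightarrow> (\<forall>h. hom N h \<longrightarrow> h x = h y)"
    if "x \<in> struc.carrier N" "y \<in> struc.carrier N" for x y
    using assms that by (auto simp: separated_def)
  have hs: "h (struc.zero N) = F0" "h (struc.one N) = F1"
    "\<And>x y. x \<in> struc.carrier N \<Longrightarrow> y \<in> struc.carrier N \<Longrightarrow> h (struc.join N x y) = h x \<squnion> h y"
    "\<And>x y. x \<in> struc.carrier N \<Longrightarrow> y \<in> struc.carrier N \<Longrightarrow> h (struc.meet N x y) = h x \<sqinter> h y"
    "\<And>x y. x \<in> struc.carrier N \<Longrightarrow> y \<in> struc.carrier N \<Longrightarrow> h (struc.minus N x y) = h x - h y"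
    if "hom N h" for h
    using that by (auto simp: hom_def)
  have i1: "x - y \<squnion> x \<sqinter> y = x" "F0 \<sqinter> x = F0" "F1 \<sqinter> x = x" for x y :: a5
    by (cases x; cases y; simp add: a5_defs)+
  have i2: "x \<sqinter> y \<squnion> x \<sqinter> z = x \<Longrightarrow> z \<sqinter> (x - y) = x - y" for x y z :: a5
    by (cases x; cases y; cases z; simp add: a5_defs)
  have i3: "((F1 - x) \<sqinter> x - y) \<sqinter> y = F0" for x y :: a5
    by (cases x; cases y; simp add: a5_defs)
  have i4: "(x - y) \<sqinter> (y - x) \<sqinter> ((x - (F1 - y)) \<squnion> ((F1 - y) - x)) = F0" for x y :: a5
    by (cases x; cases y; simp add: a5_defs)
  have "models N coHeyting_theory"
    unfolding models_def coHeyting_theory_def Let_def Le_def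
    by (simp add: N) (simp add: e c hs i1 i2 ac_simps inf_sup_distrib1)
  moreover have "\<forall>x \<in> struc.carrier N. \<forall>y \<in> struc.carrier N.
        struc.meet N (struc.minus N (struc.meet N (struc.minus N (struc.one N) x) x) y) y = struc.zero N \<and>
        struc.meet N (struc.meet N (struc.minus N x y) (struc.minus N y x))
          (struc.join N (struc.minus N x (struc.minus N (struc.one N) y)) (struc.minus N (struc.minus N (struc.one N) y) x)) = struc.zero N"
    by (simp add: e c hs i3 i4)
  ultimately show ?thesis
    unfolding models_V4_theory by blast
qed

section \<open>Prime filters and homomorphisms\<close>

locale coHeyting =
  fixes N :: "'a struc"
  assumes models: "models N coHeyting_theory"
begin

abbreviation "L \<equiv> struc.carrier N"
abbreviation "zer \<equiv> struc.zero N"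
abbreviation "one \<equiv> struc.one N"
abbreviation jn (infixl "\<oplus>" 65) where "x \<oplus> y \<equiv> struc.join N x y"
abbreviation mt (infixl "\<otimes>" 70) where "x \<otimes> y \<equiv> struc.meet N x y"
abbreviation mn (infixl "\<ominus>" 65) where "x \<ominus> y \<equiv> struc.minus N x y"

definition le (infix "\<sqsubseteq>" 50) where "x \<sqsubseteq> y \<longleftrightarrow> x \<otimes> y = x"

lemmas axioms = coHeyting_theoryD[OF models]

lemma closed [simp, intro]:
  "zer \<in> L" "one \<in> L"
  "x \<in> L \<Longrightarrow> y \<in> L \<Longrightarrow> x \<oplus> y \<in> L"
  "x \<in> L \<Longrightarrow> y \<in> L \<Longrightarrow> x \<otimes> y \<in> L"
  "x \<in> L \<Longrightarrow> y \<in> L \<Longrightarrow> x \<ominus> y \<in> L"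
  using axioms(1) by (simp_all add: is_struc_def)

lemma jn_comm: "x \<in> L \<Longrightarrow> y \<in> L \<Longrightarrow> x \<oplus> y = y \<oplus> x"
  using axioms(2) unfolding le_def by blast

lemma mt_comm: "x \<in> L \<Longrightarrow> y \<in> L \<Longrightarrow> x \<otimes> y = y \<otimes> x"
  using axioms(3) unfolding le_def by blast

lemma mt_assoc: "x \<in> L \<Longrightarrow> y \<in> L \<Longrightarrow> z \<in> L \<Longrightarrow> (x \<otimes> y) \<otimes> z = x \<otimes> (y \<otimes> z)"
  using axioms(5) unfolding le_def by blast

lemma jn_absorb: "x \<in> L \<Longrightarrow> y \<in> L \<Longrightarrow> x \<oplus> (x \<otimes> y) = x"
  using axioms(6) unfolding le_def by blast

lemma mt_absorb: "x \<in> L \<Longrightarrow> y \<in> L \<Longrightarrow> x \<otimes> (x \<oplus> y) = x"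
  using axioms(7) unfolding le_def by blast

lemma mt_distrib: "x \<in> L \<Longrightarrow> y \<in> L \<Longrightarrow> z \<in> L \<Longrightarrow> x \<otimes> (y \<oplus> z) = (x \<otimes> y) \<oplus> (x \<otimes> z)"
  using axioms(8) unfolding le_def by blast

lemma zer_le: "x \<in> L \<Longrightarrow> zer \<sqsubseteq> x"
  using axioms(9) unfolding le_def by blast

lemma le_one: "x \<in> L \<Longrightarrow> x \<sqsubseteq> one"
  using axioms(10) unfolding le_def by blast

lemma le_jn_mn: "x \<in> L \<Longrightarrow> y \<in> L \<Longrightarrow> x \<sqsubseteq> y \<oplus> (x \<ominus> y)"
  using axioms(11) unfolding le_def by blast

lemma mn_le: "x \<in> L \<Longrightarrow> y \<in> L \<Longrightarrow> z \<in> L \<Longrightarrow> x \<sqsubseteq> y \<oplus> z \<Longrightarrow> x \<ominus> y \<sqsubseteq> z"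
  using axioms(11) unfolding le_def by blast

lemma mt_idem: "x \<in> L \<Longrightarrow> x \<otimes> x = x"
  by (metis closed(4) jn_absorb mt_absorb)

lemma le_refl: "x \<in> L \<Longrightarrow> x \<sqsubseteq> x"
  by (simp add: le_def mt_idem)

lemma le_trans: "x \<in> L \<Longrightarrow> y \<in> L \<Longrightarrow> z \<in> L \<Longrightarrow> x \<sqsubseteq> y \<Longrightarrow> y \<sqsubseteq> z \<Longrightarrow> x \<sqsubseteq> z"
  unfolding le_def by (metis mt_assoc)

lemma le_antisym: "x \<in> L \<Longrightarrow> y \<in> L \<Longrightarrow> x \<sqsubseteq> y \<Longrightarrow> y \<sqsubseteq> x \<Longrightarrow> x = y"
  unfolding le_def by (metis mt_comm)

lemma mt_le1: "x \<in> L \<Longrightarrow> y \<in> L \<Longrightarrow> x \<otimes> y \<sqsubseteq> x"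
  unfolding le_def by (metis mt_assoc mt_comm mt_idem)

lemma mt_le2: "x \<in> L \<Longrightarrow> y \<in> L \<Longrightarrow> x \<otimes> y \<sqsubseteq> y"
  unfolding le_def by (metis mt_assoc mt_idem)

lemma le_mt: "x \<in> L \<Longrightarrow> y \<in> L \<Longrightarrow> z \<in> L \<Longrightarrow> z \<sqsubseteq> x \<Longrightarrow> z \<sqsubseteq> y \<Longrightarrow> z \<sqsubseteq> x \<otimes> y"
  unfolding le_def by (metis mt_assoc)

lemma le_jn1: "x \<in> L \<Longrightarrow> y \<in> L \<Longrightarrow> x \<sqsubseteq> x \<oplus> y"
  by (simp add: le_def mt_absorb)

lemma le_jn2: "x \<in> L \<Longrightarrow> y \<in> L \<Longrightarrow> y \<sqsubseteq> x \<oplus> y"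
  by (metis jn_comm le_jn1)

lemma jn_le: "x \<in> L \<Longrightarrow> y \<in> L \<Longrightarrow> z \<in> L \<Longrightarrow> x \<sqsubseteq> z \<Longrightarrow> y \<sqsubseteq> z \<Longrightarrow> x \<oplus> y \<sqsubseteq> z"
  unfolding le_def by (metis closed(3) mt_comm mt_distrib)

lemma jn_mono:
  assumes L: "x \<in> L" "y \<in> L" "u \<in> L" "v \<in> L" and le: "x \<sqsubseteq> u" "y \<sqsubseteq> v"
  shows "x \<oplus> y \<sqsubseteq> u \<oplus> v"
proof (rule jn_le)
  show "x \<sqsubseteq> u \<oplus> v" using L le_trans[of x u "u \<oplus> v"] le(1) le_jn1[of u v] by simp
  show "y \<sqsubseteq> u \<oplus> v" using L le_trans[of y v "u \<oplus> v"] le(2) le_jn2[of u v] by simp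
qed (use L in simp_all)

lemma mt_mono:
  assumes L: "x \<in> L" "y \<in> L" "u \<in> L" "v \<in> L" and le: "x \<sqsubseteq> u" "y \<sqsubseteq> v"
  shows "x \<otimes> y \<sqsubseteq> u \<otimes> v"
proof (rule le_mt)
  show "x \<otimes> y \<sqsubseteq> u" using L le_trans[of "x \<otimes> y" x u] le(1) mt_le1[of x y] by simp
  show "x \<otimes> y \<sqsubseteq> v" using L le_trans[of "x \<otimes> y" y v] le(2) mt_le2[of x y] by simp
qed (use L in simp_all)

definition fltr :: "'a set \<Rightarrow> bool" where
  "fltr F \<longleftrightarrow> F \<subseteq> L \<and> one \<in> F \<and> (\<forall>x \<in> F. \<forall>y \<in> F. x \<otimes> y \<in> F) \<and>
     (\<forall>x \<in> F. \<forall>y \<in> L. x \<sqsubseteq> y \<longrightarrow> y \<in> F)"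

definition idl :: "'a set \<Rightarrow> bool" where
  "idl J \<longleftrightarrow> J \<subseteq> L \<and> zer \<in> J \<and> (\<forall>x \<in> J. \<forall>y \<in> J. x \<oplus> y \<in> J) \<and>
     (\<forall>x \<in> J. \<forall>y \<in> L. y \<sqsubseteq> x \<longrightarrow> y \<in> J)"

definition prime :: "'a set \<Rightarrow> bool" where
  "prime F \<longleftrightarrow> fltr F \<and> zer \<notin> F \<and> (\<forall>x \<in> L. \<forall>y \<in> L. x \<oplus> y \<in> F \<longrightarrow> x \<in> F \<or> y \<in> F)"

text \<open>The prime filter theorem. A filter that is maximal among those containing
  \<open>F\<close> and avoiding \<open>J\<close> is prime: adjoining either of two elements outside
  it produces an element of \<open>J\<close>, and distributivity combines these into one for the
  join.\<close>

lemma prime_exists: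
  assumes F: "fltr F" and J: "idl J" and disj: "F \<inter> J = {}"
  shows "\<exists>G. prime G \<and> F \<subseteq> G \<and> G \<inter> J = {}"
proof -
  let ?A = "{G. fltr G \<and> F \<subseteq> G \<and> G \<inter> J = {}}"
  have "\<exists>G \<in> ?A. \<forall>X \<in> ?A. G \<subseteq> X \<longrightarrow> X = G"
  proof (rule subset_Zorn_nonempty)
    show "?A \<noteq> {}" using F disj by blast
    show "\<Union>C \<in> ?A" if "C \<noteq> {}" "subset.chain ?A C" for C
    proof -
      have C: "G \<in> C \<Longrightarrow> fltr G \<and> F \<subseteq> G \<and> G \<inter> J = {}" for G
        using that(2) by (auto simp: subset.chain_def)
      have "x \<otimes> y \<in> \<Union>C" if x: "x \<in> \<Union>C" and y: "y \<in> \<Union>C" for x y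
      proof -
        obtain G H where "G \<in> C" "x \<in> G" "H \<in> C" "y \<in> H" using x y by blast
        moreover have "G \<subseteq> H \<or> H \<subseteq> G"
          using \<open>subset.chain ?A C\<close> calculation by (auto simp: subset_chain_def)
        ultimately show ?thesis
          using C unfolding fltr_def by (meson UnionI subsetD)
      qed
      moreover have "one \<in> \<Union>C" "\<Union>C \<subseteq> L" "F \<subseteq> \<Union>C" "\<Union>C \<inter> J = {}"
        using C \<open>C \<noteq> {}\<close> unfolding fltr_def by blast+
      moreover have "y \<in> \<Union>C" if "x \<in> \<Union>C" "y \<in> L" "x \<sqsubseteq> y" for x y
        using C that unfolding fltr_def by blast
      ultimately show ?thesis by (simp add: fltr_def)
    qed
  qed
  then obtain G where "G \<in> ?A" and *: "\<forall>X \<in> ?A. G \<subseteq> X \<longrightarrow> X = G" by (rule bexE)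
  then have G: "fltr G" "F \<subseteq> G" "G \<inter> J = {}" by simp_all
  have max: "X = G" if "fltr X" "F \<subseteq> X" "X \<inter> J = {}" "G \<subseteq> X" for X
    using * that by simp
  have GL: "g \<in> L" if "g \<in> G" for g using G(1) that by (auto simp: fltr_def)
  have JL: "g \<in> L" if "g \<in> J" for g using J that by (auto simp: idl_def)
  have ex: "\<exists>g \<in> G. g \<otimes> x \<in> J" if x: "x \<in> L" "x \<notin> G" for x
  proof (rule ccontr)
    assume no: "\<not> ?thesis"
    define X where "X = {y \<in> L. \<exists>g \<in> G. g \<otimes> x \<sqsubseteq> y}"
    have "fltr X"
      unfolding fltr_def
    proof (intro conjI ballI impI)
      show "one \<in> X" using G(1) x by (auto simp: X_def fltr_def intro!: bexI[of _ one] le_one)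
      fix u assume u: "u \<in> X"
      show "u \<otimes> v \<in> X" if v: "v \<in> X" for v
      proof -
        obtain g h where gh: "g \<in> G" "g \<otimes> x \<sqsubseteq> u" "h \<in> G" "h \<otimes> x \<sqsubseteq> v" "u \<in> L" "v \<in> L"
          using u v by (auto simp: X_def)
        have L: "g \<in> L" "h \<in> L" using gh GL by auto
        have "(g \<otimes> h) \<otimes> x \<sqsubseteq> g \<otimes> x" "(g \<otimes> h) \<otimes> x \<sqsubseteq> h \<otimes> x"
          using L x by (simp_all add: mt_mono mt_le1 mt_le2 le_refl)
        then have "(g \<otimes> h) \<otimes> x \<sqsubseteq> u" "(g \<otimes> h) \<otimes> x \<sqsubseteq> v"
          using le_trans[OF _ _ gh(5) _ gh(2)] le_trans[OF _ _ gh(6) _ gh(4)] L x by simp_all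
        then have "(g \<otimes> h) \<otimes> x \<sqsubseteq> u \<otimes> v"
          using gh L x by (simp add: le_mt)
        moreover have "g \<otimes> h \<in> G" using G(1) gh by (simp add: fltr_def)
        ultimately show ?thesis using gh by (auto simp: X_def)
      qed
      show "v \<in> X" if "v \<in> L" "u \<sqsubseteq> v" for v
        using u that x GL unfolding X_def by (auto intro: le_trans[of "_ \<otimes> x" u v])
    qed (auto simp: X_def)
    moreover have "G \<subseteq> X" using x GL by (auto simp: X_def intro: mt_le1)
    moreover have "X \<inter> J = {}"
      using no J x GL unfolding X_def idl_def by (auto; metis closed(4))
    ultimately have "X = G" using max G(2) by blast
    moreover have "x \<in> X" using x G(1) by (auto simp: X_def fltr_def intro!: bexI[of _ one] mt_le2)
    ultimately show False using x by blast
  qed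
  have "x \<in> G \<or> y \<in> G" if xy: "x \<in> L" "y \<in> L" "x \<oplus> y \<in> G" for x y
  proof (rule ccontr)
    assume "\<not> ?thesis"
    then obtain g h where gh: "g \<in> G" "g \<otimes> x \<in> J" "h \<in> G" "h \<otimes> y \<in> J"
      using ex xy by blast
    let ?k = "g \<otimes> h"
    have L: "g \<in> L" "h \<in> L" using gh GL by auto
    have "?k \<otimes> x \<sqsubseteq> g \<otimes> x" "?k \<otimes> y \<sqsubseteq> h \<otimes> y"
      using L xy by (simp_all add: mt_mono mt_le1 mt_le2 le_refl)
    then have "?k \<otimes> x \<in> J" "?k \<otimes> y \<in> J" using J gh L xy by (auto simp: idl_def)
    then have "?k \<otimes> (x \<oplus> y) \<in> J" using J L xy by (simp add: idl_def mt_distrib)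
    moreover have "?k \<otimes> (x \<oplus> y) \<in> G" using G(1) gh xy by (simp add: fltr_def)
    ultimately show False using G(3) by blast
  qed
  moreover have "zer \<notin> G" using G(3) J by (auto simp: idl_def)
  ultimately show ?thesis using G by (auto simp: prime_def)
qed

lemma prime_closed: "prime G \<Longrightarrow> G \<subseteq> L"
  by (simp add: prime_def fltr_def)

lemma prime_simps:
  assumes "prime G"
  shows "one \<in> G" "zer \<notin> G"
    "x \<in> L \<Longrightarrow> y \<in> L \<Longrightarrow> x \<oplus> y \<in> G \<longleftrightarrow> x \<in> G \<or> y \<in> G"
    "x \<in> L \<Longrightarrow> y \<in> L \<Longrightarrow> x \<otimes> y \<in> G \<longleftrightarrow> x \<in> G \<and> y \<in> G"
proof -
  show "one \<in> G" "zer \<notin> G" using assms by (simp_all add: prime_def fltr_def)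
  have up: "x \<in> G \<Longrightarrow> y \<in> L \<Longrightarrow> x \<sqsubseteq> y \<Longrightarrow> y \<in> G" for x y
    using assms by (auto simp: prime_def fltr_def)
  assume L: "x \<in> L" "y \<in> L"
  show "x \<oplus> y \<in> G \<longleftrightarrow> x \<in> G \<or> y \<in> G"
    using L up assms le_jn1 le_jn2 by (metis closed(3) prime_def)
  show "x \<otimes> y \<in> G \<longleftrightarrow> x \<in> G \<and> y \<in> G"
    using L up assms mt_le1 mt_le2 by (metis closed(4) fltr_def prime_def)
qed

lemma prime_up: "prime G \<Longrightarrow> x \<in> G \<Longrightarrow> y \<in> L \<Longrightarrow> x \<sqsubseteq> y \<Longrightarrow> y \<in> G"
  by (auto simp: prime_def fltr_def)

text \<open>Among the prime filters ordered by inclusion an element is an up-set, and the difference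
  is the up-closure of the set difference. For the hard direction a prime filter separates the
  filter above \<open>x\<close> from the ideal generated by \<open>y\<close> and the complement of
  \<open>F\<close>: a common element would give \<open>x \<sqsubseteq> y \<oplus> c\<close>, hence
  \<open>x \<ominus> y \<sqsubseteq> c\<close>, with \<open>c\<close> outside
  \<open>F\<close>.\<close>

lemma prime_mn:
  assumes F: "prime F" and L: "x \<in> L" "y \<in> L"
  shows "x \<ominus> y \<in> F \<longleftrightarrow> (\<exists>G. prime G \<and> G \<subseteq> F \<and> x \<in> G \<and> y \<notin> G)"
proof
  assume "\<exists>G. prime G \<and> G \<subseteq> F \<and> x \<in> G \<and> y \<notin> G"
  then obtain G where G: "prime G" "G \<subseteq> F" "x \<in> G" "y \<notin> G" by blast
  then have "y \<oplus> (x \<ominus> y) \<in> G" using L le_jn_mn prime_up[OF G(1,3)] by simp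
  then show "x \<ominus> y \<in> F" using G L prime_simps(3)[OF G(1)] by auto
next
  assume xy: "x \<ominus> y \<in> F"
  let ?J = "{z \<in> L. \<exists>c \<in> L - F. z \<sqsubseteq> y \<oplus> c}"
  let ?F = "{z \<in> L. x \<sqsubseteq> z}"
  have "fltr ?F"
    using L by (auto simp: fltr_def le_refl le_one intro: le_mt le_trans)
  moreover have "idl ?J"
    unfolding idl_def
  proof (intro conjI ballI impI)
    show "zer \<in> ?J" using L prime_simps(2)[OF F] by (auto intro!: bexI[of _ zer] zer_le)
    fix u assume u: "u \<in> ?J"
    show "u \<oplus> v \<in> ?J" if v: "v \<in> ?J" for v
    proof -
      obtain c d where cd: "c \<in> L" "d \<in> L" "c \<notin> F" "d \<notin> F" "u \<sqsubseteq> y \<oplus> c" "v \<sqsubseteq> y \<oplus> d"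
        "u \<in> L" "v \<in> L" using u v by blast
      have "y \<oplus> c \<sqsubseteq> y \<oplus> (c \<oplus> d)" "y \<oplus> d \<sqsubseteq> y \<oplus> (c \<oplus> d)"
        using cd L by (simp_all add: jn_mono le_refl le_jn1 le_jn2)
      then have "u \<sqsubseteq> y \<oplus> (c \<oplus> d)" "v \<sqsubseteq> y \<oplus> (c \<oplus> d)"
        using le_trans[OF _ _ _ cd(5)] le_trans[OF _ _ _ cd(6)] cd L by simp_all
      then have "u \<oplus> v \<sqsubseteq> y \<oplus> (c \<oplus> d)" using cd L by (simp add: jn_le)
      moreover have "c \<oplus> d \<notin> F" using cd prime_simps(3)[OF F] by simp
      ultimately show ?thesis using cd by auto
    qed
    show "v \<in> ?J" if "v \<in> L" "v \<sqsubseteq> u" for v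
      using u that L by (auto intro: le_trans[of v u])
  qed auto
  moreover have "?F \<inter> ?J = {}"
  proof (rule ccontr)
    assume "?F \<inter> ?J \<noteq> {}"
    then obtain z c where "z \<in> L" "x \<sqsubseteq> z" "c \<in> L" "c \<notin> F" "z \<sqsubseteq> y \<oplus> c" by auto
    then have "x \<ominus> y \<sqsubseteq> c" using L le_trans[of x z "y \<oplus> c"] by (simp add: mn_le)
    then show False using xy F \<open>c \<in> L\<close> \<open>c \<notin> F\<close> prime_up by blast
  qed
  ultimately obtain G where G: "prime G" "?F \<subseteq> G" "G \<inter> ?J = {}"
    using prime_exists by blast
  have "x \<in> G" using G(2) L le_refl by auto
  moreover have "y \<in> ?J" using L prime_simps(2)[OF F] by (auto intro!: bexI[of _ zer] le_jn1)
  then have "y \<notin> G" using G(3) by blast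
  moreover have "G \<subseteq> F"
  proof
    fix c assume c: "c \<in> G"
    then have "c \<in> L" using G(1) prime_closed by blast
    moreover have "c \<sqsubseteq> y \<oplus> c" using L calculation le_jn2 by blast
    ultimately show "c \<in> F" using c G(3) by blast
  qed
  ultimately show "\<exists>G. prime G \<and> G \<subseteq> F \<and> x \<in> G \<and> y \<notin> G" using G(1) by blast
qed

end

section \<open>Prime filters under the two laws of the variety\<close>

locale V4 = coHeyting +
  assumes V4_models: "models N V4_theory"
begin

lemma depth_law: "x \<in> L \<Longrightarrow> y \<in> L \<Longrightarrow> ((one \<ominus> x) \<otimes> x \<ominus> y) \<otimes> y = zer"
  using V4_models unfolding models_V4_theory by blast

lemma width_law:
  "x \<in> L \<Longrightarrow> y \<in> L \<Longrightarrow>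
    (x \<ominus> y) \<otimes> (y \<ominus> x) \<otimes> ((x \<ominus> (one \<ominus> y)) \<oplus> ((one \<ominus> y) \<ominus> x)) = zer"
  using V4_models unfolding models_V4_theory by blast

text \<open>Take \<open>x\<close> in \<open>G\<close> outside \<open>K\<close> and \<open>y\<close>
  in \<open>F\<close> outside \<open>G\<close>. Then \<open>K\<close> witnesses that
  \<open>one \<ominus> x\<close> is in \<open>G\<close>, and \<open>G\<close> witnesses that the
  left side of the first law, which is zero, is in \<open>F\<close>.\<close>

lemma prime_depth:
  assumes "prime F" "prime G" "prime K" "K \<subset> G" "G \<subset> F"
  shows False
proof -
  obtain x y where xy: "x \<in> G" "x \<notin> K" "y \<in> F" "y \<notin> G" using assms by blast
  have L: "x \<in> L" "y \<in> L" using xy assms prime_closed by blast+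
  have "one \<ominus> x \<in> G"
    using prime_mn[OF assms(2) _ L(1)] prime_simps(1) assms xy by (metis closed(2) psubset_imp_subset)
  then have "(one \<ominus> x) \<otimes> x \<in> G" using xy L prime_simps(4)[OF assms(2)] by simp
  then have "(one \<ominus> x) \<otimes> x \<ominus> y \<in> F"
    using prime_mn[OF assms(1)] L xy assms(2,5) by (metis closed(2,4,5) psubset_imp_subset)
  then have "((one \<ominus> x) \<otimes> x \<ominus> y) \<otimes> y \<in> F" using xy L prime_simps(4)[OF assms(1)] by simp
  then show False using depth_law[OF L] prime_simps(2)[OF assms(1)] by simp
qed

text \<open>By \<open>prime_depth\<close> the three primes are pairwise incomparable, so
  \<open>x\<close> can be chosen in \<open>G1\<close> only and \<open>y\<close> in \<open>G2\<close>
  only. Then \<open>G1\<close>, \<open>G2\<close> and \<open>G3\<close> witness one factor each of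
  the second law, whose left side would therefore be in \<open>F\<close>.\<close>

lemma prime_width:
  assumes F: "prime F" and G: "prime G1" "prime G2" "prime G3" "G1 \<subset> F" "G2 \<subset> F" "G3 \<subset> F"
    and ne: "G1 \<noteq> G2" "G1 \<noteq> G3" "G2 \<noteq> G3"
  shows False
proof -
  have inc: "\<exists>x. x \<in> G \<and> x \<notin> G' \<and> x \<notin> G''"
    if "prime G" "prime G'" "prime G''" "G \<subset> F" "G' \<subset> F" "G'' \<subset> F" "G \<noteq> G'" "G \<noteq> G''" for G G' G''
  proof -
    have "\<not> G \<subseteq> G'" "\<not> G \<subseteq> G''" using prime_depth[OF F] that by blast+
    then obtain u v where "u \<in> G" "u \<notin> G'" "v \<in> G" "v \<notin> G''" by blast
    moreover have "u \<in> L" "v \<in> L" using calculation that(1) prime_closed by blast+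
    ultimately show ?thesis using prime_simps(4) that by (metis closed(4))
  qed
  obtain x y where xy: "x \<in> G1" "x \<notin> G2" "x \<notin> G3" "y \<in> G2" "y \<notin> G1" "y \<notin> G3"
    using inc[of G1 G2 G3] inc[of G2 G1 G3] G ne by metis
  have L: "x \<in> L" "y \<in> L" using xy G prime_closed by blast+
  have mnF: "u \<ominus> v \<in> F" if "prime K" "K \<subset> F" "u \<in> K" "v \<notin> K" "u \<in> L" "v \<in> L" for u v K
    using prime_mn[OF F, of u v] that by blast
  have "x \<ominus> y \<in> F" "y \<ominus> x \<in> F" using mnF G xy L by blast+
  moreover have "one \<ominus> y \<in> G3"
    using prime_mn[OF G(3), of one y] xy L prime_simps(1)[OF G(3)] G(3) by auto
  then have "(one \<ominus> y) \<ominus> x \<in> F" using mnF[OF G(3,6)] xy L by simp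
  ultimately have "(x \<ominus> y) \<otimes> (y \<ominus> x) \<otimes> ((x \<ominus> (one \<ominus> y)) \<oplus> ((one \<ominus> y) \<ominus> x)) \<in> F"
    using L by (simp add: prime_simps[OF F])
  then show False using width_law[OF L] prime_simps(2)[OF F] by simp
qed

text \<open>Membership in \<open>F\<close> and in the at most two primes strictly below it
  distinguishes five cases, one for each element of \<open>a5\<close>; \<open>prime_mn\<close> shows
  that differences are respected.\<close>

lemma hom_of_prime:
  assumes F: "prime F"
  shows "\<exists>h. hom N h \<and> (\<forall>x \<in> L. h x = F0 \<longleftrightarrow> x \<notin> F)"
proof -
  \<comment> \<open>With fewer than two primes strictly below \<open>F\<close> the pair degenerates:
    \<open>G1 = G2 = F\<close> is a vertex, and a single lower prime taken twice is an edge with one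
    end point.\<close>
  obtain G1 G2 where G: "prime G1" "prime G2" "G1 \<subseteq> F" "G2 \<subseteq> F"
    and all: "\<And>G. prime G \<Longrightarrow> G \<subseteq> F \<Longrightarrow> G = F \<or> G = G1 \<or> G = G2"
    and min: "\<And>G. prime G \<Longrightarrow> G \<subseteq> G1 \<Longrightarrow> G = G1" "\<And>G. prime G \<Longrightarrow> G \<subseteq> G2 \<Longrightarrow> G = G2"
  proof (cases "\<exists>G. prime G \<and> G \<subset> F")
    case False
    then show ?thesis using that[of F F] F by blast
  next
    case True
    then obtain G where G: "prime G" "G \<subset> F" by blast
    show ?thesis
    proof (cases "\<exists>G'. prime G' \<and> G' \<subset> F \<and> G' \<noteq> G")
      case True
      then obtain G' where G': "prime G'" "G' \<subset> F" "G' \<noteq> G" by blast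
      show ?thesis
      proof (rule that[of G G'])
        show "K = F \<or> K = G \<or> K = G'" if "prime K" "K \<subseteq> F" for K
          using prime_width[OF F G(1) G'(1) that(1) G(2) G'(2)] G'(3) that by blast
        show "K = G" if "prime K" "K \<subseteq> G" for K
          using prime_depth[OF F G(1) that(1) _ G(2)] that by blast
        show "K = G'" if "prime K" "K \<subseteq> G'" for K
          using prime_depth[OF F G'(1) that(1) _ G'(2)] that by blast
      qed (use G G' in auto)
    next
      case False
      show ?thesis
      proof (rule that[of G G])
        show "K = F \<or> K = G \<or> K = G" if "prime K" "K \<subseteq> F" for K
          using False that by blast
        show "K = G" if "prime K" "K \<subseteq> G" for K
          using prime_depth[OF F G(1) that(1) _ G(2)] that by blast
        then show "K = G" if "prime K" "K \<subseteq> G" for K using that by blast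
      qed (use G in auto)
    qed
  qed
  define h where "h x = (if x \<notin> F then F0 else if x \<in> G1 then if x \<in> G2 then F1 else FL
    else if x \<in> G2 then FR else FM)" for x
  have mnF: "x \<ominus> y \<in> F \<longleftrightarrow> x \<in> F \<and> y \<notin> F \<or> x \<in> G1 \<and> y \<notin> G1 \<or> x \<in> G2 \<and> y \<notin> G2"
    if "x \<in> L" "y \<in> L" for x y
    using prime_mn[OF F that] all G F by blast
  have mn1: "x \<ominus> y \<in> G1 \<longleftrightarrow> x \<in> G1 \<and> y \<notin> G1" if "x \<in> L" "y \<in> L" for x y
    using prime_mn[OF G(1) that] min(1) G(1) by blast
  have mn2: "x \<ominus> y \<in> G2 \<longleftrightarrow> x \<in> G2 \<and> y \<notin> G2" if "x \<in> L" "y \<in> L" for x y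
    using prime_mn[OF G(2) that] min(2) G(2) by blast
  have sub: "x \<in> G1 \<Longrightarrow> x \<in> F" "x \<in> G2 \<Longrightarrow> x \<in> F" for x using G by auto
  have "hom N h"
    unfolding hom_def
  proof (intro conjI ballI)
    show "h zer = F0" "h one = F1"
      by (simp_all add: h_def prime_simps[OF F] prime_simps[OF G(1)] prime_simps[OF G(2)])
    fix x y assume L: "x \<in> L" "y \<in> L"
    note s = prime_simps(3,4)[OF F L] prime_simps(3,4)[OF G(1) L] prime_simps(3,4)[OF G(2) L]
      mnF[OF L] mn1[OF L] mn2[OF L]
    show "h (x \<oplus> y) = h x \<squnion> h y" "h (x \<otimes> y) = h x \<sqinter> h y" "h (x \<ominus> y) = h x - h y"
      using sub[of x] sub[of y] unfolding h_def s
      by (cases "x \<in> F"; cases "y \<in> F"; cases "x \<in> G1"; cases "x \<in> G2"; cases "y \<in> G1"; cases "y \<in> G2";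
          simp add: a5_defs)+
  qed
  moreover have "\<forall>x \<in> L. h x = F0 \<longleftrightarrow> x \<notin> F" by (simp add: h_def)
  ultimately show ?thesis by blast
qed

lemma not_le_hom:
  assumes "x \<in> L" "y \<in> L" "\<not> x \<sqsubseteq> y"
  shows "\<exists>h. hom N h \<and> h x \<noteq> F0 \<and> h y = F0"
proof -
  have "fltr {z \<in> L. x \<sqsubseteq> z}"
    using assms by (auto simp: fltr_def le_refl le_one intro: le_mt le_trans)
  moreover have "idl {z \<in> L. z \<sqsubseteq> y}"
    using assms by (auto simp: idl_def zer_le intro: jn_le le_trans)
  moreover have "{z \<in> L. x \<sqsubseteq> z} \<inter> {z \<in> L. z \<sqsubseteq> y} = {}"
    using assms le_trans[of x _ y] by auto
  ultimately obtain G where G: "prime G" "{z \<in> L. x \<sqsubseteq> z} \<subseteq> G" "G \<inter> {z \<in> L. z \<sqsubseteq> y} = {}"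
    using prime_exists by blast
  then have "x \<in> G" "y \<notin> G" using assms le_refl by auto
  then show ?thesis using hom_of_prime[OF G(1)] assms by blast
qed

lemma separated: "separated N"
  unfolding separated_def
proof (intro conjI ballI impI)
  show "is_struc N" by (rule axioms(1))
  fix x y assume "x \<in> L" "y \<in> L" "\<forall>h. hom N h \<longrightarrow> h x = h y"
  then show "x = y" using not_le_hom[of x y] not_le_hom[of y x] le_antisym by metis
qed

end

lemma V4_separated: "models N V4_theory \<longleftrightarrow> separated N"
proof
  assume "models N V4_theory"
  then have "V4 N" by unfold_locales (auto simp: models_V4_theory)
  then show "separated N" by (rule V4.separated)
qed (rule separated_models_V4)

section \<open>Homomorphisms that agree up to a flip, and their extension along embeddings\<close>

definition subalg :: "'a struc \<Rightarrow> 'a set \<Rightarrow> bool" where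
  "subalg N A \<longleftrightarrow> A \<subseteq> struc.carrier N \<and> struc.zero N \<in> A \<and> struc.one N \<in> A \<and>
     (\<forall>x \<in> A. \<forall>y \<in> A. struc.join N x y \<in> A \<and> struc.meet N x y \<in> A \<and> struc.minus N x y \<in> A)"

lemma subalg_closed:
  assumes "subalg N A"
  shows "struc.zero N \<in> A" "struc.one N \<in> A"
    "x \<in> A \<Longrightarrow> y \<in> A \<Longrightarrow> struc.join N x y \<in> A"
    "x \<in> A \<Longrightarrow> y \<in> A \<Longrightarrow> struc.meet N x y \<in> A"
    "x \<in> A \<Longrightarrow> y \<in> A \<Longrightarrow> struc.minus N x y \<in> A"
    "x \<in> A \<Longrightarrow> x \<in> struc.carrier N"
  using assms by (auto simp: subalg_def)

lemma hom_simps: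
  assumes "hom N h"
  shows "h (struc.zero N) = F0" "h (struc.one N) = F1"
    "x \<in> struc.carrier N \<Longrightarrow> y \<in> struc.carrier N \<Longrightarrow> h (struc.join N x y) = h x \<squnion> h y"
    "x \<in> struc.carrier N \<Longrightarrow> y \<in> struc.carrier N \<Longrightarrow> h (struc.meet N x y) = h x \<sqinter> h y"
    "x \<in> struc.carrier N \<Longrightarrow> y \<in> struc.carrier N \<Longrightarrow> h (struc.minus N x y) = h x - h y"
  using assms by (auto simp: hom_def)

text \<open>The weak hypothesis \<open>mid\<close> suffices because it can be applied to every term
  in elements of \<open>A\<close>; suitable terms pin down \<open>g\<close> on single elements up to
  a flip, and others show that the flip is the same for all of them.\<close>

lemma hom_eq_up_to_flip:
  assumes A: "subalg N A" and h: "hom N h" and g: "hom N g"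
    and z0: "z0 \<in> A" "h z0 \<noteq> F0" "h z0 \<noteq> F1"
    and mid: "\<And>x. x \<in> A \<Longrightarrow> h x = FM \<Longrightarrow> g x \<noteq> F0"
  shows "(\<forall>x \<in> A. g x = h x) \<or> (\<forall>x \<in> A. g x = flip (h x))"
proof -
  let ?one = "struc.one N" and ?jn = "struc.join N" and ?mt = "struc.meet N" and ?mn = "struc.minus N"
  note cl = subalg_closed[OF A]
  note hs = hom_simps[OF h] hom_simps[OF g] cl
  define e where "e = ?mt z0 (?mn ?one z0)"
  have e: "e \<in> A" "h e = FM"
    using z0 by (auto simp: e_def hs) (cases "h z0"; simp add: a5_defs)
  have ge: "g e = FM"
    using mid[OF e] z0(1) by (auto simp: e_def hs) (cases "g z0"; simp add: a5_defs)
  have 1: "g z = h z \<or> (h z = FL \<or> h z = FR) \<and> g z = flip (h z)" if z: "z \<in> A" for z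
  proof -
    let ?r = "?mn ?one (?mn ?one z)"
    \<comment> \<open>Since \<open>e\<close> has value \<open>FM\<close> at both homomorphisms,
      subtracting a term from \<open>e\<close> gives \<open>FM\<close> exactly where the term is
      \<open>F0\<close>. So \<open>mid\<close> also carries the vanishing of a term from
      \<open>h\<close> to \<open>g\<close>.\<close>
    have "FM - h z = FM \<longrightarrow> FM - g z \<noteq> F0"
      "FM - (F1 - h z) = FM \<longrightarrow> FM - (F1 - g z) \<noteq> F0"
      "FM - (F1 - (F1 - h z)) = FM \<longrightarrow> FM - (F1 - (F1 - g z)) \<noteq> F0"
      "FM \<sqinter> h z = FM \<longrightarrow> FM \<sqinter> g z \<noteq> F0"
      "h z \<sqinter> (F1 - h z) = FM \<longrightarrow> g z \<sqinter> (F1 - g z) \<noteq> F0"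
      "FM \<sqinter> (F1 - (F1 - h z)) = FM \<longrightarrow> FM \<sqinter> (F1 - (F1 - g z)) \<noteq> F0"
      using mid[of "?mn e z"] mid[of "?mn e (?mn ?one z)"] mid[of "?mn e ?r"] mid[of "?mt e z"]
        mid[of "?mt z (?mn ?one z)"] mid[of "?mt e ?r"] z e(1)
      by (simp_all add: hs e(2) ge)
    then show ?thesis by (cases "h z"; cases "g z"; simp add: a5_defs)
  qed
  have 2: "(h z = h y \<longrightarrow> g z = g y) \<and> (h z = F1 - h y \<longrightarrow> g z = F1 - g y)"
    if z: "z \<in> A" "h z = FL \<or> h z = FR" and y: "y \<in> A" "h y = FL \<or> h y = FR" for z y
  proof -
    \<comment> \<open>The symmetric difference vanishes at \<open>h\<close> when \<open>z\<close>
      and \<open>y\<close> have equal values, so \<open>g\<close> cannot flip one of them and keep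
      the other. The second row does the same for opposite values.\<close>
    have "FM - ((h z - h y) \<squnion> (h y - h z)) = FM \<longrightarrow> FM - ((g z - g y) \<squnion> (g y - g z)) \<noteq> F0"
      "FM - ((h z - (F1 - h y)) \<squnion> ((F1 - h y) - h z)) = FM \<longrightarrow>
        FM - ((g z - (F1 - g y)) \<squnion> ((F1 - g y) - g z)) \<noteq> F0"
      using mid[of "?mn e (?jn (?mn z y) (?mn y z))"]
        mid[of "?mn e (?jn (?mn z (?mn ?one y)) (?mn (?mn ?one y) z))"] z(1) y(1) e(1)
      by (simp_all add: hs e(2) ge)
    then show ?thesis using z(2) y(2) 1[OF z(1)] 1[OF y(1)]
      by (cases "h z"; cases "h y"; simp; elim disjE; simp add: a5_defs)
  qed
  show ?thesis
  proof (cases "\<exists>z \<in> A. g z \<noteq> h z")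
    case True
    then obtain z where z: "z \<in> A" "g z \<noteq> h z" by blast
    then have zz: "h z = FL \<or> h z = FR" "g z = flip (h z)" using 1 by blast+
    have "g y = flip (h y)" if y: "y \<in> A" for y
    proof (cases "h y = FL \<or> h y = FR")
      case True
      then show ?thesis using 2[OF z(1) zz(1) y True] zz True
        by (cases "h z"; cases "h y"; cases "g y"; simp add: a5_defs)
    next
      case False
      then show ?thesis using 1[OF y] by (cases "h y") auto
    qed
    then show ?thesis by blast
  qed blast
qed

text \<open>The source of amalgamation: \<open>a5\<close> behaves like an injective object. The
  elements where \<open>h\<close> is not \<open>F0\<close> form a prime filter of \<open>M\<close>,
  which is the trace of a prime filter of \<open>N\<close>. The homomorphism of the latter has the
  zero set of \<open>h\<close> on \<open>M\<close>, and a zero set determines a homomorphism up to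
  \<open>flip\<close>.\<close>

lemma hom_extend:
  assumes M: "models M V4_theory" and N: "models N V4_theory" and f: "embedding f M N"
    and h: "hom M h"
  shows "\<exists>k. hom N k \<and> (\<forall>x \<in> struc.carrier M. k (f x) = h x)"
proof -
  interpret M: V4 M using M by unfold_locales (auto simp: models_V4_theory)
  interpret N: V4 N using N by unfold_locales (auto simp: models_V4_theory)
  have fL: "x \<in> M.L \<Longrightarrow> f x \<in> N.L" for x using f by (auto simp: embedding_def)
  have fs: "f M.zer = N.zer" "f M.one = N.one"
    "\<And>x y. x \<in> M.L \<Longrightarrow> y \<in> M.L \<Longrightarrow> f (struc.join M x y) = struc.join N (f x) (f y)"
    "\<And>x y. x \<in> M.L \<Longrightarrow> y \<in> M.L \<Longrightarrow> f (struc.meet M x y) = struc.meet N (f x) (f y)"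
    "\<And>x y. x \<in> M.L \<Longrightarrow> y \<in> M.L \<Longrightarrow> f (struc.minus M x y) = struc.minus N (f x) (f y)"
    "\<And>x y. x \<in> M.L \<Longrightarrow> y \<in> M.L \<Longrightarrow> f x = f y \<longleftrightarrow> x = y"
    using f by (auto simp: embedding_def inj_on_def)
  note hs = hom_simps[OF h]
  let ?F = "{y \<in> N.L. \<exists>x \<in> M.L. h x \<noteq> F0 \<and> N.le (f x) y}"
  let ?J = "{y \<in> N.L. \<exists>x \<in> M.L. h x = F0 \<and> N.le y (f x)}"
  have F: "N.fltr ?F"
    unfolding N.fltr_def
  proof (intro conjI ballI impI)
    show "N.one \<in> ?F" by (auto intro!: bexI[of _ M.one] simp: hs fs N.le_refl)
    fix u assume u: "u \<in> ?F"
    show "struc.meet N u v \<in> ?F" if v: "v \<in> ?F" for v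
    proof -
      obtain x y where xy: "x \<in> M.L" "y \<in> M.L" "h x \<noteq> F0" "h y \<noteq> F0" "N.le (f x) u" "N.le (f y) v"
        "u \<in> N.L" "v \<in> N.L" using u v by blast
      have "h (struc.meet M x y) \<noteq> F0" using xy by (simp add: hs a5_defs)
      moreover have "N.le (f (struc.meet M x y)) (struc.meet N u v)"
        using xy by (simp add: fs fL N.mt_mono)
      ultimately show ?thesis using xy by auto
    qed
    show "v \<in> ?F" if "v \<in> N.L" "N.le u v" for v
    proof -
      obtain x where x: "x \<in> M.L" "h x \<noteq> F0" "N.le (f x) u" "u \<in> N.L" using u by blast
      then have "N.le (f x) v" using that N.le_trans[of "f x" u v] fL by simp
      then show ?thesis using x that by blast
    qed
  qed auto
  have J: "N.idl ?J"
    unfolding N.idl_def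
  proof (intro conjI ballI impI)
    show "N.zer \<in> ?J" by (auto intro!: bexI[of _ M.zer] simp: hs fs N.le_refl)
    fix u assume u: "u \<in> ?J"
    show "struc.join N u v \<in> ?J" if v: "v \<in> ?J" for v
    proof -
      obtain x y where xy: "x \<in> M.L" "y \<in> M.L" "h x = F0" "h y = F0" "N.le u (f x)" "N.le v (f y)"
        "u \<in> N.L" "v \<in> N.L" using u v by blast
      have "h (struc.join M x y) = F0" using xy by (simp add: hs a5_defs)
      moreover have "N.le (struc.join N u v) (f (struc.join M x y))"
        using xy by (simp add: fs fL N.jn_mono)
      ultimately show ?thesis using xy by auto
    qed
    show "v \<in> ?J" if "v \<in> N.L" "N.le v u" for v
    proof -
      obtain x where x: "x \<in> M.L" "h x = F0" "N.le u (f x)" "u \<in> N.L" using u by blast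
      then have "N.le v (f x)" using that N.le_trans[of v u "f x"] fL by simp
      then show ?thesis using x that by blast
    qed
  qed auto
  have "?F \<inter> ?J = {}"
  proof (rule ccontr)
    assume "?F \<inter> ?J \<noteq> {}"
    then obtain x y u where xy: "x \<in> M.L" "y \<in> M.L" "u \<in> N.L" "h x \<noteq> F0" "h y = F0"
      "N.le (f x) u" "N.le u (f y)" by blast
    then have "N.le (f x) (f y)" using N.le_trans[of "f x" u "f y"] fL by simp
    then have "struc.meet M x y = x" using xy fs(6)[of "struc.meet M x y" x] by (simp add: N.le_def fs)
    then have "h x = h x \<sqinter> h y" using hs(4)[OF xy(1,2)] by simp
    then show False using xy by (simp add: a5_defs split: if_splits)
  qed
  then obtain G where G: "N.prime G" "?F \<subseteq> G" "G \<inter> ?J = {}"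
    using N.prime_exists[OF F J] by blast
  obtain g where g: "hom N g" "\<forall>y \<in> N.L. g y = F0 \<longleftrightarrow> y \<notin> G" using N.hom_of_prime[OF G(1)] by blast
  have same: "g (f x) = F0 \<longleftrightarrow> h x = F0" if x: "x \<in> M.L" for x
  proof -
    have "f x \<in> N.L" "N.le (f x) (f x)" using fL[OF x] N.le_refl by auto
    then show ?thesis using G(2,3) g(2) x by blast
  qed
  have gf: "hom M (\<lambda>x. g (f x))"
    using hom_simps[OF g(1)] fL by (simp add: hom_def fs)
  show ?thesis
  proof (cases "\<exists>z \<in> M.L. h z \<noteq> F0 \<and> h z \<noteq> F1")
    case True
    then obtain z where z: "z \<in> M.L" "h z \<noteq> F0" "h z \<noteq> F1" by blast
    have "subalg M M.L" by (simp add: subalg_def)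
    from hom_eq_up_to_flip[OF this h gf z] same consider
      "\<forall>x \<in> M.L. g (f x) = h x" | "\<forall>x \<in> M.L. g (f x) = flip (h x)" by force
    then show ?thesis
    proof cases
      case 2
      then show ?thesis using hom_flip[OF g(1)] by (intro exI[of _ "\<lambda>x. flip (g x)"]) simp
    qed (use g in blast)
  next
    case False
    \<comment> \<open>If \<open>h\<close> takes only the values \<open>F0\<close> and
      \<open>F1\<close>, complements \<open>one - x\<close> turn the value \<open>F1\<close> into
      membership in the common zero set.\<close>
    have "g (f x) = h x" if x: "x \<in> M.L" for x
    proof (cases "h x = F0")
      case True
      then show ?thesis using same x by simp
    next
      case h0: False
      then have "h x = F1" using False x by blast
      then have "h (struc.minus M M.one x) = F0" using x by (simp add: hs a5_defs)
      then have "g (f (struc.minus M M.one x)) = F0" using same x by simp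
      then have "F1 - g (f x) = F0" using x by (simp add: fs hom_simps[OF g(1)] fL)
      then show ?thesis using \<open>h x = F1\<close>
        by (cases "g (f x)"; simp add: a5_defs)
    qed
    then show ?thesis using g(1) by blast
  qed
qed

section \<open>Back and forth\<close>

inductive_set generated :: "'a struc \<Rightarrow> 'a set \<Rightarrow> 'a set" for N X where
  base: "x \<in> X \<Longrightarrow> x \<in> generated N X"
| zero: "struc.zero N \<in> generated N X"
| one: "struc.one N \<in> generated N X"
| join: "x \<in> generated N X \<Longrightarrow> y \<in> generated N X \<Longrightarrow> struc.join N x y \<in> generated N X"
| meet: "x \<in> generated N X \<Longrightarrow> y \<in> generated N X \<Longrightarrow> struc.meet N x y \<in> generated N X"
| minus: "x \<in> generated N X \<Longrightarrow> y \<in> generated N X \<Longrightarrow> struc.minus N x y \<in> generated N X"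

lemma generated_closed:
  assumes "is_struc N" "X \<subseteq> struc.carrier N" "x \<in> generated N X"
  shows "x \<in> struc.carrier N"
  using assms(3) by induction (use assms(1,2) in \<open>auto simp: is_struc_def\<close>)

lemma generated_hom_eq:
  assumes N: "is_struc N" "X \<subseteq> struc.carrier N" and h: "hom N h" "hom N g" "\<forall>x \<in> X. h x = g x"
    and x: "x \<in> generated N X"
  shows "h x = g x"
  using x
  by induction (simp_all add: h hom_simps[OF h(1)] hom_simps[OF h(2)] generated_closed[OF N])

lemma subalg_generated:
  "is_struc N \<Longrightarrow> X \<subseteq> struc.carrier N \<Longrightarrow> subalg N (generated N X)"
  by (auto simp: subalg_def intro: generated.intros generated_closed)

lemma separatedD:
  "separated N \<Longrightarrow> x \<in> struc.carrier N \<Longrightarrow> y \<in> struc.carrier N \<Longrightarrow>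
    (\<And>h. hom N h \<Longrightarrow> h x = h y) \<Longrightarrow> x = y"
  by (auto simp: separated_def)

text \<open>An element of the generated subalgebra is determined by its values under the homomorphisms
  into \<^typ>\<open>a5\<close>, and these values depend only on the restriction to the finite set \<open>X\<close>.\<close>

lemma finite_generated:
  assumes N: "separated N" and X: "X \<subseteq> struc.carrier N" "finite X"
  shows "finite (generated N X)"
proof -
  have sN: "is_struc N" using N by (simp add: separated_def)
  let ?\<Phi> = "\<lambda>x. {((\<lambda>u. (u, h u)) ` X, h x) | h. hom N h}"
  have "inj_on ?\<Phi> (generated N X)"
  proof (rule inj_onI)
    fix x y assume x: "x \<in> generated N X" and y: "y \<in> generated N X" and eq: "?\<Phi> x = ?\<Phi> y"
    show "x = y"
    proof (rule separatedD[OF N])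
      fix h assume h: "hom N h"
      then have "((\<lambda>u. (u, h u)) ` X, h x) \<in> ?\<Phi> y" unfolding eq[symmetric] by blast
      then obtain g where g: "hom N g" "(\<lambda>u. (u, h u)) ` X = (\<lambda>u. (u, g u)) ` X" "h x = g y" by blast
      have "\<forall>u \<in> X. h u = g u" using g(2) by (auto simp: set_eq_iff image_iff)
      then show "h x = h y" using generated_hom_eq[OF sN X(1) h g(1) _ y] g(3) by simp
    qed (use generated_closed[OF sN X(1)] x y in auto)
  qed
  moreover have "?\<Phi> ` generated N X \<subseteq> Pow (Pow (X \<times> UNIV) \<times> UNIV)" by auto
  then have "finite (?\<Phi> ` generated N X)"
    by (rule finite_subset) (simp add: X(2) finite_cartesian_product)
  ultimately show ?thesis by (rule finite_imageD[rotated])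
qed

section \<open>Good relations and the extension moves\<close>

definition half :: "('a \<times> 'b) set \<Rightarrow> 'a struc \<Rightarrow> 'b struc \<Rightarrow> bool" where
  "half \<rho> N1 N2 \<longleftrightarrow> (\<forall>h. hom N1 h \<longrightarrow> (\<exists>k. hom N2 k \<and> (\<forall>(x, y) \<in> \<rho>. h x = k y)))"

text \<open>Stands in for an isomorphism between the generated subalgebras:
  \<open>val_eq_transfer\<close> reads equations off it, and pairs may be dropped at will
  (\<open>good_mono\<close>).\<close>

definition good :: "('a \<times> 'b) set \<Rightarrow> 'a struc \<Rightarrow> 'b struc \<Rightarrow> bool" where
  "good \<rho> N1 N2 \<longleftrightarrow> half \<rho> N1 N2 \<and> half (\<rho>\<inverse>) N2 N1"

lemma halfE:
  assumes "half \<rho> N1 N2" "hom N1 h"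
  obtains k where "hom N2 k" "\<And>x y. (x, y) \<in> \<rho> \<Longrightarrow> k y = h x"
  using assms by (fastforce simp: half_def)

lemma halfI:
  assumes "\<And>h. hom N1 h \<Longrightarrow> \<exists>k. hom N2 k \<and> (\<forall>x y. (x, y) \<in> \<rho> \<longrightarrow> k y = h x)"
  shows "half \<rho> N1 N2"
  using assms by (fastforce simp: half_def)

lemma half_mono: "half \<rho> N1 N2 \<Longrightarrow> \<sigma> \<subseteq> \<rho> \<Longrightarrow> half \<sigma> N1 N2"
  unfolding half_def by blast

lemma good_mono: "good \<rho> N1 N2 \<Longrightarrow> \<sigma> \<subseteq> \<rho> \<Longrightarrow> good \<sigma> N1 N2"
  unfolding good_def by (meson converse_mono half_mono)

text \<open>If \<open>E\<close> is the join of all edges of a subalgebra \<open>A\<close>, then the homomorphisms with \<open>h E = F0\<close>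
  restrict to the vertices of \<open>A\<close>, and the other ones to its edges; \<^const>\<open>flip\<close> exchanges the end
  points of an edge.\<close>

definition edge_bound :: "'a struc \<Rightarrow> 'a set \<Rightarrow> 'a \<Rightarrow> bool" where
  "edge_bound N A E \<longleftrightarrow> (\<forall>h. hom N h \<longrightarrow> (h E = F0 \<or> h E = FM) \<and>
     (h E = F0 \<longrightarrow> (\<forall>x \<in> A. h x = F0 \<or> h x = F1)))"

text \<open>Atoms are described through homomorphisms and not through the order, so that the
  property can be carried along a good relation. The homomorphisms that do not vanish at an
  undivided edge differ on \<open>A\<close> at most in the orientation of that edge.\<close>

definition edge_atom :: "'a struc \<Rightarrow> 'a set \<Rightarrow> 'a \<Rightarrow> bool" where
  "edge_atom N A e \<longleftrightarrow> (\<forall>h g. hom N h \<longrightarrow> hom N g \<longrightarrow> h e \<noteq> F0 \<longrightarrow> g e \<noteq> F0 \<longrightarrow>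
     (\<forall>x \<in> A. g x = h x) \<or> (\<forall>x \<in> A. g x = flip (h x)))"

definition vertex_atom :: "'a struc \<Rightarrow> 'a set \<Rightarrow> 'a \<Rightarrow> 'a \<Rightarrow> bool" where
  "vertex_atom N A E a \<longleftrightarrow> (\<forall>h g. hom N h \<longrightarrow> hom N g \<longrightarrow> h E = F0 \<longrightarrow> g E = F0 \<longrightarrow>
     h a \<noteq> F0 \<longrightarrow> g a \<noteq> F0 \<longrightarrow> (\<forall>x \<in> A. g x = h x))"

context
  fixes N1 :: "'a struc" and N2 :: "'b struc" and \<rho> :: "('a \<times> 'b) set"
  assumes good: "good \<rho> N1 N2"
begin

lemma half12: "half \<rho> N1 N2" and half21: "half (\<rho>\<inverse>) N2 N1"
  using good by (auto simp: good_def)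

lemma half21E:
  assumes "hom N2 k"
  obtains h where "hom N1 h" "\<And>x y. (x, y) \<in> \<rho> \<Longrightarrow> h x = k y"
  using halfE[OF half21 assms] by (metis converseI)

text \<open>In this and the next two lemmas a homomorphism of \<open>N2\<close> is pulled back to
  one of \<open>N1\<close> with the same values along \<open>\<rho>\<close>; the properties speak of
  such values only.\<close>

lemma edge_bound_transfer:
  assumes E: "(E, E') \<in> \<rho>" "edge_bound N1 (Domain \<rho>) E"
  shows "edge_bound N2 (Range \<rho>) E'"
  unfolding edge_bound_def
proof (intro allI impI)
  fix k assume "hom N2 k"
  then obtain h where h: "hom N1 h" "\<And>x y. (x, y) \<in> \<rho> \<Longrightarrow> h x = k y" by (rule half21E) blast
  then have "h E = k E'" using E by blast
  moreover have "k y = F0 \<or> k y = F1" if y: "y \<in> Range \<rho>" "h E = F0" for y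
  proof -
    obtain x where "(x, y) \<in> \<rho>" using y(1) by blast
    then have "x \<in> Domain \<rho>" "h x = k y" using h by auto
    then show ?thesis using E(2) h(1) y(2) unfolding edge_bound_def by metis
  qed
  ultimately show "(k E' = F0 \<or> k E' = FM) \<and> (k E' = F0 \<longrightarrow> (\<forall>x \<in> Range \<rho>. k x = F0 \<or> k x = F1))"
    using E(2) h(1) unfolding edge_bound_def by metis
qed

lemma edge_atom_transfer:
  assumes e: "(e, e') \<in> \<rho>" "edge_atom N1 (Domain \<rho>) e"
  shows "edge_atom N2 (Range \<rho>) e'"
  unfolding edge_atom_def
proof (intro allI impI)
  fix k l assume k: "hom N2 k" "k e' \<noteq> F0" and l: "hom N2 l" "l e' \<noteq> F0"
  obtain h where h: "hom N1 h" "\<And>x y. (x, y) \<in> \<rho> \<Longrightarrow> h x = k y" using half21E[OF k(1)] by blast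
  obtain g where g: "hom N1 g" "\<And>x y. (x, y) \<in> \<rho> \<Longrightarrow> g x = l y" using half21E[OF l(1)] by blast
  have "(\<forall>x \<in> Domain \<rho>. g x = h x) \<or> (\<forall>x \<in> Domain \<rho>. g x = flip (h x))"
    using e h g k l unfolding edge_atom_def by metis
  then show "(\<forall>x \<in> Range \<rho>. l x = k x) \<or> (\<forall>x \<in> Range \<rho>. l x = flip (k x))"
    using h(2) g(2) by (metis Domain.DomainI RangeE)
qed

lemma vertex_atom_transfer:
  assumes a: "(E, E') \<in> \<rho>" "(a, a') \<in> \<rho>" "vertex_atom N1 (Domain \<rho>) E a"
  shows "vertex_atom N2 (Range \<rho>) E' a'"
  unfolding vertex_atom_def
proof (intro allI impI)
  fix k l assume k: "hom N2 k" "k a' \<noteq> F0" "k E' = F0" and l: "hom N2 l" "l a' \<noteq> F0" "l E' = F0"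
  obtain h where h: "hom N1 h" "\<And>x y. (x, y) \<in> \<rho> \<Longrightarrow> h x = k y" using half21E[OF k(1)] by blast
  obtain g where g: "hom N1 g" "\<And>x y. (x, y) \<in> \<rho> \<Longrightarrow> g x = l y" using half21E[OF l(1)] by blast
  have "\<forall>x \<in> Domain \<rho>. g x = h x"
    using a h g k l unfolding vertex_atom_def by metis
  then show "\<forall>x \<in> Range \<rho>. l x = k x"
    using h(2) g(2) by (metis Domain.DomainI RangeE)
qed

text \<open>Every homomorphism through the undivided edge \<open>e'\<close> is right on
  \<open>\<rho>\<close> up to a flip, so it may be chosen by its value at \<open>y\<close>. That
  value is \<open>F0\<close> or \<open>FM\<close>, and the correcting flip does not disturb
  it.\<close>

lemma edge_split_half:
  assumes e: "(e, e') \<in> \<rho>" "edge_atom N2 (Range \<rho>) e'"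
    and d: "\<And>h. hom N1 h \<Longrightarrow> (h d = F0 \<or> h d = FM) \<and> h d \<le> h e"
    and y: "\<And>k. hom N2 k \<Longrightarrow> (k y = F0 \<or> k y = FM) \<and> k y \<le> k e'"
    and ex: "\<exists>k. hom N2 k \<and> k y \<noteq> F0" "\<exists>k. hom N2 k \<and> k e' \<noteq> F0 \<and> k y = F0"
  shows "half (insert (d, y) \<rho>) N1 N2"
proof (rule halfI)
  fix h assume h: "hom N1 h"
  obtain k where k: "hom N2 k" "\<And>x y. (x, y) \<in> \<rho> \<Longrightarrow> k y = h x" using halfE[OF half12 h] by blast
  show "\<exists>k. hom N2 k \<and> (\<forall>x z. (x, z) \<in> insert (d, y) \<rho> \<longrightarrow> k z = h x)"
  proof (cases "h e = F0")
    case True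
    then have "h d = F0" "k y = F0" using d[OF h] y[OF k(1)] k(2)[OF e(1)] by (auto simp: a5_defs)
    then show ?thesis using k by auto
  next
    case False
    have "\<exists>l. hom N2 l \<and> l y = h d \<and> l e' \<noteq> F0"
    proof (cases "h d = F0")
      case True
      then show ?thesis using ex(2) by metis
    next
      case False
      obtain l where l: "hom N2 l" "l y \<noteq> F0" using ex(1) by blast
      then have "l y = FM" "l e' \<noteq> F0" using y[OF l(1)] by (auto simp: a5_defs)
      then show ?thesis using l False d[OF h] by metis
    qed
    then obtain l where l: "hom N2 l" "l y = h d" "l e' \<noteq> F0" by blast
    have "k e' \<noteq> F0" using False k(2)[OF e(1)] by simp
    with e(2) k(1) l consider "\<forall>x \<in> Range \<rho>. l x = k x" | "\<forall>x \<in> Range \<rho>. l x = flip (k x)"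
      unfolding edge_atom_def by metis
    then show ?thesis
    proof cases
      case 1
      then have "l z = h x" if "(x, z) \<in> \<rho>" for x z using k(2)[OF that] that by (metis Range.RangeI)
      then show ?thesis using l by (intro exI[of _ l]) auto
    next
      case 2
      have "flip (l y) = h d" using d[OF h] l(2) by auto
      moreover have "flip (l z) = h x" if "(x, z) \<in> \<rho>" for x z
        using 2 k(2)[OF that] that by (metis Range.RangeI flip_flip)
      ultimately show ?thesis using hom_flip[OF l(1)] by (intro exI[of _ "\<lambda>x. flip (l x)"]) auto
    qed
  qed
qed

text \<open>Seen from \<open>\<rho>\<close> the new edge is a loop at the vertex \<open>a\<close>: a
  homomorphism through it looks like that vertex on all old elements.\<close>

lemma new_edge_half:
  assumes E: "(E, E') \<in> \<rho>" "edge_bound N1 (Domain \<rho>) E"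
    and a: "(a, a') \<in> \<rho>" "vertex_atom N2 (Range \<rho>) E' a'"
    and d: "\<And>h. hom N1 h \<Longrightarrow> h d = F0 \<or> h d = FM \<and> h E = F0 \<and> h a \<noteq> F0"
    and y: "\<And>k. hom N2 k \<Longrightarrow> k y = F0 \<or> k y = FM \<and> k E' = F0 \<and> k a' \<noteq> F0"
    and ex: "\<exists>k. hom N2 k \<and> k y \<noteq> F0"
  shows "half (insert (d, y) \<rho>) N1 N2"
proof (rule halfI)
  fix h assume h: "hom N1 h"
  obtain k where k: "hom N2 k" "\<And>x y. (x, y) \<in> \<rho> \<Longrightarrow> k y = h x" using halfE[OF half12 h] by blast
  note kE = k(2)[OF E(1)] k(2)[OF a(1)]
  show "\<exists>k. hom N2 k \<and> (\<forall>x z. (x, z) \<in> insert (d, y) \<rho> \<longrightarrow> k z = h x)"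
  proof (cases "h d = F0")
    case True
    show ?thesis
    proof (cases "h E = F0")
      case hE: True
      \<comment> \<open>\<open>k\<close> may run through the new edge \<open>y\<close> although
        \<open>h\<close> avoids \<open>d\<close>. Passing to an end point kills \<open>y\<close> and
        keeps the values on \<open>\<rho>\<close>, which are \<open>F0\<close> or \<open>F1\<close>
        here.\<close>
      have "prL (k z) = h x" if "(x, z) \<in> \<rho>" for x z
      proof -
        have "h x = F0 \<or> h x = F1" using E(2) h hE that unfolding edge_bound_def by blast
        then show ?thesis using k(2)[OF that] by (auto simp: prL_def a5_defs)
      qed
      moreover have "prL (k y) = h d" using y[OF k(1)] True by (auto simp: prL_def a5_defs)
      ultimately show ?thesis using hom_prL[OF k(1)] by (intro exI[of _ "\<lambda>x. prL (k x)"]) auto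
    next
      case False
      then have "k y = h d" using y[OF k(1)] kE True by auto
      then show ?thesis using k by auto
    qed
  next
    case False
    obtain l where l: "hom N2 l" "l y \<noteq> F0" using ex by blast
    then have ly: "l y = FM" "l E' = F0" "l a' \<noteq> F0" using y by blast+
    have "h d = FM" "k E' = F0" "k a' \<noteq> F0" using False d[OF h] kE by auto
    then have "\<forall>x \<in> Range \<rho>. l x = k x"
      using a(2) k(1) l(1) ly unfolding vertex_atom_def by blast
    then have "l z = h x" if "(x, z) \<in> \<rho>" for x z using k(2)[OF that] that by (metis Range.RangeI)
    then show ?thesis using l(1) ly(1) \<open>h d = FM\<close> by (intro exI[of _ l]) auto
  qed
qed

text \<open>\<open>p\<close> and \<open>q\<close> record which old edges end in \<open>r\<close> and
  which end in the rest of \<open>a\<close>. At an old edge they fix the value at \<open>r\<close>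
  up to a flip; at the vertex \<open>a\<close> either value is available, because both parts of
  \<open>a'\<close> are non-zero.\<close>

lemma vertex_split_half:
  assumes E: "(E, E') \<in> \<rho>" "edge_bound N1 (Domain \<rho>) E"
    and a: "(a, a') \<in> \<rho>" "vertex_atom N1 (Domain \<rho>) E a" "vertex_atom N2 (Range \<rho>) E' a'"
    and b: "(p, p') \<in> \<rho>" "(q, q') \<in> \<rho>"
    and r: "\<And>h. hom N1 h \<Longrightarrow> h r \<noteq> FM \<and> h a \<noteq> FM \<and> h r \<le> h a \<and> h r \<sqinter> (h a - h r) \<le> h E \<and>
      h p = h E \<sqinter> h r \<and> h q = h E \<sqinter> (h a - h r)"
    and y: "\<And>k. hom N2 k \<Longrightarrow> k y \<noteq> FM \<and> k a' \<noteq> FM \<and> k y \<le> k a' \<and> k y \<sqinter> (k a' - k y) \<le> k E' \<and>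
      k p' = k E' \<sqinter> k y \<and> k q' = k E' \<sqinter> (k a' - k y)"
    and ex: "\<exists>k. hom N2 k \<and> k y \<noteq> F0" "\<exists>k. hom N2 k \<and> k y \<noteq> k a'"
  shows "half (insert (r, y) \<rho>) N1 N2"
proof (rule halfI)
  fix h assume h: "hom N1 h"
  obtain k where k: "hom N2 k" "\<And>x y. (x, y) \<in> \<rho> \<Longrightarrow> k y = h x" using halfE[OF half12 h] by blast
  note kE = k(2)[OF E(1)] k(2)[OF a(1)] k(2)[OF b(1)] k(2)[OF b(2)]
  have hE: "h E = F0 \<or> h E = FM" using E(2) h unfolding edge_bound_def by blast
  show "\<exists>k. hom N2 k \<and> (\<forall>x z. (x, z) \<in> insert (r, y) \<rho> \<longrightarrow> k z = h x)"
  proof (cases "h E = F0")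
    case True
    have h01: "h x = F0 \<or> h x = F1" if "x \<in> Domain \<rho>" for x
      using E(2) h True that unfolding edge_bound_def by blast
    then have ha: "h a = F0 \<or> h a = F1" using a(1) by blast
    show ?thesis
    proof (cases "h a = F0")
      case ha0: True
      then have "h r = F0" "k y = F0" using r[OF h] y[OF k(1)] kE by (auto simp: a5_defs)
      then show ?thesis using k by auto
    next
      case False
      then have ha1: "h a = F1" using ha by blast
      then have hr: "h r = F0 \<or> h r = F1" using r[OF h] True
        by (cases "h r"; simp add: a5_defs)
      have "\<exists>l. hom N2 l \<and> l E' = F0 \<and> l a' \<noteq> F0 \<and> l y = h r"
      proof -
        obtain l where l: "hom N2 l" "if h r = F0 then l y \<noteq> l a' else l y \<noteq> F0"
          using ex by (cases "h r = F0") auto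
        have "l E' = F0 \<or> l E' = FM"
          using edge_bound_transfer[OF E] l(1) unfolding edge_bound_def by blast
        \<comment> \<open>\<open>l\<close> meets the wanted part of \<open>a'\<close>; if it is an
          edge, one of its end points is a vertex in that part.\<close>
        then have "prL (l E') = F0 \<and> prL (l a') \<noteq> F0 \<and> prL (l y) = h r \<or>
            prR (l E') = F0 \<and> prR (l a') \<noteq> F0 \<and> prR (l y) = h r"
          using l(2) y[OF l(1)] hr
          by (cases "l y"; cases "l a'"; simp add: prL_def prR_def a5_defs split: if_splits; elim disjE;
              simp add: a5_defs)
        then show ?thesis using hom_prL[OF l(1)] hom_prR[OF l(1)] by blast
      qed
      then obtain l where l: "hom N2 l" "l E' = F0" "l a' \<noteq> F0" "l y = h r" by blast
      have "k E' = F0" "k a' \<noteq> F0" using kE True ha1 by auto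
      then have "\<forall>x \<in> Range \<rho>. l x = k x"
        using a(3) k(1) l unfolding vertex_atom_def by blast
      then have "l z = h x" if "(x, z) \<in> \<rho>" for x z using k(2)[OF that] that by (metis Range.RangeI)
      then show ?thesis using l by (intro exI[of _ l]) auto
    qed
  next
    case False
    then have hE: "h E = FM" using hE by blast
    have "k y = h r \<or> h a = F1 \<and> k y = flip (h r)"
      using r[OF h] y[OF k(1)] kE hE
      by (cases "h r"; cases "h a"; cases "k y"; simp add: a5_defs)
    then show ?thesis
    proof
      assume "k y = h r"
      then show ?thesis using k by auto
    next
      assume *: "h a = F1 \<and> k y = flip (h r)"
      \<comment> \<open>Both end points of the edge lie in the undivided vertex \<open>a\<close>, so
        on the domain of \<open>\<rho>\<close> it is a loop and a flip does not show.\<close>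
      have "flip (k z) = h x" if "(x, z) \<in> \<rho>" for x z
      proof -
        have "prL (h E) = F0" "prR (h E) = F0" "prL (h a) \<noteq> F0" "prR (h a) \<noteq> F0"
          using hE * by (simp_all add: prL_def prR_def a5_defs)
        then have "prL (h x) = prR (h x)"
          using a(2) hom_prL[OF h] hom_prR[OF h] that unfolding vertex_atom_def by blast
        then have "flip (h x) = h x" by (cases "h x"; simp add: prL_def prR_def a5_defs)
        then show ?thesis using k(2)[OF that] by simp
      qed
      then show ?thesis using * hom_flip[OF k(1)] by (intro exI[of _ "\<lambda>x. flip (k x)"]) auto
    qed
  qed
qed

end

section \<open>Edges and vertices of finite subalgebras\<close>

lemma hom_minimal:
  assumes N: "separated N" and S: "finite S" "S \<noteq> {}" "S \<subseteq> struc.carrier N"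
  obtains m where "m \<in> S" "\<And>x. x \<in> S \<Longrightarrow> (\<And>h. hom N h \<Longrightarrow> h x \<le> h m) \<Longrightarrow> x = m"
proof -
  let ?R = "\<lambda>x y. x \<noteq> y \<and> (\<forall>h. hom N h \<longrightarrow> h x \<le> h y)"
  have eq: "x = y" if "x \<in> S" "y \<in> S" "\<forall>h. hom N h \<longrightarrow> h x \<le> h y" "\<forall>h. hom N h \<longrightarrow> h y \<le> h x" for x y
    by (rule separatedD[OF N]) (use that S(3) in \<open>auto intro: antisym\<close>)
  have "asymp_on S ?R"
  proof (intro asymp_onI notI)
    fix x y assume xy: "x \<in> S" "y \<in> S" "?R x y" "?R y x"
    show False using eq[OF xy(1,2)] xy(3,4) by simp
  qed
  moreover have "transp_on S ?R"
  proof (intro transp_onI)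
    fix x y z assume xyz: "x \<in> S" "y \<in> S" "z \<in> S" "?R x y" "?R y z"
    note le = conjunct2[OF xyz(4), rule_format] conjunct2[OF xyz(5), rule_format]
    have "x \<noteq> z"
    proof
      assume "x = z"
      then have "x = y" using eq[OF xyz(1,2)] le by simp
      then show False using xyz(4) by simp
    qed
    moreover have "h x \<le> h z" if "hom N h" for h
      using le(1)[OF that] le(2)[OF that] by (rule order_trans)
    ultimately show "?R x z" by simp
  qed
  ultimately have "\<exists>m \<in> S. \<forall>x \<in> S. x \<noteq> m \<longrightarrow> \<not> ?R x m"
    by (rule Finite_Set.bex_min_element[OF S(1) _ _ S(2)])
  then obtain m where m: "m \<in> S" "\<forall>x \<in> S. x \<noteq> m \<longrightarrow> \<not> ?R x m" by (rule bexE)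
  show ?thesis
  proof (rule that[OF m(1)])
    show "x = m" if "x \<in> S" "\<And>h. hom N h \<Longrightarrow> h x \<le> h m" for x
      using m(2) that by auto
  qed
qed

text \<open>In a separated structure these are the elements with \<open>1 - d = 1\<close>, and the
  regular ones below are those with \<open>r = 1 - (1 - r)\<close>, as in D4. Every \<open>z\<close>
  is the join of the regular \<open>1 - (1 - z)\<close> and the edgy
  \<open>z \<sqinter> (1 - z)\<close>.\<close>

definition edgy :: "'a struc \<Rightarrow> 'a \<Rightarrow> bool" where
  "edgy N d \<longleftrightarrow> (\<forall>h. hom N h \<longrightarrow> h d = F0 \<or> h d = FM)"

definition regular :: "'a struc \<Rightarrow> 'a \<Rightarrow> bool" where
  "regular N r \<longleftrightarrow> (\<forall>h. hom N h \<longrightarrow> h r \<noteq> FM)"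

lemma edgyD: "edgy N d \<Longrightarrow> hom N h \<Longrightarrow> h d = F0 \<or> h d = FM"
  by (simp add: edgy_def)

lemma regularD: "regular N d \<Longrightarrow> hom N h \<Longrightarrow> h d \<noteq> FM"
  by (simp add: regular_def)

lemma edgy_transfer:
  assumes "good \<rho> N1 N2" "(d, d') \<in> \<rho>" "edgy N1 d"
  shows "edgy N2 d'"
  unfolding edgy_def
proof (intro allI impI)
  fix k assume "hom N2 k"
  then obtain h where "hom N1 h" "\<And>x y. (x, y) \<in> \<rho> \<Longrightarrow> h x = k y" by (rule half21E[OF assms(1)]) blast
  then show "k d' = F0 \<or> k d' = FM" using assms(2,3) unfolding edgy_def by metis
qed

lemma regular_transfer:
  assumes "good \<rho> N1 N2" "(d, d') \<in> \<rho>" "regular N1 d"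
  shows "regular N2 d'"
  unfolding regular_def
proof (intro allI impI)
  fix k assume "hom N2 k"
  then obtain h where "hom N1 h" "\<And>x y. (x, y) \<in> \<rho> \<Longrightarrow> h x = k y" by (rule half21E[OF assms(1)]) blast
  then show "k d' \<noteq> FM" using assms(2,3) unfolding regular_def by metis
qed

lemma nonzero_transfer:
  assumes "separated N1" "good \<rho> N1 N2" "(d, d') \<in> \<rho>" "d \<in> struc.carrier N1" "d \<noteq> struc.zero N1"
  shows "d' \<noteq> struc.zero N2"
proof -
  have "struc.zero N1 \<in> struc.carrier N1" using assms(1) by (simp add: separated_def is_struc_def)
  then obtain h where h: "hom N1 h" "h d \<noteq> F0"
    using separatedD[OF assms(1,4)] assms(5) hom_simps(1) by metis
  then obtain k where "hom N2 k" "\<And>x y. (x, y) \<in> \<rho> \<Longrightarrow> k y = h x"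
    using halfE[of \<rho> N1 N2 h] assms(2) unfolding good_def by metis
  then show ?thesis using assms(3) h hom_simps(1) by metis
qed

lemma edge_boundI:
  assumes A: "subalg N A" and E: "edgy N E" "\<And>d h. d \<in> A \<Longrightarrow> edgy N d \<Longrightarrow> hom N h \<Longrightarrow> h d \<le> h E"
  shows "edge_bound N A E"
  unfolding edge_bound_def
proof (intro allI impI conjI ballI)
  fix h assume h: "hom N h"
  show "h E = F0 \<or> h E = FM" using E(1) h by (simp add: edgy_def)
  fix x assume x: "x \<in> A" and E0: "h E = F0"
  \<comment> \<open>This term takes only the values \<open>F0\<close> and \<open>FM\<close>, and it
    vanishes exactly where \<open>x\<close> is \<open>F0\<close> or \<open>F1\<close>.\<close>
  let ?d = "struc.meet N x (struc.minus N (struc.one N) x)"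
  note cl = subalg_closed[OF A]
  have v: "g ?d = g x \<sqinter> (F1 - g x)" if "hom N g" for g
    using x by (simp add: hom_simps[OF that] cl)
  have "edgy N ?d"
    unfolding edgy_def
  proof (intro allI impI)
    fix g assume g: "hom N g"
    then show "g ?d = F0 \<or> g ?d = FM" using v[OF g] by (cases "g x"; simp add: a5_defs)
  qed
  then have "h ?d \<le> F0" using E(2)[of ?d h] x h cl E0 by simp
  then show "h x = F0 \<or> h x = F1" using v[OF h] by (cases "h x"; simp add: a5_defs)
qed

lemma edge_bound_exists:
  assumes A: "subalg N A" "finite A"
  obtains E where "E \<in> A" "edgy N E" "\<And>d h. d \<in> A \<Longrightarrow> edgy N d \<Longrightarrow> hom N h \<Longrightarrow> h d \<le> h E"
proof -
  note cl = subalg_closed[OF A(1)]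
  have "\<exists>E \<in> A. edgy N E \<and> (\<forall>d \<in> S. \<forall>h. hom N h \<longrightarrow> h d \<le> h E)"
    if "finite S" "S \<subseteq> {d \<in> A. edgy N d}" for S
    using that
  proof (induction S)
    case empty
    show ?case using cl(1) by (intro bexI[of _ "struc.zero N"]) (auto simp: edgy_def hom_simps)
  next
    case (insert d S)
    then obtain E where E: "E \<in> A" "edgy N E" "\<forall>d \<in> S. \<forall>h. hom N h \<longrightarrow> h d \<le> h E" by auto
    let ?E = "struc.join N d E"
    have v: "h ?E = h d \<squnion> h E" if "hom N h" for h
      using insert.prems E(1) by (simp add: hom_simps[OF that] cl)
    have "edgy N ?E"
      using E(2) insert.prems by (auto simp: edgy_def v a5_defs)
    moreover have "\<forall>d' \<in> insert d S. \<forall>h. hom N h \<longrightarrow> h d' \<le> h ?E"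
      using E(3) by (auto simp: v intro: le_supI2)
    ultimately show ?case using E(1) insert.prems cl(3) by blast
  qed
  from this[of "{d \<in> A. edgy N d}"] show ?thesis using A(2) that by auto
qed

text \<open>The two lemmas below recognise the join irreducible elements of a finite subalgebra: an edge
  or a vertex which cannot be divided inside the subalgebra.\<close>

lemma edge_atomI:
  assumes A: "subalg N A" and e: "e \<in> A" "edgy N e"
    and atom: "\<And>z. z \<in> A \<Longrightarrow> edgy N z \<Longrightarrow> struc.meet N e z = e \<or> struc.minus N e z = e"
  shows "edge_atom N A e"
  unfolding edge_atom_def
proof (intro allI impI)
  fix h g assume h: "hom N h" "h e \<noteq> F0" and g: "hom N g" "g e \<noteq> F0"
  note cl = subalg_closed[OF A]
  have he: "h e = FM" using edgyD[OF e(2) h(1)] h(2) by blast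
  have "g x \<noteq> F0" if x: "x \<in> A" "h x = FM" for x
  proof -
    let ?z = "struc.meet N x (struc.minus N (struc.one N) x)"
    have v: "l ?z = l x \<sqinter> (F1 - l x)" if "hom N l" for l
      using x by (simp add: hom_simps[OF that] cl)
    have "edgy N ?z"
      unfolding edgy_def
    proof (intro allI impI)
      fix l assume l: "hom N l"
      then show "l ?z = F0 \<or> l ?z = FM" using v[OF l] by (cases "l x"; simp add: a5_defs)
    qed
    moreover have "?z \<in> A" using x cl by simp
    ultimately have "struc.meet N e ?z = e \<or> struc.minus N e ?z = e" using atom by blast
    moreover have "h (struc.minus N e ?z) = FM - FM"
      using hom_simps(5)[OF h(1), of e ?z] v[OF h(1)] x(2) he cl e(1) \<open>?z \<in> A\<close> by (simp add: a5_defs)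
    ultimately have "struc.meet N e ?z = e" using he by (auto simp: a5_defs)
    then have "g e = g e \<sqinter> g ?z" using hom_simps(4)[OF g(1), of e ?z] e(1) \<open>?z \<in> A\<close> cl by simp
    then show ?thesis using g(2) v[OF g(1)] by (auto simp: a5_defs)
  qed
  then show "(\<forall>x \<in> A. g x = h x) \<or> (\<forall>x \<in> A. g x = flip (h x))"
    using hom_eq_up_to_flip[OF A h(1) g(1) e(1)] he by simp
qed

lemma vertex_atomI:
  assumes A: "subalg N A" and E: "edge_bound N A E" and a: "a \<in> A"
    and atom: "\<And>z. z \<in> A \<Longrightarrow> regular N z \<Longrightarrow>
      struc.minus N (struc.one N) (struc.minus N (struc.one N) (struc.meet N a z)) = a \<or> struc.minus N a z = a"
  shows "vertex_atom N A E a"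
proof -
  note cl = subalg_closed[OF A]
  let ?mn = "struc.minus N" and ?one = "struc.one N"
  have *: False
    if h: "hom N h" "h a = F1" and g: "hom N g" "g a = F1" and x: "x \<in> A" "h x = F1" "g x = F0" for h g x
  proof -
    \<comment> \<open>The regular part of \<open>x\<close> still tells \<open>h\<close> and
      \<open>g\<close> apart; \<open>a\<close> inside it contradicts \<open>g\<close>, and
      \<open>a\<close> apart from it contradicts \<open>h\<close>.\<close>
    let ?z = "?mn ?one (?mn ?one x)"
    have v: "l ?z = F1 - (F1 - l x)" if "hom N l" for l
      using x by (simp add: hom_simps[OF that] cl)
    have "regular N ?z"
      unfolding regular_def
    proof (intro allI impI)
      fix l assume l: "hom N l"
      then show "l ?z \<noteq> FM" using v[OF l] by (cases "l x"; simp add: a5_defs)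
    qed
    moreover have z: "?z \<in> A" using x cl by simp
    ultimately consider "?mn ?one (?mn ?one (struc.meet N a ?z)) = a" | "?mn a ?z = a" using atom by blast
    then show False
    proof cases
      case 1
      have "g (?mn ?one (?mn ?one (struc.meet N a ?z))) = F1 - (F1 - (g a \<sqinter> g ?z))"
        using a z by (simp add: hom_simps[OF g(1)] cl)
      then show False using 1 g v[OF g(1)] x by (simp add: a5_defs)
    next
      case 2
      have "h (?mn a ?z) = h a - h ?z"
        using a z by (simp add: hom_simps[OF h(1)] cl)
      then show False using 2 h v[OF h(1)] x by (simp add: a5_defs)
    qed
  qed
  show ?thesis
    unfolding vertex_atom_def
  proof (intro allI impI ballI)
    fix h g x assume h: "hom N h" "h E = F0" "h a \<noteq> F0" and g: "hom N g" "g E = F0" "g a \<noteq> F0" and x: "x \<in> A"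
    have "h a = F1" "g a = F1" "h x = F0 \<or> h x = F1" "g x = F0 \<or> g x = F1"
      using E h g x a unfolding edge_bound_def by blast+
    then show "g x = h x" using *[OF h(1) _ g(1) _ x] *[OF g(1) _ h(1) _ x] by metis
  qed
qed

lemma neq_hom:
  assumes "separated N" "x \<in> struc.carrier N" "y \<in> struc.carrier N" "x \<noteq> y"
  obtains h where "hom N h" "h x \<noteq> h y"
  using separatedD[OF assms(1-3)] assms(4) by blast

lemma nonzero_hom:
  assumes "separated N" "x \<in> struc.carrier N" "x \<noteq> struc.zero N"
  obtains h where "hom N h" "h x \<noteq> F0"
proof -
  have "struc.zero N \<in> struc.carrier N" using assms(1) by (simp add: separated_def is_struc_def)
  from neq_hom[OF assms(1,2) this assms(3)] show ?thesis using that hom_simps(1) by metis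
qed

section \<open>The axioms D4 and S4 in terms of values in the five-element algebra\<close>

abbreviation "V4_completion \<equiv> V4_theory \<union> {D4, S4}"

lemma models_completion:
  "models N V4_completion \<longleftrightarrow> separated N \<and> (\<forall>s. sat N s D4 \<and> sat N s S4)"
proof (cases "separated N")
  case True
  then have "is_struc N" by (simp add: separated_def)
  then have "range (\<lambda>_ :: nat. struc.zero N) \<subseteq> struc.carrier N" by (auto simp: is_struc_def)
  moreover have "models N V4_theory" using True by (simp add: V4_separated)
  ultimately show ?thesis
    using True by (auto simp: models_def sat_D4 sat_S4)
next
  case False
  then have "\<not> models N V4_theory" by (simp add: V4_separated)
  then show ?thesis using False by (auto simp: models_def)
qed

lemma completion_D4:
  assumes N: "models N V4_completion" and a: "a \<in> struc.carrier N" "regular N a" "a \<noteq> struc.zero N"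
  obtains b where "b \<in> struc.carrier N" "b \<noteq> struc.zero N"
    "\<And>k. hom N k \<Longrightarrow> k a - k b = k a \<and> k b \<le> k a"
proof -
  have S: "separated N" and D4: "\<And>s. sat N s D4" using N unfolding models_completion by blast+
  have c: "subalg N (struc.carrier N)" using S by (auto simp: subalg_def separated_def is_struc_def)
  note cl = subalg_closed[OF c]
  let ?c = "struc.minus N (struc.one N) (struc.minus N (struc.one N) a)"
  have "a = ?c"
  proof (rule separatedD[OF S])
    fix h assume h: "hom N h"
    have "h ?c = F1 - (F1 - h a)" using a(1) by (simp add: hom_simps[OF h] cl)
    then show "h a = h ?c" using regularD[OF a(2) h] by (cases "h a"; simp add: a5_defs)
  qed (use a(1) cl in auto)
  then obtain b where b: "b \<in> struc.carrier N" "b \<noteq> struc.zero N" "struc.minus N a b = a" "struc.meet N b a = b"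
    using D4[unfolded sat_D4] a by metis
  have "k a - k b = k a \<and> k b \<le> k a" if k: "hom N k" for k
    using hom_simps(4)[OF k b(1) a(1)] hom_simps(5)[OF k a(1) b(1)] b(3,4)
    by (metis inf.cobounded2)
  then show ?thesis using that b by blast
qed

lemma completion_S4:
  assumes N: "models N V4_completion"
    and L: "a \<in> struc.carrier N" "b1 \<in> struc.carrier N" "b2 \<in> struc.carrier N" and a: "a \<noteq> struc.zero N"
    and b: "\<And>k. hom N k \<Longrightarrow> k a - (k b1 \<squnion> k b2) = k a \<and> k b1 \<squnion> k b2 \<le> k a \<and> k b1 \<sqinter> k b2 \<sqinter> (F1 - k a) = F0"
  obtains a1 a2 where "a1 \<in> struc.carrier N" "a2 \<in> struc.carrier N" "a1 \<noteq> struc.zero N" "a2 \<noteq> struc.zero N"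
    "\<And>k. hom N k \<Longrightarrow> k a - k a2 = k a1 \<and> k a - k a1 = k a2 \<and> k b1 \<le> k a1 \<and> k b2 \<le> k a2 \<and>
      k a1 \<sqinter> k a2 = k b1 \<sqinter> k b2"
proof -
  have S: "separated N" and S4: "\<And>s. sat N s S4" using N unfolding models_completion by blast+
  have c: "subalg N (struc.carrier N)" using S by (auto simp: subalg_def separated_def is_struc_def)
  note cl = subalg_closed[OF c]
  have "struc.minus N a (struc.join N b1 b2) = a"
    by (rule separatedD[OF S]) (use L cl b in \<open>auto simp: hom_simps\<close>)
  moreover have "struc.meet N (struc.join N b1 b2) a = struc.join N b1 b2"
    by (rule separatedD[OF S]) (use L cl b in \<open>auto simp: hom_simps inf.absorb1\<close>)
  moreover have "struc.meet N (struc.meet N b1 b2) (struc.minus N (struc.one N) a) = struc.zero N"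
    by (rule separatedD[OF S]) (use L cl b in \<open>auto simp: hom_simps\<close>)
  ultimately obtain a1 a2 where *: "a1 \<in> struc.carrier N" "a2 \<in> struc.carrier N" "a1 \<noteq> struc.zero N" "a2 \<noteq> struc.zero N"
    "struc.minus N a a2 = a1" "struc.meet N b1 a1 = b1" "struc.minus N a a1 = a2" "struc.meet N b2 a2 = b2"
    "struc.meet N a1 a2 = struc.meet N b1 b2"
    using S4[unfolded sat_S4] L a by metis
  have "k a - k a2 = k a1 \<and> k a - k a1 = k a2 \<and> k b1 \<le> k a1 \<and> k b2 \<le> k a2 \<and>
      k a1 \<sqinter> k a2 = k b1 \<sqinter> k b2" if k: "hom N k" for k
    using hom_simps(5)[OF k L(1) *(2)] hom_simps(5)[OF k L(1) *(1)] hom_simps(4)[OF k L(2) *(1)]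
      hom_simps(4)[OF k L(3) *(2)] hom_simps(4)[OF k *(1,2)] hom_simps(4)[OF k L(2,3)] *(5-9)
    by (simp add: le_iff_inf)
  then show ?thesis using that * by blast
qed

lemma a5_F0 [simp]:
  fixes x :: a5
  shows "x \<sqinter> F0 = F0" "F0 \<sqinter> x = F0" "x - F0 = x" "x \<le> F0 \<longleftrightarrow> x = F0"
  by (cases x; simp add: a5_defs)+

text \<open>The three \<open>dist\<close> lemmas recover the trace of a new element on a whole from
  its traces on two parts. They are what makes a minimal counterexample undivided.\<close>

lemma a5_edge_dist:
  fixes d e z :: a5
  assumes "d = F0 \<or> d = FM" "e = F0 \<or> e = FM" "z = F0 \<or> z = FM"
  shows "(d \<sqinter> (e \<sqinter> z)) \<squnion> (d \<sqinter> (e - z)) = d \<sqinter> e"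
  using assms by (elim disjE; simp add: a5_defs)

lemma a5_vertex_dist:
  fixes d a c :: a5
  assumes "d = F0 \<or> d = FM" "a \<noteq> FM" "c \<noteq> FM"
  shows "(d \<sqinter> (F1 - (F1 - (a \<sqinter> c)))) \<squnion> (d \<sqinter> (a - c)) = d \<sqinter> a"
  using assms by (cases d; cases a; cases c; simp add: a5_defs)

text \<open>\<open>a1\<close> contains all old edges below \<open>a\<close> and is disjoint from
  \<open>a2\<close>, so no old edge is present where \<open>a2\<close> is non-zero, and
  \<open>y\<close> lies below \<open>a2\<close>.\<close>

lemma a5_new_edge:
  fixes a a1 a2 e y :: a5
  assumes "a2 = a - a1" "e \<sqinter> a \<le> a1" "a1 \<sqinter> a2 = F0" "a2 - y = a2 \<and> y \<le> a2" "e = F0 \<or> e = FM" "a \<noteq> FM"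
  shows "y = F0 \<or> y = FM \<and> e = F0 \<and> a \<noteq> F0"
proof -
  have "a2 \<noteq> FM" using assms(1,6) by (cases a; cases a1; simp add: a5_defs)
  then have y: "y = F0 \<or> y = FM \<and> a2 \<noteq> F0" using assms(4) by (cases a2; cases y; simp add: a5_defs)
  have "a1 = F0" if "a2 \<noteq> F0" using assms(3) that by (cases a1; cases a2; simp add: a5_defs)
  then have "e \<sqinter> a = F0 \<and> a = a2" if "a2 \<noteq> F0" using assms(1,2) that by (simp add: a5_F0)
  moreover have "e = F0" if "e \<sqinter> a = F0" "a \<noteq> F0" using that by (cases e; cases a; simp add: a5_defs)
  ultimately show ?thesis using y by blast
qed

lemma a5_regular_dist:
  fixes r a c :: a5
  assumes "r \<noteq> FM" "a \<noteq> FM" "c \<noteq> FM"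
  shows "(r - (F1 - (F1 - (F1 - (a \<sqinter> c))))) \<squnion> (r - (F1 - (a - c))) = r - (F1 - a)"
  using assms by (cases r; cases a; cases c; simp add: a5_defs)

text \<open>\<open>b1\<close> and \<open>b2\<close> consist of edges, so subtracting them does not
  change the regular \<open>a\<close>. An edge in both has an end point in each of the two parts,
  hence no end point outside \<open>a\<close>.\<close>

lemma a5_split_premise:
  fixes s a E :: a5
  assumes "s \<noteq> FM" "s \<le> a" "a \<noteq> FM" "E = F0 \<or> E = FM" "b1 = E \<sqinter> s" "b2 = E \<sqinter> (a - s)"
  shows "a - (b1 \<squnion> b2) = a \<and> b1 \<squnion> b2 \<le> a \<and> b1 \<sqinter> b2 \<sqinter> (F1 - a) = F0"
  using assms(1-4) unfolding assms(5,6) by (cases s; cases a; cases E; simp add: a5_defs)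

text \<open>\<open>a1\<close> distributes the edges as \<open>s\<close> does: an edge of
  \<open>E\<close> in \<open>a1\<close> but not in \<open>s\<close> would be in
  \<open>a - s\<close>, hence in \<open>a - a1\<close>, and the equation for
  \<open>a1 \<sqinter> (a - a1)\<close> puts it back into \<open>s\<close>.\<close>

lemma a5_split:
  fixes s a E a1 :: a5
  assumes "s \<noteq> FM" "s \<le> a" "a \<noteq> FM" "E = F0 \<or> E = FM"
    "a - (a - a1) = a1" "E \<sqinter> s \<le> a1" "E \<sqinter> (a - s) \<le> a - a1"
    "a1 \<sqinter> (a - a1) = (E \<sqinter> s) \<sqinter> (E \<sqinter> (a - s))"
  shows "a1 \<noteq> FM \<and> a1 \<le> a \<and> a1 \<sqinter> (a - a1) \<le> E \<and> E \<sqinter> s = E \<sqinter> a1 \<and> E \<sqinter> (a - s) = E \<sqinter> (a - a1)"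
proof -
  consider "s = F0" | "s = a" | "a = F1" "s = FL" | "a = F1" "s = FR"
    using assms(1,2) by (cases s; cases a; simp add: a5_defs)
  then show ?thesis
    using assms(4)
  proof (cases; elim disjE)
  qed (use assms(3,5-) in \<open>simp; cases a; cases a1; simp add: a5_defs\<close>)+
qed

section \<open>A maximal good relation is total on its finite subalgebra\<close>

locale maximal_good =
  fixes N1 :: "'a struc" and N2 :: "'b struc" and \<rho> :: "('a \<times> 'b) set" and B :: "'a set"
  assumes N1: "separated N1" and N2: "models N2 V4_completion"
    and good: "good \<rho> N1 N2" and \<rho>: "\<rho> \<subseteq> B \<times> struc.carrier N2"
    and B: "subalg N1 B" "finite B"
    and maximal: "\<And>z z'. z \<in> B \<Longrightarrow> z' \<in> struc.carrier N2 \<Longrightarrow> good (insert (z, z') \<rho>) N1 N2 \<Longrightarrow> (z, z') \<in> \<rho>"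
begin

abbreviation "A \<equiv> Domain \<rho>"
abbreviation jn (infixl "\<oplus>" 65) where "x \<oplus> y \<equiv> struc.join N1 x y"
abbreviation mt (infixl "\<otimes>" 70) where "x \<otimes> y \<equiv> struc.meet N1 x y"
abbreviation mn (infixl "\<ominus>" 65) where "x \<ominus> y \<equiv> struc.minus N1 x y"
abbreviation "one \<equiv> struc.one N1"

lemma N2': "separated N2"
  using N2 unfolding models_completion by blast

lemma carrier2: "subalg N2 (struc.carrier N2)"
  using N2' by (auto simp: subalg_def separated_def is_struc_def)

lemma A_sub: "x \<in> A \<Longrightarrow> x \<in> B"
  using \<rho> by auto

lemma \<rho>2: "(x, y) \<in> \<rho> \<Longrightarrow> y \<in> struc.carrier N2"
  using \<rho> by auto

lemmas B_closed = subalg_closed[OF B(1)]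

text \<open>A pair whose values are forced by \<open>\<rho>\<close> keeps it good, so maximality has
  already included it. In particular \<open>\<rho>\<close> is closed under the operations, and no
  closure has to be formed after a move.\<close>

lemma good_op:
  assumes z: "z \<in> B" "z' \<in> struc.carrier N2"
    and v: "\<And>h k. hom N1 h \<Longrightarrow> hom N2 k \<Longrightarrow> (\<And>x y. (x, y) \<in> \<rho> \<Longrightarrow> h x = k y) \<Longrightarrow> h z = k z'"
  shows "(z, z') \<in> \<rho>"
proof (rule maximal[OF z])
  have "half (insert (z, z') \<rho>) N1 N2"
  proof (rule halfI)
    fix h assume h: "hom N1 h"
    obtain k where k: "hom N2 k" "\<And>x y. (x, y) \<in> \<rho> \<Longrightarrow> k y = h x"
      using halfE[OF half12[OF good] h] by blast
    then show "\<exists>k. hom N2 k \<and> (\<forall>x y. (x, y) \<in> insert (z, z') \<rho> \<longrightarrow> k y = h x)"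
      using v[OF h k(1)] by (intro exI[of _ k]) auto
  qed
  moreover have "half ((insert (z, z') \<rho>)\<inverse>) N2 N1"
  proof (rule halfI)
    fix k assume k: "hom N2 k"
    obtain h where h: "hom N1 h" "\<And>x y. (x, y) \<in> \<rho> \<Longrightarrow> h x = k y"
      using half21E[OF good k] by blast
    then show "\<exists>h. hom N1 h \<and> (\<forall>x y. (x, y) \<in> (insert (z, z') \<rho>)\<inverse> \<longrightarrow> h y = k x)"
      using v[OF h(1) k] by (intro exI[of _ h]) auto
  qed
  ultimately show "good (insert (z, z') \<rho>) N1 N2" by (simp add: good_def)
qed

lemma \<rho>_closed:
  "(struc.zero N1, struc.zero N2) \<in> \<rho>" "(one, struc.one N2) \<in> \<rho>"
  "(x, x') \<in> \<rho> \<Longrightarrow> (y, y') \<in> \<rho> \<Longrightarrow> (x \<oplus> y, struc.join N2 x' y') \<in> \<rho>"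
  "(x, x') \<in> \<rho> \<Longrightarrow> (y, y') \<in> \<rho> \<Longrightarrow> (x \<otimes> y, struc.meet N2 x' y') \<in> \<rho>"
  "(x, x') \<in> \<rho> \<Longrightarrow> (y, y') \<in> \<rho> \<Longrightarrow> (x \<ominus> y, struc.minus N2 x' y') \<in> \<rho>"
  by (rule good_op;
      use B_closed subalg_closed[OF carrier2] A_sub \<rho>2 in \<open>auto simp: hom_simps Domain.DomainI\<close>)+

lemma A: "subalg N1 A" "finite A"
proof -
  show "subalg N1 A"
    unfolding subalg_def
  proof (intro conjI ballI subsetI)
    show "x \<in> struc.carrier N1" if "x \<in> A" for x using A_sub[OF that] B_closed(6) by blast
    show "struc.zero N1 \<in> A" "one \<in> A" using \<rho>_closed(1,2) by blast+
    fix x y assume "x \<in> A" "y \<in> A"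
    then obtain x' y' where "(x, x') \<in> \<rho>" "(y, y') \<in> \<rho>" by blast
    from \<rho>_closed(3-5)[OF this] show "x \<oplus> y \<in> A" "x \<otimes> y \<in> A" "x \<ominus> y \<in> A" by blast+
  qed
  show "finite A" using B(2) A_sub by (meson finite_subset subsetI)
qed

lemmas A_closed = subalg_closed[OF A(1)]

lemma add:
  assumes "z \<in> B" "z' \<in> struc.carrier N2" "half (insert (z, z') \<rho>) N1 N2" "half (insert (z', z) (\<rho>\<inverse>)) N2 N1"
  shows "z \<in> A"
proof -
  have "(insert (z, z') \<rho>)\<inverse> = insert (z', z) (\<rho>\<inverse>)" by auto
  then have "(z, z') \<in> \<rho>" using assms maximal by (simp add: good_def)
  then show ?thesis by blast
qed

lemma good_converse: "good (\<rho>\<inverse>) N2 N1"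
  using good by (simp add: good_def)

definition E :: 'a where
  "E = (SOME E. E \<in> A \<and> edgy N1 E \<and> (\<forall>d h. d \<in> A \<longrightarrow> edgy N1 d \<longrightarrow> hom N1 h \<longrightarrow> h d \<le> h E))"

lemma E: "E \<in> A" "edgy N1 E" "\<And>d h. d \<in> A \<Longrightarrow> edgy N1 d \<Longrightarrow> hom N1 h \<Longrightarrow> h d \<le> h E"
proof -
  have "\<exists>E. E \<in> A \<and> edgy N1 E \<and> (\<forall>d h. d \<in> A \<longrightarrow> edgy N1 d \<longrightarrow> hom N1 h \<longrightarrow> h d \<le> h E)"
    using edge_bound_exists[OF A] by metis
  from someI_ex[OF this] show "E \<in> A" "edgy N1 E"
    "\<And>d h. d \<in> A \<Longrightarrow> edgy N1 d \<Longrightarrow> hom N1 h \<Longrightarrow> h d \<le> h E"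
    unfolding E_def by blast+
qed

lemma E_bound: "edge_bound N1 A E"
  by (rule edge_boundI[OF A(1) E(2,3)])

text \<open>Minimal counterexample: if some \<open>z\<close> divided \<open>e\<close>, the traces of
  \<open>d\<close> on both parts would be in \<open>A\<close>, and so would their join. Hence
  \<open>e\<close> is an undivided edge, and \<open>d \<otimes> e\<close> can be paired with one
  half of the partner of \<open>e\<close>, against maximality.\<close>

lemma edge_split:
  assumes d: "d \<in> B" "edgy N1 d" and e: "e \<in> A" "edgy N1 e"
  shows "d \<otimes> e \<in> A"
proof (rule ccontr)
  assume "d \<otimes> e \<notin> A"
  let ?S = "{e \<in> A. edgy N1 e \<and> d \<otimes> e \<notin> A}"
  have "finite ?S" "?S \<noteq> {}" "?S \<subseteq> struc.carrier N1"
    using A(2) e \<open>d \<otimes> e \<notin> A\<close> A_closed(6) by auto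
  from hom_minimal[OF N1 this] obtain e where e: "e \<in> A" "edgy N1 e" "d \<otimes> e \<notin> A"
    and min: "\<And>x. x \<in> A \<Longrightarrow> edgy N1 x \<Longrightarrow> d \<otimes> x \<notin> A \<Longrightarrow> (\<And>h. hom N1 h \<Longrightarrow> h x \<le> h e) \<Longrightarrow> x = e"
    by (smt (verit, best) mem_Collect_eq)
  have L: "d \<in> struc.carrier N1" "e \<in> struc.carrier N1" using d e B_closed A_closed by auto
  have vd: "h (d \<otimes> e) = h d \<sqinter> h e" if "hom N1 h" for h using L by (simp add: hom_simps[OF that])
  have "edge_atom N1 A e"
  proof (rule edge_atomI[OF A(1) e(1,2)])
    fix z assume z: "z \<in> A" "edgy N1 z"
    have zL: "z \<in> struc.carrier N1" using z A_closed by auto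
    have v: "h (e \<otimes> z) = h e \<sqinter> h z" "h (e \<ominus> z) = h e - h z" if "hom N1 h" for h
      using L zL by (simp_all add: hom_simps[OF that])
    have in_A: "e \<otimes> z \<in> A" "e \<ominus> z \<in> A" using e z A_closed by auto
    have "edgy N1 (e \<otimes> z)" "edgy N1 (e \<ominus> z)"
      using e(2) z(2) by (auto simp: edgy_def v a5_defs)
    moreover have "h (e \<otimes> z) \<le> h e" "h (e \<ominus> z) \<le> h e" if "hom N1 h" for h
      using edgyD[OF e(2) that] by (auto simp: v[OF that] a5_defs)
    ultimately have "e \<otimes> z = e \<or> d \<otimes> (e \<otimes> z) \<in> A" "e \<ominus> z = e \<or> d \<otimes> (e \<ominus> z) \<in> A"
      using min in_A by blast+
    moreover have "d \<otimes> e = (d \<otimes> (e \<otimes> z)) \<oplus> (d \<otimes> (e \<ominus> z))"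
    proof (rule separatedD[OF N1])
      fix h assume h: "hom N1 h"
      have "h ((d \<otimes> (e \<otimes> z)) \<oplus> (d \<otimes> (e \<ominus> z))) = (h d \<sqinter> (h e \<sqinter> h z)) \<squnion> (h d \<sqinter> (h e - h z))"
        using B_closed(6) d(1) A_closed A_sub in_A z(1) e(1) L zL
        by (simp add: hom_simps[OF h] v[OF h] B_closed)
      then show "h (d \<otimes> e) = h ((d \<otimes> (e \<otimes> z)) \<oplus> (d \<otimes> (e \<ominus> z)))"
        using a5_edge_dist[OF edgyD[OF d(2) h] edgyD[OF e(2) h] edgyD[OF z(2) h]] vd[OF h] by simp
    qed (use d(1) e(1) z(1) A_sub B_closed in auto)
    ultimately show "e \<otimes> z = e \<or> e \<ominus> z = e" using e(3) A_closed(3) by metis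
  qed
  note atom = this
  obtain e' where e': "(e, e') \<in> \<rho>" using e(1) by blast
  have e'L: "e' \<in> struc.carrier N2" using \<rho>2 e' by blast
  have edgy': "edgy N2 e'" by (rule edgy_transfer[OF good e' e(2)])
  have atom': "edge_atom N2 (Range \<rho>) e'" by (rule edge_atom_transfer[OF good e' atom])
  have dB: "d \<otimes> e \<in> B" using d(1) e(1) A_sub B_closed by auto
  have "d \<otimes> e \<noteq> struc.zero N1" using e(3) A_closed(1) by metis
  then obtain h0 where h0: "hom N1 h0" "h0 (d \<otimes> e) \<noteq> F0" using nonzero_hom[OF N1] dB B_closed(6) by metis
  have "e \<noteq> struc.zero N1"
    using h0 vd[OF h0(1)] hom_simps(1)[OF h0(1)] by auto
  then have "e' \<noteq> struc.zero N2" using nonzero_transfer[OF N1 good e'] L by blast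
  moreover have z: "struc.zero N2 \<in> struc.carrier N2" by (rule subalg_closed(1)[OF carrier2])
  moreover have "k e' - (k (struc.zero N2) \<squnion> k (struc.zero N2)) = k e' \<and>
      k (struc.zero N2) \<squnion> k (struc.zero N2) \<le> k e' \<and> k (struc.zero N2) \<sqinter> k (struc.zero N2) \<sqinter> (F1 - k e') = F0"
    if k: "hom N2 k" for k
    using edgyD[OF edgy' k] by (auto simp: hom_simps(1)[OF k] a5_defs)
  ultimately obtain a1 a2 where a: "a1 \<in> struc.carrier N2" "a2 \<in> struc.carrier N2"
    "a1 \<noteq> struc.zero N2" "a2 \<noteq> struc.zero N2"
    "\<And>k. hom N2 k \<Longrightarrow> k e' - k a2 = k a1 \<and> k e' - k a1 = k a2"
    using completion_S4[OF N2 e'L z z] by metis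
  have y: "(k a1 = F0 \<or> k a1 = FM) \<and> k a1 \<le> k e'" if k: "hom N2 k" for k
    using a(5)[OF k] edgyD[OF edgy' k] by (cases "k a1"; cases "k a2"; auto simp: a5_defs)
  have d': "(h (d \<otimes> e) = F0 \<or> h (d \<otimes> e) = FM) \<and> h (d \<otimes> e) \<le> h e" if h: "hom N1 h" for h
    using edgyD[OF d(2) h] edgyD[OF e(2) h] by (auto simp: vd[OF h] a5_defs)
  have ex2: "\<exists>k. hom N2 k \<and> k a1 \<noteq> F0" using nonzero_hom[OF N2' a(1,3)] by blast
  have ex2': "\<exists>k. hom N2 k \<and> k e' \<noteq> F0 \<and> k a1 = F0"
  proof -
    obtain k where k: "hom N2 k" "k a2 \<noteq> F0" using nonzero_hom[OF N2' a(2,4)] by blast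
    then have "k e' \<noteq> F0 \<and> k a1 = F0" using a(5)[OF k(1)] edgyD[OF edgy' k(1)] y[OF k(1)]
      by (auto simp: a5_defs)
    then show ?thesis using k by blast
  qed
  have ex1: "\<exists>h. hom N1 h \<and> h (d \<otimes> e) \<noteq> F0" using h0 by (intro exI[of _ h0]) simp
  have ex1': "\<exists>h. hom N1 h \<and> h e \<noteq> F0 \<and> h (d \<otimes> e) = F0"
  proof -
    have "d \<otimes> e \<noteq> e" using e by metis
    then obtain h where h: "hom N1 h" "h (d \<otimes> e) \<noteq> h e" using neq_hom[OF N1] dB B_closed(6) L by metis
    then have "h e \<noteq> F0 \<and> h (d \<otimes> e) = F0" using d'[OF h(1)] edgyD[OF e(2) h(1)] by (auto simp: a5_defs)
    then show ?thesis using h by blast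
  qed
  have "half (insert (d \<otimes> e, a1) \<rho>) N1 N2"
    by (rule edge_split_half[where d = "d \<otimes> e" and y = a1 and e = e and e' = e', OF good e' atom' d' y ex2 ex2'])
  moreover have "half (insert (a1, d \<otimes> e) (\<rho>\<inverse>)) N2 N1"
  proof (rule edge_split_half[where d = a1 and y = "d \<otimes> e" and e = e' and e' = e, OF good_converse _ _ y d' ex1 ex1'])
    show "(e', e) \<in> \<rho>\<inverse>" using e' by simp
    show "edge_atom N1 (Range (\<rho>\<inverse>)) e" using atom by simp
  qed
  ultimately show False using add[OF dB a(1)] e(3) by blast
qed

text \<open>The minimality argument shared by new edges and vertex divisions. \<open>f a\<close> is
  the trace of the new element on \<open>a\<close>, and \<open>dist\<close> rebuilds it from the
  traces on the two parts into which \<open>c\<close> cuts \<open>a\<close>.\<close>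

lemma vertex_atom_exists:
  assumes f: "f one \<notin> A"
    and dist: "\<And>a c. a \<in> A \<Longrightarrow> c \<in> A \<Longrightarrow> regular N1 a \<Longrightarrow> regular N1 c \<Longrightarrow>
      f a = f (one \<ominus> (one \<ominus> (a \<otimes> c))) \<oplus> f (a \<ominus> c)"
  obtains a where "a \<in> A" "regular N1 a" "f a \<notin> A" "vertex_atom N1 A E a"
proof -
  let ?S = "{a \<in> A. regular N1 a \<and> f a \<notin> A}"
  have "regular N1 one" by (auto simp: regular_def hom_simps)
  then have "finite ?S" "?S \<noteq> {}" "?S \<subseteq> struc.carrier N1"
    using A(2) f A_closed(2,6) by auto
  from hom_minimal[OF N1 this] obtain a where a: "a \<in> A" "regular N1 a" "f a \<notin> A"
    and min: "\<And>x. x \<in> A \<Longrightarrow> regular N1 x \<Longrightarrow> f x \<notin> A \<Longrightarrow> (\<And>h. hom N1 h \<Longrightarrow> h x \<le> h a) \<Longrightarrow> x = a"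
    by (smt (verit, best) mem_Collect_eq)
  have "vertex_atom N1 A E a"
  proof (rule vertex_atomI[OF A(1) E_bound a(1)])
    fix c assume c: "c \<in> A" "regular N1 c"
    \<comment> \<open>The regular part of \<open>a \<otimes> c\<close>; the meet itself may contain
      edges that keep it from being regular.\<close>
    let ?c1 = "one \<ominus> (one \<ominus> (a \<otimes> c))" and ?c2 = "a \<ominus> c"
    have v: "h ?c1 = F1 - (F1 - (h a \<sqinter> h c))" "h ?c2 = h a - h c" if "hom N1 h" for h
      using a(1) c(1) by (simp_all add: hom_simps[OF that] A_closed)
    have "h ?c1 \<noteq> FM \<and> h ?c1 \<le> h a \<and> h ?c2 \<noteq> FM \<and> h ?c2 \<le> h a" if h: "hom N1 h" for h
      using regularD[OF a(2) h] regularD[OF c(2) h] unfolding v[OF h]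
      by (cases "h a"; cases "h c"; simp add: a5_defs)
    moreover have "?c1 \<in> A" "?c2 \<in> A" using a(1) c(1) A_closed by auto
    ultimately have "?c1 = a \<or> f ?c1 \<in> A" "?c2 = a \<or> f ?c2 \<in> A"
      using min unfolding regular_def by blast+
    then show "?c1 = a \<or> ?c2 = a" using dist[OF a(1) c(1) a(2) c(2)] a(3) A_closed(3) by metis
  qed
  then show ?thesis using that a by blast
qed

lemma new_edge:
  assumes d: "d \<in> B" "edgy N1 d"
  shows "d \<in> A"
proof (rule ccontr)
  assume "d \<notin> A"
  \<comment> \<open>\<open>edge_split\<close> settles the part of \<open>d\<close> inside the old
    edges, so the part outside them must be new.\<close>
  let ?d = "d \<ominus> E"
  have EB: "E \<in> B" using E(1) A_sub by blast
  have dB: "?d \<in> B" using d EB B_closed by auto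
  have v: "h ?d = h d - h E" if "hom N1 h" for h
    using d(1) EB by (simp add: hom_simps[OF that] B_closed)
  have "?d \<notin> A"
  proof
    assume "?d \<in> A"
    then have "(d \<otimes> E) \<oplus> ?d \<in> A" using edge_split[OF d E(1,2)] A_closed(3) by blast
    moreover have "d = (d \<otimes> E) \<oplus> ?d"
    proof (rule separatedD[OF N1])
      fix h assume h: "hom N1 h"
      have "h ((d \<otimes> E) \<oplus> ?d) = (h d \<sqinter> h E) \<squnion> (h d - h E)"
        using d(1) EB by (simp add: hom_simps[OF h] B_closed)
      then show "h d = h ((d \<otimes> E) \<oplus> ?d)"
        using edgyD[OF d(2) h] edgyD[OF E(2) h] by (elim disjE; simp add: a5_defs)
    qed (use d EB B_closed in auto)
    ultimately show False using \<open>d \<notin> A\<close> by simp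
  qed
  have de: "h ?d = F0 \<or> h ?d = FM \<and> h E = F0" if h: "hom N1 h" for h
    using edgyD[OF d(2) h] edgyD[OF E(2) h] by (elim disjE; simp add: v[OF h] a5_defs)
  have "?d \<otimes> one \<notin> A"
  proof -
    have "?d \<otimes> one = ?d"
    proof (rule separatedD[OF N1])
      fix h assume h: "hom N1 h"
      have "h (?d \<otimes> one) = h ?d \<sqinter> F1" using dB by (simp add: hom_simps[OF h] B_closed)
      then show "h (?d \<otimes> one) = h ?d" by (cases "h ?d"; simp add: a5_defs)
    qed (use dB B_closed in auto)
    then show ?thesis using \<open>?d \<notin> A\<close> by simp
  qed
  moreover have "?d \<otimes> a = (?d \<otimes> (one \<ominus> (one \<ominus> (a \<otimes> c)))) \<oplus> (?d \<otimes> (a \<ominus> c))"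
    if a: "a \<in> A" "regular N1 a" and c: "c \<in> A" "regular N1 c" for a c
  proof (rule separatedD[OF N1])
    fix h assume h: "hom N1 h"
    have L: "a \<in> struc.carrier N1" "c \<in> struc.carrier N1" "?d \<in> struc.carrier N1" "one \<in> struc.carrier N1"
      using a c dB B_closed A_closed by auto
    have "h ((?d \<otimes> (one \<ominus> (one \<ominus> (a \<otimes> c)))) \<oplus> (?d \<otimes> (a \<ominus> c))) =
      (h ?d \<sqinter> (F1 - (F1 - (h a \<sqinter> h c)))) \<squnion> (h ?d \<sqinter> (h a - h c))"
      using a c dB A_sub by (simp add: hom_simps[OF h] B_closed)
    moreover have "h (?d \<otimes> a) = h ?d \<sqinter> h a" using L by (simp only: hom_simps[OF h])
    moreover have "h ?d = F0 \<or> h ?d = FM" using de[OF h] by blast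
    ultimately show "h (?d \<otimes> a) = h ((?d \<otimes> (one \<ominus> (one \<ominus> (a \<otimes> c)))) \<oplus> (?d \<otimes> (a \<ominus> c)))"
      using a5_vertex_dist[OF _ regularD[OF a(2) h] regularD[OF c(2) h]] by simp
  qed (use a c dB A_sub B_closed in auto)
  ultimately obtain a where a: "a \<in> A" "regular N1 a" "?d \<otimes> a \<notin> A" "vertex_atom N1 A E a"
    using vertex_atom_exists[of "\<lambda>a. ?d \<otimes> a"] by blast
  have aB: "a \<in> B" using a A_sub by blast
  let ?e = "?d \<otimes> a"
  have eB: "?e \<in> B" using dB aB B_closed by auto
  have ve: "h ?e = h ?d \<sqinter> h a" if "hom N1 h" for h
    using hom_simps(4)[OF that, of ?d a] dB aB B_closed(6) by blast
  obtain a' where a': "(a, a') \<in> \<rho>" using a(1) by blast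
  obtain E' where E': "(E, E') \<in> \<rho>" using E(1) by blast
  have L2: "a' \<in> struc.carrier N2" "E' \<in> struc.carrier N2" using a' E' \<rho>2 by auto
  note cl2 = subalg_closed[OF carrier2]
  have reg': "regular N2 a'" by (rule regular_transfer[OF good a' a(2)])
  have edgy': "edgy N2 E'" by (rule edgy_transfer[OF good E' E(2)])
  have "?e \<noteq> struc.zero N1" using a(3) A_closed(1) by metis
  then obtain h0 where h0: "hom N1 h0" "h0 ?e \<noteq> F0" using nonzero_hom[OF N1] eB B_closed(6) by metis
  have "a \<noteq> struc.zero N1"
    using h0 ve[OF h0(1)] hom_simps(1)[OF h0(1)] by auto
  then have nz: "a' \<noteq> struc.zero N2" by (rule nonzero_transfer[OF N1 good a' B_closed(6)[OF aB]])
  \<comment> \<open>With this \<open>b1\<close> and \<open>b2 = 0\<close>, S4 moves all old edges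
    below \<open>a'\<close> into \<open>a1\<close>. A witness of D4 below \<open>a2\<close> is then
    a new edge.\<close>
  let ?b = "struc.meet N2 E' a'" and ?z = "struc.zero N2"
  have vb: "k ?b = k E' \<sqinter> k a'" if "hom N2 k" for k using L2 by (simp add: hom_simps[OF that])
  have "k a' - (k ?b \<squnion> k ?z) = k a' \<and> k ?b \<squnion> k ?z \<le> k a' \<and> k ?b \<sqinter> k ?z \<sqinter> (F1 - k a') = F0"
    if k: "hom N2 k" for k
    using edgyD[OF edgy' k] regularD[OF reg' k] unfolding vb[OF k] hom_simps(1)[OF k]
    by (elim disjE; cases "k a'"; simp add: a5_defs)
  from completion_S4[OF N2 L2(1) cl2(4)[OF L2(2,1)] cl2(1) nz this]
  obtain a1 a2 where s: "a1 \<in> struc.carrier N2" "a2 \<in> struc.carrier N2" "a2 \<noteq> struc.zero N2"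
    "\<And>k. hom N2 k \<Longrightarrow> k a' - k a2 = k a1 \<and> k a' - k a1 = k a2 \<and> k ?b \<le> k a1 \<and> k ?z \<le> k a2 \<and>
      k a1 \<sqinter> k a2 = k ?b \<sqinter> k ?z" by blast
  have reg2: "regular N2 a2"
    unfolding regular_def
  proof (intro allI impI)
    fix k assume k: "hom N2 k"
    have "k a2 = k a' - k a1" using s(4)[OF k] by simp
    then show "k a2 \<noteq> FM" using regularD[OF reg' k] by (cases "k a'"; cases "k a1"; simp add: a5_defs)
  qed
  obtain y where y: "y \<in> struc.carrier N2" "y \<noteq> struc.zero N2" "\<And>k. hom N2 k \<Longrightarrow> k a2 - k y = k a2 \<and> k y \<le> k a2"
    using completion_D4[OF N2 s(2) reg2 s(3)] by blast
  have y': "k y = F0 \<or> k y = FM \<and> k E' = F0 \<and> k a' \<noteq> F0" if k: "hom N2 k" for k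
  proof -
    have "k a2 = k a' - k a1" "k E' \<sqinter> k a' \<le> k a1" "k a1 \<sqinter> k a2 = F0"
      using s(4)[OF k] vb[OF k] hom_simps(1)[OF k] by simp_all
    then show ?thesis
      using y(3)[OF k] edgyD[OF edgy' k] regularD[OF reg' k] a5_new_edge by blast
  qed
  have d': "h ?e = F0 \<or> h ?e = FM \<and> h E = F0 \<and> h a \<noteq> F0" if h: "hom N1 h" for h
    using de[OF h] regularD[OF a(2) h] unfolding ve[OF h] by (elim disjE conjE; cases "h a"; simp add: a5_defs)
  have ex1: "\<exists>h. hom N1 h \<and> h ?e \<noteq> F0" using h0 by (intro exI[of _ h0]) simp
  have "half (insert (?e, y) \<rho>) N1 N2"
    by (rule new_edge_half[where d = ?e and y = y and E = E and E' = E' and a = a and a' = a', OF good E' E_bound a' _ d' y'])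
      (use vertex_atom_transfer[OF good E' a' a(4)] nonzero_hom[OF N2' y(1,2)] in blast)+
  moreover have "half (insert (y, ?e) (\<rho>\<inverse>)) N2 N1"
  proof (rule new_edge_half[where d = y and y = ?e and E = E' and E' = E and a = a' and a' = a, OF good_converse _ _ _ _ y' d' ex1])
    show "(E', E) \<in> \<rho>\<inverse>" "(a', a) \<in> \<rho>\<inverse>" using E' a' by auto
    show "edge_bound N2 (Domain (\<rho>\<inverse>)) E'" using edge_bound_transfer[OF good E' E_bound] by simp
    show "vertex_atom N1 (Range (\<rho>\<inverse>)) E a" using a(4) by simp
  qed
  ultimately show False using add[OF eB y(1)] a(3) by blast
qed

lemma domain_eq: "A = B"
proof (intro equalityI subsetI)
  fix z assume zB: "z \<in> B"
  show "z \<in> A"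
  proof (rule ccontr)
    assume "z \<notin> A"
    \<comment> \<open>The regular and the edgy part of \<open>z\<close>; \<open>new_edge\<close>
      places the edgy part in \<open>A\<close>, so the regular part is missing.\<close>
    let ?r = "one \<ominus> (one \<ominus> z)" and ?d = "z \<otimes> (one \<ominus> z)"
    have rdB: "?r \<in> B" "?d \<in> B" using zB B_closed by auto
    have v: "h ?r = F1 - (F1 - h z)" "h ?d = h z \<sqinter> (F1 - h z)" if "hom N1 h" for h
      using zB by (simp_all add: hom_simps[OF that] B_closed)
    have "edgy N1 ?d"
      unfolding edgy_def
    proof (intro allI impI)
      fix h assume h: "hom N1 h"
      show "h ?d = F0 \<or> h ?d = FM" unfolding v[OF h] by (cases "h z"; simp add: a5_defs)
    qed
    then have "?d \<in> A" using new_edge rdB by blast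
    have rr: "h ?r \<noteq> FM" if h: "hom N1 h" for h
      unfolding v[OF h] by (cases "h z"; simp add: a5_defs)
    have "?r \<notin> A"
    proof
      assume "?r \<in> A"
      then have "?r \<oplus> ?d \<in> A" using \<open>?d \<in> A\<close> A_closed(3) by blast
      moreover have "z = ?r \<oplus> ?d"
      proof (rule separatedD[OF N1])
        fix h assume h: "hom N1 h"
        have "h (?r \<oplus> ?d) = h ?r \<squnion> h ?d" using rdB B_closed(6) by (simp only: hom_simps(3)[OF h])
        then show "h z = h (?r \<oplus> ?d)" unfolding v[OF h] by (cases "h z"; simp add: a5_defs)
      qed (use zB rdB B_closed in auto)
      ultimately show False using \<open>z \<notin> A\<close> by simp
    qed
    obtain r where r: "r \<in> B" "r \<notin> A" "\<And>h. hom N1 h \<Longrightarrow> h r \<noteq> FM"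
      using rdB(1) \<open>?r \<notin> A\<close> rr by blast
    have "r \<ominus> (one \<ominus> one) \<notin> A"
    proof -
      have "r \<ominus> (one \<ominus> one) = r"
      proof (rule separatedD[OF N1])
        fix h assume h: "hom N1 h"
        have "h (r \<ominus> (one \<ominus> one)) = h r - (F1 - F1)" using r(1) by (simp add: hom_simps[OF h] B_closed)
        moreover have "F1 - F1 = F0" by (simp add: a5_defs)
        ultimately show "h (r \<ominus> (one \<ominus> one)) = h r" by simp
      qed (use r(1) B_closed in auto)
      then show ?thesis using r(2) by simp
    qed
    moreover have "r \<ominus> (one \<ominus> a) = (r \<ominus> (one \<ominus> (one \<ominus> (one \<ominus> (a \<otimes> c))))) \<oplus> (r \<ominus> (one \<ominus> (a \<ominus> c)))"
      if a: "a \<in> A" "regular N1 a" and c: "c \<in> A" "regular N1 c" for a c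
    proof (rule separatedD[OF N1])
      fix h assume h: "hom N1 h"
      show "h (r \<ominus> (one \<ominus> a)) = h ((r \<ominus> (one \<ominus> (one \<ominus> (one \<ominus> (a \<otimes> c))))) \<oplus> (r \<ominus> (one \<ominus> (a \<ominus> c))))"
        using a5_regular_dist[OF r(3)[OF h] regularD[OF a(2) h] regularD[OF c(2) h]] r(1) a(1) c(1) A_sub
        by (simp add: hom_simps[OF h] B_closed)
    qed (use a c r(1) A_sub B_closed in auto)
    ultimately obtain a where a: "a \<in> A" "regular N1 a" "r \<ominus> (one \<ominus> a) \<notin> A" "vertex_atom N1 A E a"
      using vertex_atom_exists[of "\<lambda>a. r \<ominus> (one \<ominus> a)"] by blast
    \<comment> \<open>The regular part of \<open>r \<otimes> a\<close>. The next terms collect the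
      edges of \<open>E\<close> that lie in \<open>?s\<close>, those that lie in the rest of
      \<open>a\<close>, and the edges between the two parts. All are edgy, so they are in
      \<open>A\<close>, and the first two have partners that can serve as \<open>b1\<close> and
      \<open>b2\<close> in S4.\<close>
    let ?s = "r \<ominus> (one \<ominus> a)"
    let ?b1 = "E \<otimes> ?s" and ?b2 = "E \<otimes> (a \<ominus> ?s)" and ?c = "?s \<otimes> (a \<ominus> ?s)"
    have aB: "a \<in> B" and EB: "E \<in> B" using a E A_sub by auto
    have sB: "?s \<in> B" using aB r(1) B_closed by auto
    have asB: "a \<ominus> ?s \<in> B" using aB sB B_closed by auto
    have L: "E \<in> struc.carrier N1" "?s \<in> struc.carrier N1" "a \<in> struc.carrier N1" "a \<ominus> ?s \<in> struc.carrier N1"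
      using EB sB aB asB B_closed(6) by auto
    have vs: "h ?b1 = h E \<sqinter> h ?s" "h ?b2 = h E \<sqinter> (h a - h ?s)" "h ?c = h ?s \<sqinter> (h a - h ?s)"
      if h: "hom N1 h" for h
      using hom_simps(4)[OF h L(1,2)] hom_simps(4)[OF h L(1,4)] hom_simps(4)[OF h L(2,4)]
        hom_simps(5)[OF h L(3,2)] by simp_all
    have s: "h ?s \<noteq> FM \<and> h ?s \<le> h a" if h: "hom N1 h" for h
    proof -
      have "h ?s = h r - (F1 - h a)" using aB r(1) by (simp add: hom_simps[OF h] B_closed)
      then show ?thesis using r(3)[OF h] regularD[OF a(2) h] by (cases "h r"; cases "h a"; simp add: a5_defs)
    qed
    have edgy: "edgy N1 ?b1" "edgy N1 ?b2" "edgy N1 ?c"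
      unfolding edgy_def
    proof (safe del: disjCI)
      fix h assume h: "hom N1 h"
      show "h ?b1 = F0 \<or> h ?b1 = FM" "h ?b2 = F0 \<or> h ?b2 = FM"
        unfolding vs[OF h] using edgyD[OF E(2) h] by (auto simp: a5_defs)
      show "h ?c = F0 \<or> h ?c = FM"
        unfolding vs[OF h] using s[OF h] by (cases "h ?s"; cases "h a"; simp add: a5_defs)
    qed
    have "?b1 \<in> A" "?b2 \<in> A" "?c \<in> A"
      using edgy EB sB asB B_closed(4) new_edge by blast+
    then obtain b1' b2' where b': "(?b1, b1') \<in> \<rho>" "(?b2, b2') \<in> \<rho>" by blast
    have cE: "h ?s \<sqinter> (h a - h ?s) \<le> h E" if h: "hom N1 h" for h
      using E(3)[OF \<open>?c \<in> A\<close> edgy(3) h] vs(3)[OF h] by simp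
    obtain a' where a': "(a, a') \<in> \<rho>" using a(1) by blast
    obtain E' where E': "(E, E') \<in> \<rho>" using E(1) by blast
    have L2: "a' \<in> struc.carrier N2" "b1' \<in> struc.carrier N2" "b2' \<in> struc.carrier N2" using a' b' \<rho>2 by auto
    have "?s \<noteq> struc.zero N1" using a(3) A_closed(1) by metis
    then obtain h0 where h0: "hom N1 h0" "h0 ?s \<noteq> F0" using nonzero_hom[OF N1] L(2) by metis
    have "a \<noteq> struc.zero N1"
      using h0 s[OF h0(1)] hom_simps(1)[OF h0(1)] by auto
    then have nz: "a' \<noteq> struc.zero N2" by (rule nonzero_transfer[OF N1 good a' L(3)])
    have "?s \<noteq> a" using a(1,3) by metis
    then obtain h1 where h1: "hom N1 h1" "h1 ?s \<noteq> h1 a" using neq_hom[OF N1 L(2,3)] by metis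
    \<comment> \<open>\<open>?s\<close> has no partner in \<open>N2\<close> yet. Its value at a
      matching homomorphism of \<open>N1\<close> replaces it, separately for each \<open>k\<close>,
      in \<open>a5_split_premise\<close> and \<open>a5_split\<close>.\<close>
    have match: "\<exists>t. t \<noteq> FM \<and> t \<le> k a' \<and> k a' \<noteq> FM \<and> (k E' = F0 \<or> k E' = FM) \<and>
        k b1' = k E' \<sqinter> t \<and> k b2' = k E' \<sqinter> (k a' - t)" if k: "hom N2 k" for k
    proof -
      obtain h where h: "hom N1 h" "\<And>x y. (x, y) \<in> \<rho> \<Longrightarrow> h x = k y" using half21E[OF good k] by blast
      show ?thesis
        using s[OF h(1)] vs(1,2)[OF h(1)] edgyD[OF E(2) h(1)] regularD[OF a(2) h(1)]
        unfolding h(2)[OF a'] h(2)[OF E'] h(2)[OF b'(1)] h(2)[OF b'(2)] by blast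
    qed
    have "k a' - (k b1' \<squnion> k b2') = k a' \<and> k b1' \<squnion> k b2' \<le> k a' \<and> k b1' \<sqinter> k b2' \<sqinter> (F1 - k a') = F0"
      if k: "hom N2 k" for k
      using match[OF k] a5_split_premise by metis
    from completion_S4[OF N2 L2 nz this]
    obtain a1 a2 where t: "a1 \<in> struc.carrier N2" "a2 \<in> struc.carrier N2" "a1 \<noteq> struc.zero N2" "a2 \<noteq> struc.zero N2"
      "\<And>k. hom N2 k \<Longrightarrow> k a' - k a2 = k a1 \<and> k a' - k a1 = k a2 \<and> k b1' \<le> k a1 \<and> k b2' \<le> k a2 \<and>
        k a1 \<sqinter> k a2 = k b1' \<sqinter> k b2'" by blast
    have y: "k a1 \<noteq> FM \<and> k a' \<noteq> FM \<and> k a1 \<le> k a' \<and> k a1 \<sqinter> (k a' - k a1) \<le> k E' \<and>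
      k b1' = k E' \<sqinter> k a1 \<and> k b2' = k E' \<sqinter> (k a' - k a1)" if k: "hom N2 k" for k
    proof -
      obtain u where u: "u \<noteq> FM" "u \<le> k a'" "k a' \<noteq> FM" "k E' = F0 \<or> k E' = FM"
        "k b1' = k E' \<sqinter> u" "k b2' = k E' \<sqinter> (k a' - u)" using match[OF k] by blast
      have a2: "k a2 = k a' - k a1" using t(5)[OF k] by simp
      show ?thesis
        using a5_split[OF u(1-4), of "k a1"] t(5)[OF k] u(3) unfolding u(5,6) a2 by blast
    qed
    have x: "h ?s \<noteq> FM \<and> h a \<noteq> FM \<and> h ?s \<le> h a \<and> h ?s \<sqinter> (h a - h ?s) \<le> h E \<and>
      h ?b1 = h E \<sqinter> h ?s \<and> h ?b2 = h E \<sqinter> (h a - h ?s)" if h: "hom N1 h" for h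
      using s[OF h] cE[OF h] vs(1,2)[OF h] regularD[OF a(2) h] by blast
    have ex1: "\<exists>h. hom N1 h \<and> h ?s \<noteq> F0" "\<exists>h. hom N1 h \<and> h ?s \<noteq> h a" using h0 h1 by meson+
    have ex2: "\<exists>k. hom N2 k \<and> k a1 \<noteq> F0" using nonzero_hom[OF N2' t(1,3)] by blast
    have ex2': "\<exists>k. hom N2 k \<and> k a1 \<noteq> k a'"
    proof -
      obtain k where k: "hom N2 k" "k a2 \<noteq> F0" using nonzero_hom[OF N2' t(2,4)] by blast
      have "k a1 \<noteq> k a'"
      proof
        assume "k a1 = k a'"
        then have "k a2 = k a' - k a'" using t(5)[OF k(1)] by simp
        then show False using k(2) by (simp add: a5_defs)
      qed
      then show ?thesis using k(1) by blast
    qed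
    have "half (insert (?s, a1) \<rho>) N1 N2"
      by (rule vertex_split_half[where r = ?s and y = a1 and E = E and E' = E' and a = a and a' = a', OF good E' E_bound a' a(4) _ b' x y ex2 ex2'])
        (rule vertex_atom_transfer[OF good E' a' a(4)])
    moreover have "half (insert (a1, ?s) (\<rho>\<inverse>)) N2 N1"
    proof (rule vertex_split_half[where r = a1 and y = ?s and p = b1' and p' = ?b1 and q = b2' and q' = ?b2 and E = E' and E' = E and a = a' and a' = a, OF good_converse _ _ _ _ _ _ _ y x ex1])
      show "(E', E) \<in> \<rho>\<inverse>" "(a', a) \<in> \<rho>\<inverse>" "(b1', ?b1) \<in> \<rho>\<inverse>" "(b2', ?b2) \<in> \<rho>\<inverse>"
        using E' a' b' by auto
      show "edge_bound N2 (Domain (\<rho>\<inverse>)) E'" using edge_bound_transfer[OF good E' E_bound] by simp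
      show "vertex_atom N2 (Domain (\<rho>\<inverse>)) E' a'" using vertex_atom_transfer[OF good E' a' a(4)] by simp
      show "vertex_atom N1 (Range (\<rho>\<inverse>)) E a" using a(4) by simp
    qed
    ultimately show False using add[OF sB t(1)] a(3) by blast
  qed
qed (rule A_sub)

end

lemma good_inverse: "good \<rho> N1 N2 \<Longrightarrow> good (\<rho>\<inverse>) N2 N1"
  by (simp add: good_def)

lemma good_functional:
  assumes "separated N2" "good \<rho> N1 N2" "(x, y) \<in> \<rho>" "(x, y') \<in> \<rho>"
    "y \<in> struc.carrier N2" "y' \<in> struc.carrier N2"
  shows "y = y'"
proof (rule separatedD[OF assms(1,5,6)])
  fix k assume "hom N2 k"
  then obtain h where "\<And>x y. (x, y) \<in> \<rho> \<Longrightarrow> h x = k y" using half21E[OF assms(2)] by blast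
  then show "k y = k y'" using assms(3,4) by metis
qed

text \<open>By local finiteness \<open>B\<close> is finite, and good relations are functional, so
  their size inside \<open>B\<close> is bounded. One of greatest size above \<open>\<rho>0\<close>
  is maximal, hence total on \<open>B\<close>, which contains \<open>x\<close>.\<close>

lemma good_extend:
  assumes N1: "separated N1" and N2: "models N2 V4_completion"
    and \<rho>0: "good \<rho>0 N1 N2" "finite \<rho>0" "\<rho>0 \<subseteq> struc.carrier N1 \<times> struc.carrier N2"
    and x: "x \<in> struc.carrier N1"
  shows "\<exists>y \<in> struc.carrier N2. good (insert (x, y) \<rho>0) N1 N2"
proof -
  have N2': "separated N2" using N2 unfolding models_completion by blast
  have s1: "is_struc N1" using N1 by (simp add: separated_def)
  let ?X = "insert x (Domain \<rho>0)"
  define B where "B = generated N1 ?X"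
  have X: "?X \<subseteq> struc.carrier N1" "finite ?X"
    using \<rho>0(2,3) x by (auto simp: finite_Domain)
  have B: "subalg N1 B" "finite B"
    unfolding B_def by (rule subalg_generated[OF s1 X(1)], rule finite_generated[OF N1 X])
  have XB: "?X \<subseteq> B" by (auto simp: B_def intro: generated.base)
  let ?P = "\<lambda>\<rho>. \<rho> \<subseteq> B \<times> struc.carrier N2 \<and> good \<rho> N1 N2 \<and> \<rho>0 \<subseteq> \<rho>"
  have fin: "finite \<rho> \<and> card \<rho> \<le> card B" if P: "?P \<rho>" for \<rho>
  proof -
    have "inj_on fst \<rho>"
    proof (rule inj_onI)
      fix u v assume uv: "u \<in> \<rho>" "v \<in> \<rho>" "fst u = fst v"
      have "snd u = snd v"
        by (rule good_functional[OF N2', of \<rho> N1 "fst u"]) (use P uv in auto)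
      then show "u = v" using uv(3) by (rule prod_eqI[rotated])
    qed
    moreover have "fst ` \<rho> \<subseteq> B" using P by auto
    ultimately show ?thesis
      using B(2) by (meson card_inj_on_le finite_subset inj_on_finite)
  qed
  have "?P \<rho>0" using \<rho>0(1,3) XB by auto
  moreover have "\<forall>\<rho>. ?P \<rho> \<longrightarrow> card \<rho> < Suc (card B)" using fin by (simp add: less_Suc_eq_le)
  ultimately have "\<exists>\<rho>. ?P \<rho> \<and> (\<forall>\<sigma>. ?P \<sigma> \<longrightarrow> card \<sigma> \<le> card \<rho>)"
    by (rule Lattices_Big.ex_has_greatest_nat)
  then obtain \<rho> where P: "?P \<rho>" and max: "\<forall>\<sigma>. ?P \<sigma> \<longrightarrow> card \<sigma> \<le> card \<rho>" by (elim exE conjE) simp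
  interpret maximal_good N1 N2 \<rho> B
  proof
    fix z z' assume z: "z \<in> B" "z' \<in> struc.carrier N2" "good (insert (z, z') \<rho>) N1 N2"
    have "card (insert (z, z') \<rho>) \<le> card \<rho>" using P z by (intro max[rule_format]) auto
    then show "(z, z') \<in> \<rho>" using fin[OF P] by (metis card_insert_disjoint not_less_eq_eq order_refl)
  qed (use N1 N2 B P in auto)
  have "x \<in> Domain \<rho>" using domain_eq XB by auto
  then obtain y where y: "(x, y) \<in> \<rho>" by blast
  then have "insert (x, y) \<rho>0 \<subseteq> \<rho>" using P by simp
  then have "good (insert (x, y) \<rho>0) N1 N2" by (rule good_mono[OF good])
  then show ?thesis using y \<rho>2 by blast
qed

section \<open>From good relations to formulas\<close>

primrec tvars :: "tm \<Rightarrow> nat set" where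
  "tvars (Var n) = {n}"
| "tvars \<^bold>0 = {}"
| "tvars \<^bold>1 = {}"
| "tvars (t \<^bold>\<squnion> u) = tvars t \<union> tvars u"
| "tvars (t \<^bold>\<sqinter> u) = tvars t \<union> tvars u"
| "tvars (t \<^bold>- u) = tvars t \<union> tvars u"

text \<open>Bound variables are collected too, so that one finite set \<open>V\<close> serves a
  formula and all its subformulas in \<open>good_sat\<close>.\<close>

primrec fvars :: "fm \<Rightarrow> nat set" where
  "fvars (t \<^bold>= u) = tvars t \<union> tvars u"
| "fvars (\<^bold>\<not> p) = fvars p"
| "fvars (p \<^bold>\<and> q) = fvars p \<union> fvars q"
| "fvars (p \<^bold>\<or> q) = fvars p \<union> fvars q"
| "fvars (p \<^bold>\<longrightarrow> q) = fvars p \<union> fvars q"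
| "fvars (\<^bold>\<forall>n. p) = insert n (fvars p)"
| "fvars (\<^bold>\<exists>n. p) = insert n (fvars p)"

lemma finite_fvars: "finite (fvars p)"
proof -
  have "finite (tvars t)" for t by (induction t) auto
  then show ?thesis by (induction p) auto
qed

lemma val_closed:
  assumes "is_struc N" "range s \<subseteq> struc.carrier N"
  shows "val N s t \<in> struc.carrier N"
  using assms by (induction t) (auto simp: is_struc_def)

lemma hom_val:
  assumes N: "is_struc N1" "is_struc N2" and s: "range s1 \<subseteq> struc.carrier N1" "range s2 \<subseteq> struc.carrier N2"
    and h: "hom N1 h" "hom N2 k" "\<And>i. i \<in> tvars t \<Longrightarrow> h (s1 i) = k (s2 i)"
  shows "h (val N1 s1 t) = k (val N2 s2 t)"
  using h(3)
  by (induction t)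
    (simp_all add: hom_simps[OF h(1)] hom_simps[OF h(2)] val_closed[OF N(1) s(1)] val_closed[OF N(2) s(2)])

lemma val_eq_transfer:
  assumes N: "is_struc N1" "separated N2" and s: "range s1 \<subseteq> struc.carrier N1" "range s2 \<subseteq> struc.carrier N2"
    and V: "tvars t \<subseteq> V" "tvars u \<subseteq> V" and g: "good ((\<lambda>i. (s1 i, s2 i)) ` V) N1 N2"
    and eq: "val N1 s1 t = val N1 s1 u"
  shows "val N2 s2 t = val N2 s2 u"
proof -
  have N2: "is_struc N2" using N(2) by (simp add: separated_def)
  show ?thesis
  proof (rule separatedD[OF N(2) val_closed[OF N2 s(2)] val_closed[OF N2 s(2)]])
    fix k assume k: "hom N2 k"
    obtain h where h: "hom N1 h" "\<And>x y. (x, y) \<in> (\<lambda>i. (s1 i, s2 i)) ` V \<Longrightarrow> h x = k y"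
      using half21E[OF g k] by blast
    have "h (s1 i) = k (s2 i)" if "i \<in> V" for i using h(2) that by blast
    then have "h (val N1 s1 v) = k (val N2 s2 v)" if "tvars v \<subseteq> V" for v
      using that by (intro hom_val[OF N(1) N2 s h(1) k]) auto
    then show "k (val N2 s2 t) = k (val N2 s2 u)" using V eq by metis
  qed
qed

abbreviation graph :: "(nat \<Rightarrow> 'a) \<Rightarrow> (nat \<Rightarrow> 'b) \<Rightarrow> nat set \<Rightarrow> ('a \<times> 'b) set" where
  "graph s1 s2 V \<equiv> (\<lambda>i. (s1 i, s2 i)) ` V"

lemma converse_graph: "(graph s1 s2 V)\<inverse> = graph s2 s1 V"
  by auto

lemma good_graph_extend:
  assumes N: "separated N1" "models N2 V4_completion" and V: "finite V"
    and s: "range s1 \<subseteq> struc.carrier N1" "range s2 \<subseteq> struc.carrier N2" and g: "good (graph s1 s2 V) N1 N2"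
    and x: "x \<in> struc.carrier N1"
  shows "\<exists>y \<in> struc.carrier N2. good (graph (s1(n := x)) (s2(n := y)) V) N1 N2"
proof -
  have "graph s1 s2 V \<subseteq> struc.carrier N1 \<times> struc.carrier N2" using s by auto
  with good_extend[OF N g _ _ x] V obtain y
    where y: "y \<in> struc.carrier N2" "good (insert (x, y) (graph s1 s2 V)) N1 N2" by blast
  \<comment> \<open>The update may lose the old pair at index \<open>n\<close>; a smaller relation
    is still good.\<close>
  have "graph (s1(n := x)) (s2(n := y)) V \<subseteq> insert (x, y) (graph s1 s2 V)" by auto
  then show ?thesis using y good_mono by blast
qed

lemma back_and_forth:
  assumes "\<forall>x \<in> X. \<exists>y \<in> Y. R x y" "\<forall>y \<in> Y. \<exists>x \<in> X. R x y"
    and "\<And>x y. x \<in> X \<Longrightarrow> y \<in> Y \<Longrightarrow> R x y \<Longrightarrow> P x \<longleftrightarrow> Q y"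
  shows "(\<forall>x \<in> X. P x) \<longleftrightarrow> (\<forall>y \<in> Y. Q y)" "(\<exists>x \<in> X. P x) \<longleftrightarrow> (\<exists>y \<in> Y. Q y)"
  using assms by blast+

lemma quantifier_step:
  assumes N: "models N1 V4_completion" "models N2 V4_completion" and V: "finite V"
    and s: "range s1 \<subseteq> struc.carrier N1" "range s2 \<subseteq> struc.carrier N2" and g: "good (graph s1 s2 V) N1 N2"
  shows "\<forall>x \<in> struc.carrier N1. \<exists>y \<in> struc.carrier N2. good (graph (s1(n := x)) (s2(n := y)) V) N1 N2"
    and "\<forall>y \<in> struc.carrier N2. \<exists>x \<in> struc.carrier N1. good (graph (s1(n := x)) (s2(n := y)) V) N1 N2"
proof -
  have S: "separated N1" "separated N2" using N unfolding models_completion by blast+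
  show "\<forall>x \<in> struc.carrier N1. \<exists>y \<in> struc.carrier N2. good (graph (s1(n := x)) (s2(n := y)) V) N1 N2"
    using good_graph_extend[OF S(1) N(2) V s g] by blast
  have "good (graph s2 s1 V) N2 N1" using good_inverse[OF g] unfolding converse_graph .
  then have "\<exists>x \<in> struc.carrier N1. good (graph (s2(n := y)) (s1(n := x)) V) N2 N1"
    if "y \<in> struc.carrier N2" for y
    using good_graph_extend[OF S(2) N(1) V s(2,1) _ that] by blast
  then show "\<forall>y \<in> struc.carrier N2. \<exists>x \<in> struc.carrier N1. good (graph (s1(n := x)) (s2(n := y)) V) N1 N2"
    using good_inverse converse_graph by metis
qed

lemma good_sat:
  assumes N: "models N1 V4_completion" "models N2 V4_completion" and V: "finite V"
  shows "fvars p \<subseteq> V \<Longrightarrow> range s1 \<subseteq> struc.carrier N1 \<Longrightarrow> range s2 \<subseteq> struc.carrier N2 \<Longrightarrow>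
    good (graph s1 s2 V) N1 N2 \<Longrightarrow> sat N1 s1 p \<longleftrightarrow> sat N2 s2 p"
proof (induction p arbitrary: s1 s2)
  case (Eq t u)
  have S: "separated N1" "separated N2" using N unfolding models_completion by blast+
  then have st: "is_struc N1" "is_struc N2" by (simp_all add: separated_def)
  have g: "good (graph s2 s1 V) N2 N1" using good_inverse[OF Eq(4)] unfolding converse_graph .
  show ?case
    using val_eq_transfer[OF st(1) S(2) Eq(2,3) _ _ Eq(4), of t u]
      val_eq_transfer[OF st(2) S(1) Eq(3,2) _ _ g, of t u] Eq(1) by auto
next
  case (All n p)
  note * = quantifier_step[OF N V All.prems(2-4), of n]
  have "sat N1 (s1(n := x)) p \<longleftrightarrow> sat N2 (s2(n := y)) p"
    if "x \<in> struc.carrier N1" "y \<in> struc.carrier N2"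
      "good (graph (s1(n := x)) (s2(n := y)) V) N1 N2" for x y
    using All.prems that by (intro All.IH) auto
  from back_and_forth(1)[OF * this] show ?case by simp
next
  case (Ex n p)
  note * = quantifier_step[OF N V Ex.prems(2-4), of n]
  have "sat N1 (s1(n := x)) p \<longleftrightarrow> sat N2 (s2(n := y)) p"
    if "x \<in> struc.carrier N1" "y \<in> struc.carrier N2"
      "good (graph (s1(n := x)) (s2(n := y)) V) N1 N2" for x y
    using Ex.prems that by (intro Ex.IH) auto
  from back_and_forth(2)[OF * this] show ?case by simp
qed simp_all

text \<open>A homomorphism of \<open>N1\<close> is restricted to the common part \<open>M\<close>
  and extended from there to \<open>N2\<close>.\<close>

lemma half_embeddings:
  assumes M: "models M V4_theory" and N: "models N2 V4_theory"
    and f: "embedding f1 M N1" "embedding f2 M N2" and s: "range s \<subseteq> struc.carrier M"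
  shows "half (graph (f1 \<circ> s) (f2 \<circ> s) V) N1 N2"
proof (rule halfI)
  fix h assume h: "hom N1 h"
  have "f1 x \<in> struc.carrier N1" if "x \<in> struc.carrier M" for x
    using f(1) that by (auto simp: embedding_def)
  then have "hom M (\<lambda>x. h (f1 x))"
    using f(1) hom_simps[OF h] by (simp add: hom_def embedding_def)
  then obtain k where "hom N2 k" "\<forall>x \<in> struc.carrier M. k (f2 x) = h (f1 x)"
    using hom_extend[OF M N f(2)] by blast
  then show "\<exists>k. hom N2 k \<and> (\<forall>x y. (x, y) \<in> graph (f1 \<circ> s) (f2 \<circ> s) V \<longrightarrow> k y = h x)"
    using s by (intro exI[of _ k]) auto
qed

lemma completion_complete:
  assumes M: "models M V4_theory" and N: "models N1 V4_completion" "models N2 V4_completion"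
    and f: "embedding f1 M N1" "embedding f2 M N2" and s: "range s \<subseteq> struc.carrier M"
  shows "sat N1 (f1 \<circ> s) p \<longleftrightarrow> sat N2 (f2 \<circ> s) p"
proof (rule good_sat[OF N finite_fvars order_refl])
  have N': "models N1 V4_theory" "models N2 V4_theory"
    using N unfolding models_completion V4_separated by blast+
  show "good (graph (f1 \<circ> s) (f2 \<circ> s) (fvars p)) N1 N2"
    unfolding good_def converse_graph
    using half_embeddings[OF M N'(2) f s] half_embeddings[OF M N'(1) f(2,1) s] by blast
qed (use f s in \<open>auto simp: embedding_def\<close>)

section \<open>Embedding into a model of the completion\<close>

datatype 'a trm =
    Const 'a
  | TJoin "'a trm" "'a trm"
  | TMeet "'a trm" "'a trm"
  | TMinus "'a trm" "'a trm"
  | Dense "'a trm"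
  | Split "'a trm" "'a trm" "'a trm"

text \<open>The bit \<open>b\<close> chooses the value of \<open>a\<^sub>1\<close> in S4 where \<open>x\<close> and \<open>y\<close>, the values of \<open>b\<^sub>1\<close> and \<open>b\<^sub>2\<close>,
  leave a choice; then \<open>a\<^sub>2 = a - a\<^sub>1\<close>.  The value is arbitrary if the premise of S4 fails.\<close>

definition pick :: "bool \<Rightarrow> a5 \<Rightarrow> a5 \<Rightarrow> a5 \<Rightarrow> a5" where
  "pick b a x y =
    (if a - (x \<squnion> y) \<noteq> a \<or> \<not> x \<squnion> y \<le> a \<or> x \<sqinter> y \<sqinter> (F1 - a) \<noteq> F0 then a
     else if x = F0 \<and> y = F0 then (if b then a else F0)
     else if y = F0 then a else if x = F0 then F0 else if b then FL else FR)"

lemma pick_split: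
  assumes "a - (x \<squnion> y) = a" "x \<squnion> y \<le> a" "x \<sqinter> y \<sqinter> (F1 - a) = F0"
  shows "a - (a - pick b a x y) = pick b a x y" "x \<le> pick b a x y" "y \<le> a - pick b a x y"
    "pick b a x y \<sqinter> (a - pick b a x y) = x \<sqinter> y"
proof -
  \<comment> \<open>The premises force the values of \<open>b1\<close> and \<open>b2\<close> to be
    \<open>F0\<close> or \<open>FM\<close>, and an edge in both has both end points in
    \<open>a\<close>.\<close>
  consider "x = F0" "y = F0" | "x = FM" "y = F0" "a = FL \<or> a = FR \<or> a = F1"
    | "x = F0" "y = FM" "a = FL \<or> a = FR \<or> a = F1" | "x = FM" "y = FM" "a = F1"
    using assms by (cases a; cases x; cases y; simp add: a5_defs)
  then have "a - (a - pick b a x y) = pick b a x y \<and> x \<le> pick b a x y \<and> y \<le> a - pick b a x y \<and>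
    pick b a x y \<sqinter> (a - pick b a x y) = x \<sqinter> y"
    by cases (cases b; cases a; simp add: pick_def a5_defs)+
  then show "a - (a - pick b a x y) = pick b a x y" "x \<le> pick b a x y" "y \<le> a - pick b a x y"
    "pick b a x y \<sqinter> (a - pick b a x y) = x \<sqinter> y" by blast+
qed

text \<open>If the premise of S4 holds, the projected \<open>x\<close> and \<open>y\<close> are
  \<open>F0\<close> and the projected result is \<open>f a\<close> or \<open>F0\<close>, each of
  which a bit can select. The default value \<open>a\<close> is compatible with the projections as
  well.\<close>

lemma pick_end5:
  assumes "f = prL \<or> f = prR"
  shows "pick (f (pick b a x y) = F1) (f a) (f x) (f y) = f (pick b a x y)"
  using assms
  by (elim disjE; cases b; cases a; cases x; cases y; simp add: pick_def prL_def prR_def a5_defs)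

text \<open>A bit is indexed by the very term that reads it, so switching it leaves the arguments
  unchanged (\<open>ev_upd\<close>). Subtracting \<open>FM\<close> changes no value except
  \<open>FM\<close>, and regular elements, the ones in D4, never take that value.\<close>

primrec ev :: "('a \<Rightarrow> a5) \<Rightarrow> ('a trm \<Rightarrow> bool) \<Rightarrow> 'a trm \<Rightarrow> a5" where
  "ev h w (Const x) = h x"
| "ev h w (TJoin t u) = ev h w t \<squnion> ev h w u"
| "ev h w (TMeet t u) = ev h w t \<sqinter> ev h w u"
| "ev h w (TMinus t u) = ev h w t - ev h w u"
| "ev h w (Dense t) = (if w (Dense t) \<and> ev h w t \<noteq> F0 then FM else F0)"
| "ev h w (Split t u v) = pick (w (Split t u v)) (ev h w t) (ev h w u) (ev h w v)"

lemma ev_upd: "size u < size s \<Longrightarrow> ev h (w(s := b)) u = ev h w u"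
  by (induction u) auto

text \<open>An evaluation followed by \<^const>\<open>prL\<close> or \<^const>\<open>prR\<close> is again an evaluation.  There \<open>b\<^sub>1\<close> and
  \<open>b\<^sub>2\<close> vanish, so either part of \<open>a\<close> can be made non-zero.\<close>

lemma ev_end5:
  fixes h :: "'a \<Rightarrow> a5"
  assumes f: "f = prL \<or> f = prR"
  obtains w' where "\<And>t. ev (\<lambda>x. f (h x)) w' t = f (ev h w t)"
proof
  \<comment> \<open>\<open>Dense\<close> terms get the bit \<open>False\<close>, because the
    projections send \<open>FM\<close> to \<open>F0\<close>.\<close>
  let ?w = "\<lambda>s. case s of Dense _ \<Rightarrow> False | _ \<Rightarrow> f (ev h w s) = F1"
  have f5: "end5 f" using f end5_prL end5_prR by blast
  have f0: "f F0 = F0" "f FM = F0" using f by (auto simp: prL_def prR_def a5_defs)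
  show "ev (\<lambda>x. f (h x)) ?w t = f (ev h w t)" for t :: "'a trm"
    by (induction t) (use f5 f0 in \<open>simp_all add: end5_def pick_end5[OF f]\<close>)
qed

lemma infinite_pairing:
  obtains g :: "('a + nat) \<times> ('a + nat) \<Rightarrow> 'a + nat" where "inj g"
proof -
  have "infinite (UNIV :: ('a + nat) set)"
    by (simp flip: UNIV_Plus_UNIV)
  from card_of_Times_same_infinite[OF this]
  obtain g where "bij_betw g ((UNIV :: ('a + nat) set) \<times> (UNIV :: ('a + nat) set)) (UNIV :: ('a + nat) set)"
    unfolding card_of_ordIso[symmetric] by blast
  then show ?thesis using that by (auto simp: bij_betw_def)
qed

text \<open>Places the Skolem terms in the type prescribed for the extension. The numbers 0 to 5 tag
  the six constructors, and the rest is an injective pairing, available because the type is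
  infinite.\<close>

lemma trm_encoding:
  obtains c :: "'a trm \<Rightarrow> 'a + nat" where "inj c"
proof -
  obtain g :: "('a + nat) \<times> ('a + nat) \<Rightarrow> 'a + nat" where g: "inj g" by (rule infinite_pairing)
  have g': "g (x, y) = g (u, v) \<longleftrightarrow> x = u \<and> y = v" for x y u v using inj_eq[OF g] by simp
  define c where "c = rec_trm (\<lambda>x. g (Inr 0, Inl x))
    (\<lambda>_ _ a b. g (Inr 1, g (a, b))) (\<lambda>_ _ a b. g (Inr 2, g (a, b))) (\<lambda>_ _ a b. g (Inr 3, g (a, b)))
    (\<lambda>_ a. g (Inr 4, a)) (\<lambda>_ _ _ a b d. g (Inr 5, g (a, g (b, d))))"
  have c: "c (Const x) = g (Inr 0, Inl x)" "c (TJoin t u) = g (Inr 1, g (c t, c u))"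
    "c (TMeet t u) = g (Inr 2, g (c t, c u))" "c (TMinus t u) = g (Inr 3, g (c t, c u))"
    "c (Dense t) = g (Inr 4, c t)" "c (Split t u v) = g (Inr 5, g (c t, g (c u, c v)))" for x t u v
    by (simp_all add: c_def)
  have "c t = c u \<Longrightarrow> t = u" for t u
  proof (induction t arbitrary: u)
    case (Const x) then show ?case by (cases u) (simp_all add: c g')
  next
    case (TJoin t1 t2) then show ?case by (cases u) (simp_all add: c g')
  next
    case (TMeet t1 t2) then show ?case by (cases u) (simp_all add: c g')
  next
    case (TMinus t1 t2) then show ?case by (cases u) (simp_all add: c g')
  next
    case (Dense t) then show ?case by (cases u) (simp_all add: c g')
  next
    case (Split t1 t2 t3) then show ?case by (cases u) (simp_all add: c g')
  qed
  then show ?thesis using that by (auto simp: inj_def)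
qed

lemma completion_embeds:
  fixes M :: "'a struc"
  assumes M: "models M V4_theory"
  shows "\<exists>(N :: ('a + nat) struc) f. models N V4_completion \<and> embedding f M N"
proof -
  have SM: "separated M" using M by (simp add: V4_separated)
  obtain c :: "'a trm \<Rightarrow> 'a + nat" where c: "inj c" by (rule trm_encoding)
  \<comment> \<open>Terms that induce the same function of homomorphism and bits are identified;
    \<open>code\<close> stores a chosen representative of each class, and \<open>dec\<close> returns
    some term of it.\<close>
  define eqv where "eqv t u \<longleftrightarrow> (\<forall>h w. hom M h \<longrightarrow> ev h w t = ev h w u)" for t u :: "'a trm"
  define code where "code t = c (SOME u. eqv t u)" for t
  have eqv_some: "eqv t (SOME u. eqv t u)" for t
    by (rule someI[of _ t]) (simp add: eqv_def)
  have code: "code t = code u \<longleftrightarrow> eqv t u" for t u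
  proof
    assume "code t = code u"
    then have "(SOME v. eqv t v) = (SOME v. eqv u v)" using c by (simp add: code_def inj_eq)
    then show "eqv t u" using eqv_some[of t] eqv_some[of u] by (simp add: eqv_def)
  next
    assume "eqv t u"
    then have "eqv t = eqv u" by (auto simp: eqv_def fun_eq_iff)
    then show "code t = code u" by (simp add: code_def)
  qed
  define dec where "dec x = (SOME t. code t = x)" for x
  have code_dec: "code (dec (code t)) = code t" for t
    unfolding dec_def by (rule someI[of _ t]) simp
  have ev_dec: "ev h w (dec (code t)) = ev h w t" if "hom M h" for h w t
    using code_dec[of t] that unfolding code eqv_def by blast
  define N where "N = \<lparr>struc.carrier = range code, zero = code (Const (struc.zero M)),
    one = code (Const (struc.one M)),
    join = \<lambda>x y. code (TJoin (dec x) (dec y)), meet = \<lambda>x y. code (TMeet (dec x) (dec y)),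
    minus = \<lambda>x y. code (TMinus (dec x) (dec y))\<rparr>"
  have N: "struc.carrier N = range code" "struc.zero N = code (Const (struc.zero M))"
    "struc.one N = code (Const (struc.one M))"
    "struc.join N (code t) (code u) = code (TJoin t u)"
    "struc.meet N (code t) (code u) = code (TMeet t u)"
    "struc.minus N (code t) (code u) = code (TMinus t u)" for t u
    by (simp_all add: N_def code eqv_def ev_dec)
  have sN: "is_struc N" by (auto simp: is_struc_def N(1-3)) (simp_all add: N(4-6))
  have homN: "hom N (\<lambda>x. ev h w (dec x))" if h: "hom M h" for h w
    unfolding hom_def by (auto simp: N ev_dec[OF h] hom_simps[OF h])
  have SN: "separated N"
    unfolding separated_def
  proof (intro conjI ballI impI sN)
    fix x y assume "x \<in> struc.carrier N" "y \<in> struc.carrier N" and eq: "\<forall>h. hom N h \<longrightarrow> h x = h y"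
    then obtain t u where tu: "x = code t" "y = code u" by (auto simp: N)
    have "ev h w t = ev h w u" if h: "hom M h" for h w
      using eq[rule_format, OF homN[OF h, of w]] by (simp add: tu ev_dec[OF h])
    then show "x = y" by (simp add: tu code eqv_def)
  qed
  have zero: "code t = struc.zero N \<longleftrightarrow> (\<forall>h w. hom M h \<longrightarrow> ev h w t = F0)" for t
    by (auto simp: N code eqv_def hom_simps)
  have D4: "sat N s D4" for s
    unfolding sat_D4
  proof (intro ballI impI)
    fix a assume "a \<in> struc.carrier N"
    then obtain t where t: "a = code t" by (auto simp: N)
    assume a: "a = struc.minus N (struc.one N) (struc.minus N (struc.one N) a) \<and> a \<noteq> struc.zero N"
    have reg: "ev h w t = F1 - (F1 - ev h w t)" if h: "hom M h" for h w
    proof -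
      have "\<forall>h w. hom M h \<longrightarrow> ev h w t = h (struc.one M) - (h (struc.one M) - ev h w t)"
        using a[THEN conjunct1] unfolding t N code eqv_def by simp
      then show ?thesis using h hom_simps(2)[OF h] by metis
    qed
    obtain h w where hw: "hom M h" "ev h w t \<noteq> F0" using a unfolding t zero by blast
    have "ev h (w(Dense t := True)) (Dense t) = FM" using hw(2) by (simp add: ev_upd)
    then have "code (Dense t) \<noteq> struc.zero N" using hw(1) unfolding zero by (metis a5.distinct(1))
    moreover have "ev h w (TMinus t (Dense t)) = ev h w t" "ev h w (TMeet (Dense t) t) = ev h w (Dense t)"
      if h: "hom M h" for h w
      using reg[OF h, of w] by (cases "ev h w t"; simp add: a5_defs)+
    then have "struc.minus N a (code (Dense t)) = a" "struc.meet N (code (Dense t)) a = code (Dense t)"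
      unfolding t N code eqv_def by blast+
    ultimately show "\<exists>b \<in> struc.carrier N. b \<noteq> struc.zero N \<and> struc.minus N a b = a \<and> struc.meet N b a = b"
      by (auto simp: N(1))
  qed
  have S4: "sat N s S4" for s
    unfolding sat_S4
  proof (intro ballI impI)
    fix a b1 b2 assume "a \<in> struc.carrier N" "b1 \<in> struc.carrier N" "b2 \<in> struc.carrier N"
    then obtain t u v where t: "a = code t" "b1 = code u" "b2 = code v" by (auto simp: N)
    assume a: "struc.minus N a (struc.join N b1 b2) = a \<and>
      struc.meet N (struc.join N b1 b2) a = struc.join N b1 b2 \<and> a \<noteq> struc.zero N \<and>
      struc.meet N (struc.meet N b1 b2) (struc.minus N (struc.one N) a) = struc.zero N"
    have prem: "ev h w t - (ev h w u \<squnion> ev h w v) = ev h w t" "ev h w u \<squnion> ev h w v \<le> ev h w t"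
      "ev h w u \<sqinter> ev h w v \<sqinter> (F1 - ev h w t) = F0" if h: "hom M h" for h w
      using a h unfolding t N code eqv_def by (auto simp: hom_simps[OF h] le_iff_inf)
    let ?a1 = "Split t u v" and ?a2 = "TMinus t (Split t u v)"
    note split = pick_split[OF prem]
    \<comment> \<open>At a point where \<open>t\<close> is non-zero and both parameters vanish,
      \<open>Split t u v\<close> is all of \<open>t\<close> or zero as its bit says. If
      \<open>t\<close> has value \<open>FM\<close> the premise makes the parameters vanish;
      otherwise an end point lying in \<open>t\<close> is such a point.\<close>
    obtain h w where hw: "hom M h" "ev h w t \<noteq> F0" "ev h w u = F0" "ev h w v = F0"
    proof -
      obtain h w where h: "hom M h" and t0: "ev h w t \<noteq> F0" using a unfolding t zero by blast
      show ?thesis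
      proof (cases "ev h w t = FM")
        case True
        have "ev h w u = F0" "ev h w v = F0"
          using prem[OF h, of w] unfolding True by (cases "ev h w u"; cases "ev h w v"; simp add: a5_defs)+
        then show ?thesis using that h t0 by blast
      next
        case False
        then have "prL (ev h w t) = F1 \<or> prR (ev h w t) = F1"
          using t0 by (cases "ev h w t"; simp add: prL_def prR_def a5_defs)
        then obtain f where f: "f = prL \<or> f = prR" "f (ev h w t) = F1" by blast
        obtain w' where w': "\<And>s. ev (\<lambda>x. f (h x)) w' s = f (ev h w s)" using ev_end5[OF f(1)] by blast
        have fh: "hom M (\<lambda>x. f (h x))" using f(1) hom_prL[OF h] hom_prR[OF h] by blast
        have f01: "f x = F0 \<or> f x = F1" for x using f(1) by (auto simp: prL_def prR_def)
        have "x = F0 \<and> y = F0" if "F1 - (x \<squnion> y) = F1" "x = F0 \<or> x = F1" "y = F0 \<or> y = F1" for x y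
          using that by (elim disjE; simp add: a5_defs)
        from this[OF _ f01 f01] have "f (ev h w u) = F0" "f (ev h w v) = F0"
          using prem(1)[OF fh, of w'] unfolding w' f(2) by blast+
        then show ?thesis using that[OF fh, of w'] f(2) by (simp add: w')
      qed
    qed
    have "ev h (w(?a1 := True)) ?a1 = ev h w t" "ev h (w(?a1 := False)) ?a2 = ev h w t"
      using hw(2-4) by (simp_all add: ev_upd pick_def a5_defs)
    then have nz: "code ?a1 \<noteq> struc.zero N" "code ?a2 \<noteq> struc.zero N"
      using hw(1,2) unfolding zero by metis+
    have *: "struc.minus N a (code ?a2) = code ?a1" "struc.meet N b1 (code ?a1) = b1"
      "struc.minus N a (code ?a1) = code ?a2" "struc.meet N b2 (code ?a2) = b2"
      "struc.meet N (code ?a1) (code ?a2) = struc.meet N b1 b2"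
      unfolding t N code eqv_def using split by (simp_all add: inf.absorb1)
    show "\<exists>a1 \<in> struc.carrier N. \<exists>a2 \<in> struc.carrier N. a1 \<noteq> struc.zero N \<and> a2 \<noteq> struc.zero N \<and>
      struc.minus N a a2 = a1 \<and> struc.meet N b1 a1 = b1 \<and> struc.minus N a a1 = a2 \<and>
      struc.meet N b2 a2 = b2 \<and> struc.meet N a1 a2 = struc.meet N b1 b2"
      by (rule bexI[of _ "code ?a1"], rule bexI[of _ "code ?a2"]) (use nz * in \<open>auto simp: N(1)\<close>)
  qed
  have "embedding (\<lambda>x. code (Const x)) M N"
    unfolding embedding_def
  proof (intro conjI ballI)
    show "inj_on (\<lambda>x. code (Const x)) (struc.carrier M)"
    proof (rule inj_onI)
      fix x y assume "x \<in> struc.carrier M" "y \<in> struc.carrier M" "code (Const x) = code (Const y)"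
      then show "x = y" using separatedD[OF SM] by (simp add: code eqv_def)
    qed
  qed (auto simp: N code eqv_def hom_simps)
  moreover have "models N V4_completion" unfolding models_completion using SN D4 S4 by blast
  ultimately show ?thesis by blast
qed

theorem theorem7p4:
  shows "model_completion TYPE('a) TYPE('b) TYPE('c) V4_theory (V4_theory \<union> {D4, S4})"
  unfolding model_completion_def
proof (intro conjI allI impI)
  fix N :: "'b struc" assume "models N V4_completion"
  then show "models N V4_theory" by (simp add: models_def)
next
  fix M :: "'a struc" assume "models M V4_theory"
  then show "\<exists>(N :: ('a + nat) struc) f. models N V4_completion \<and> embedding f M N"
    by (rule completion_embeds)
next
  fix M :: "'a struc" and N1 :: "'b struc" and N2 :: "'c struc" and f1 f2 p
    and s :: "nat \<Rightarrow> 'a"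
  assume "models M V4_theory" "models N1 V4_completion" "embedding f1 M N1"
    "models N2 V4_completion" "embedding f2 M N2" "range s \<subseteq> struc.carrier M"
  then show "sat N1 (f1 \<circ> s) p \<longleftrightarrow> sat N2 (f2 \<circ> s) p" by (intro completion_complete)
qed

end
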